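(* Let $K$ be a (not necessarily finite) group, $\Gamma$ a finite set, $H\le\operatorname{Sym}(\Gamma)$, $W=K\wr_\Gamma H$ and $S=K\wr_\Gamma\operatorname{Sym}(\Gamma)$. Let $w\in S$ have top component $h$, and let $a\in K^\Gamma\rtimes\langle 1_H\rangle\le W$ be such that $u:=w^a=(f,h)$ is in sparse disjoint wreath cycle decomposition (such an $a$ exists), so that $C_W(w)=a\,C_W(u)\,a^{-1}$. Put \[ B_u:=\prod_{L\in\mathcal{L}(u)}C_K([\gamma_L]f)^{\{\operatorname{terr}(z)\,:\,z\in\mathcal{C}(L,u)\}}\times K^{\Gamma\setminus\operatorname{terr}(u)} \] (a direct product of groups). Then: (a) The map \[ \Phi: B_u\times\operatorname{Stab}_{C_H(h)}(\mathcal{P}(u))\longrightarrow C_W(u),\qquad (c,t)\mapsto (s,t), \] is a bijection, where, writing $c=\left((c_{L,z})_{L\in\mathcal{L}(u),\,z\in\mathcal{C}(L,u)},c_0\right)$ and $t=\left(\prod_{L\in\mathcal{L}(u)}\left(\prod_{z\in\mathcal{C}(L,u)}h_z^{e_z}\right)\cdot[\sigma_L]\Psi_L\right)\cdot\pi_0$, the function $s:\Gamma\to K$ is defined by \[ [\gamma]s=\begin{cases} x_z^{-1}\cdot c_{L,z}\cdot x_{[z]\sigma_L}, & \text{if }\gamma=\gamma_z^{h^{j-e_z}}\in\operatorname{terr}(u),\ e_z<j<|h_z|\text{ or }j=0,\\ x_z^{-1}\cdot c_{L,z}\cdot x_{[z]\sigma_L}\cdot[\gamma_{[z]\sigma_L}]f,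 & \text{if }\gamma=\gamma_z^{h^{j-e_z}}\in\operatorname{terr}(u),\ 1\le j\le e_z,\\ [\gamma]c_0, & \text{if }\gamma\notin\operatorname{terr}(u), \end{cases} \] with $z\in\mathcal{C}(L,u)$ in the first two cases. Consequently $(c,t)\mapsto a\cdot[(c,t)]\Phi\cdot a^{-1}$ is a bijection onto $C_W(w)$. (b) $C_W(w)$ is an extension of two groups: there is a short exact sequence of groups \[ \{1\}\to B_u\xrightarrow{\ \iota\ }C_W(w)\xrightarrow{\ \rho\ }\operatorname{Stab}_{C_H(h)}(\mathcal{P}(w))\to\{1\}, \] where $[c]\iota=a\cdot[(c,1_H)]\Phi\cdot a^{-1}$ and $[(s,t)]\rho=t$.
   Context: All groups act from the right; $x^y=y^{-1}xy$; $x^K$ is the $K$-conjugacy class of $x$. $K^\Gamma$ is the group of functions $\Gamma\to K$ under pointwise multiplication, $[\gamma]f$ is the image of $\gamma$ under $f$, and $\operatorname{Sym}(\Gamma)$ acts on $K^\Gamma$ by $[\gamma]f^h=[\gamma^{h^{-1}}]f$. $S=K\wr_\Gamma\operatorname{Sym}(\Gamma)=K^\Gamma\rtimes\operatorname{Sym}(\Gamma)$ consists of pairs $(f,h)$ with $(f,h)(e,g)=(f\cdot e^{h^{-1}},hg)$, and $W=K\wr_\Gamma H=\{(f,h)\in S:h\in H\}$. In $(f,h)$, $h$ is the top component. $C_W(w)=\{b\in W: bw=wb\}$ and $C_H(h)=\{t\in H:th=ht\}$. $\operatorname{supp}(h)$, $\operatorname{fix}(h)$ are the sets of moved and fixed points.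 The territory of $w=(f,h)\in S$ is $\operatorname{terr}(w)=\operatorname{supp}(h)\cup\{\gamma:[\gamma]f\ne1_K\}$. $w=(f,h)$ is a wreath cycle if either $h=1$ and $|\operatorname{terr}(w)|=1$, or $h$ is a single non-trivial cycle and $\operatorname{terr}(w)=\operatorname{supp}(h)$; it is sparse if there is $\gamma_0\in\Gamma$ with $[\gamma]f=1_K$ for all $\gamma\ne\gamma_0$. Elements are disjoint if their territories are disjoint. Every $w\in S$ is a product of pairwise disjoint wreath cycles in $S$, uniquely up to order; $\mathcal{C}(w)$ is the set of these wreath cycles. $w$ is in sparse disjoint wreath cycle decomposition if all elements of $\mathcal{C}(w)$ are sparse. For a wreath cycle $w=(f,h)$ and $\gamma\in\Gamma$ put $[\gamma,w]\operatorname{Yade}=\prod_{i=0}^{|h|-1}[\gamma^{h^i}]f$ (ordered product, $|h|$ the order of $h$). Its load is $\operatorname{ld}(w)=(([\alpha,w]\operatorname{Yade})^K,|h|)$ for any $\alpha\in\operatorname{terr}(w)$ (independent of $\alpha$). For $w\in S$: $\mathcal{L}(w)=\{\operatorname{ld}(z):z\in\mathcal{C}(w)\}$, $\mathcal{C}(L,w)=\{z\in\mathcal{C}(w):\operatorname{ld}(z)=L\}$. The territory decomposition $\mathcal{P}(w)$ is the family, indexed by $L\in\mathcal{L}(w)$, of the sets $\{\operatorname{terr}(z):z\in\mathcal{C}(L,w)\}$; $\mathcal{P}(w)^t$ replaces each $\operatorname{terr}(z)$ by $\operatorname{terr}(z)^t$, keeping the indexing, and stabilisers are with respect to this action. Choices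 for $u=(f,h)$ in sparse disjoint wreath cycle decomposition: write $z=(f_z,h_z)$ for $z\in\mathcal{C}(u)$. For each $z\in\mathcal{C}(u)$ fix $\gamma_z\in\operatorname{terr}(z)$ with $[\gamma]f=1_K$ for all $\gamma\in\operatorname{terr}(z)\setminus\{\gamma_z\}$. For each $L\in\mathcal{L}(u)$ fix a representative $z_L\in\mathcal{C}(L,u)$ and put $\gamma_L:=\gamma_{z_L}$ and $x_{z_L}:=1_K$; for every other $z\in\mathcal{C}(L,u)$ fix $x_z\in K$ with $[\gamma_z]f=x_z^{-1}\cdot[\gamma_L]f\cdot x_z$. For $\sigma\in\operatorname{Sym}(\mathcal{C}(L,u))$ let $[\sigma]\Psi_L\in\operatorname{Sym}(\Gamma)$ map $\gamma_z^{h_z^j}$ to $\gamma_{[z]\sigma}^{h_{[z]\sigma}^{j}}$ for $z\in\mathcal{C}(L,u)$, $j\in\mathbb{Z}$, and fix all other points. Each $t\in\operatorname{Stab}_{C_{\operatorname{Sym}(\Gamma)}(h)}(\mathcal{P}(u))$ can be written uniquely as $t=\left(\prod_{L}\left(\prod_{z\in\mathcal{C}(L,u)}h_z^{e_z}\right)\cdot[\sigma_L]\Psi_L\right)\cdot\pi_0$ with $e_z\in\{0,\dots,|h_z|-1\}$, $\sigma_L\in\operatorname{Sym}(\mathcal{C}(L,u))$ and $\pi_0\in\operatorname{Sym}(\Gamma\setminus\operatorname{terr}(u))$ (extended by the identity). Every $\gamma\in\operatorname{terr}(u)$ is uniquely $\gamma_z^{h^{j-e_z}}$ with $z\in\mathcal{C}(u)$,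 $0\le j<|h_z|$. In $c\in B_u$, $c_{L,z}\in C_K([\gamma_L]f)$ is the component at $\operatorname{terr}(z)$ and $c_0\in K^{\Gamma\setminus\operatorname{terr}(u)}$. *)

theory Defs
  imports "HOL-Algebra.Algebra" "HOL-Combinatorics.Orbits"
begin

section \<open>Wreath products with groups acting from the right\<close>

text \<open>
  Permutations of \<open>\<Gamma>\<close> are functions that fix everything outside \<open>\<Gamma>\<close>, and the image
  of \<open>\<gamma>\<close> under \<open>h\<close>, written \<open>\<gamma>\<^sup>h\<close> in right-action notation, is \<open>h \<gamma>\<close>. Since groups
  act from the right, the product \<open>h g\<close> is ``first \<open>h\<close>, then \<open>g\<close>'', that is \<open>g \<circ> h\<close>.
\<close>

definition sym_right :: "'g set \<Rightarrow> ('g \<Rightarrow> 'g) monoid" where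
  "sym_right \<Gamma> = \<lparr>carrier = {h. h permutes \<Gamma>}, monoid.mult = (\<lambda>h g. g \<circ> h), one = id\<rparr>"

type_synonym ('g, 'k) welt = "('g \<Rightarrow> 'k) \<times> ('g \<Rightarrow> 'g)"

abbreviation fun_group ::
  "('k, 'm) monoid_scheme \<Rightarrow> 'g set \<Rightarrow> ('g \<Rightarrow> 'k) monoid" where
  "fun_group K \<Gamma> \<equiv> product_group \<Gamma> (\<lambda>_. K)"

text \<open>
  The multiplication is \<open>(f,h)(e,g) = (f \<cdot> e\<^sup>k, h g)\<close> where \<open>k\<close> is the inverse of \<open>h\<close>; the
  image of \<open>\<gamma>\<close> under \<open>e\<^sup>k\<close> is \<open>e (h \<gamma>)\<close>. The argument \<open>H\<close> is the set of admissible top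
  components.
\<close>

definition wreath ::
  "('k, 'm) monoid_scheme \<Rightarrow> 'g set \<Rightarrow> ('g \<Rightarrow> 'g) set \<Rightarrow> ('g, 'k) welt monoid" where
  "wreath K \<Gamma> H =
     \<lparr>carrier = carrier (fun_group K \<Gamma>) \<times> H,
      monoid.mult = (\<lambda>(f, h) (e, g).
        (f \<otimes>\<^bsub>fun_group K \<Gamma>\<^esub> (\<lambda>\<gamma>\<in>\<Gamma>. e (h \<gamma>)), h \<otimes>\<^bsub>sym_right \<Gamma>\<^esub> g)),
      one = (\<one>\<^bsub>fun_group K \<Gamma>\<^esub>, \<one>\<^bsub>sym_right \<Gamma>\<^esub>)\<rparr>"

abbreviation swreath ::
  "('k, 'm) monoid_scheme \<Rightarrow> 'g set \<Rightarrow> ('g, 'k) welt monoid" where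
  "swreath K \<Gamma> \<equiv> wreath K \<Gamma> (carrier (sym_right \<Gamma>))"

definition centraliser :: "('a, 'm) monoid_scheme \<Rightarrow> 'a set \<Rightarrow> 'a \<Rightarrow> 'a set" where
  "centraliser G A x = {b \<in> A. b \<otimes>\<^bsub>G\<^esub> x = x \<otimes>\<^bsub>G\<^esub> b}"

definition conj_class :: "('a, 'm) monoid_scheme \<Rightarrow> 'a \<Rightarrow> 'a set" where
  "conj_class G x = {inv\<^bsub>G\<^esub> y \<otimes>\<^bsub>G\<^esub> x \<otimes>\<^bsub>G\<^esub> y | y. y \<in> carrier G}"

definition list_product :: "('a, 'm) monoid_scheme \<Rightarrow> 'a list \<Rightarrow> 'a" where
  "list_product G xs = foldr (monoid.mult G) xs \<one>\<^bsub>G\<^esub>"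

text \<open>
  Product of a finite family of pairwise commuting elements of a group that need not be
  commutative. An arbitrary enumeration of the index set is chosen; it is only used for
  commuting factors, where the result does not depend on the enumeration.
\<close>

definition set_product :: "('a, 'm) monoid_scheme \<Rightarrow> ('i \<Rightarrow> 'a) \<Rightarrow> 'i set \<Rightarrow> 'a" where
  "set_product G f A = list_product G (map f (SOME xs. distinct xs \<and> set xs = A))"

definition is_short_exact ::
  "('a, 'm) monoid_scheme \<Rightarrow> ('b, 'n) monoid_scheme \<Rightarrow> ('c, 'p) monoid_scheme \<Rightarrow>
   ('a \<Rightarrow> 'b) \<Rightarrow> ('b \<Rightarrow> 'c) \<Rightarrow> bool" where
  "is_short_exact A B C i r \<longleftrightarrow>
     group A \<and> group B \<and> group C \<and> i \<in> mon A B \<and> r \<in> epi B C \<and>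
     i ` carrier A = kernel B C r"


section \<open>Wreath cycles\<close>

definition supp :: "('g \<Rightarrow> 'g) \<Rightarrow> 'g set" where
  "supp h = {\<gamma>. h \<gamma> \<noteq> \<gamma>}"

definition terr :: "('k, 'm) monoid_scheme \<Rightarrow> 'g set \<Rightarrow> ('g, 'k) welt \<Rightarrow> 'g set" where
  "terr K \<Gamma> w = supp (snd w) \<union> {\<gamma> \<in> \<Gamma>. fst w \<gamma> \<noteq> \<one>\<^bsub>K\<^esub>}"

definition wreath_cycle :: "('k, 'm) monoid_scheme \<Rightarrow> 'g set \<Rightarrow> ('g, 'k) welt \<Rightarrow> bool" where
  "wreath_cycle K \<Gamma> w \<longleftrightarrow>
     w \<in> carrier (swreath K \<Gamma>) \<and>
     (snd w = id \<and> card (terr K \<Gamma> w) = 1 \<or>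
      cyclic_on (snd w) (supp (snd w)) \<and> terr K \<Gamma> w = supp (snd w))"

definition sparse :: "('k, 'm) monoid_scheme \<Rightarrow> 'g set \<Rightarrow> ('g, 'k) welt \<Rightarrow> bool" where
  "sparse K \<Gamma> w \<longleftrightarrow> (\<exists>\<gamma>0\<in>\<Gamma>. \<forall>\<gamma>\<in>\<Gamma>. \<gamma> \<noteq> \<gamma>0 \<longrightarrow> fst w \<gamma> = \<one>\<^bsub>K\<^esub>)"

definition is_cycle_decomp ::
  "('k, 'm) monoid_scheme \<Rightarrow> 'g set \<Rightarrow> ('g, 'k) welt \<Rightarrow> ('g, 'k) welt set \<Rightarrow> bool" where
  "is_cycle_decomp K \<Gamma> w D \<longleftrightarrow>
     finite D \<and> (\<forall>z\<in>D. wreath_cycle K \<Gamma> z) \<and>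
     pairwise (\<lambda>y z. terr K \<Gamma> y \<inter> terr K \<Gamma> z = {}) D \<and>
     w = set_product (swreath K \<Gamma>) (\<lambda>z. z) D"

text \<open>For finite \<open>\<Gamma>\<close>, every element of the wreath product has exactly one such decomposition.\<close>

definition cycles :: "('k, 'm) monoid_scheme \<Rightarrow> 'g set \<Rightarrow> ('g, 'k) welt \<Rightarrow> ('g, 'k) welt set" where
  "cycles K \<Gamma> w = (THE D. is_cycle_decomp K \<Gamma> w D)"

definition sparse_decomp :: "('k, 'm) monoid_scheme \<Rightarrow> 'g set \<Rightarrow> ('g, 'k) welt \<Rightarrow> bool" where
  "sparse_decomp K \<Gamma> w \<longleftrightarrow> (\<forall>z\<in>cycles K \<Gamma> w. sparse K \<Gamma> z)"

definition top_order :: "'g set \<Rightarrow> ('g, 'k) welt \<Rightarrow> nat" where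
  "top_order \<Gamma> w = group.ord (sym_right \<Gamma>) (snd w)"

definition yade :: "('k, 'm) monoid_scheme \<Rightarrow> 'g set \<Rightarrow> 'g \<Rightarrow> ('g, 'k) welt \<Rightarrow> 'k" where
  "yade K \<Gamma> \<gamma> w =
     list_product K (map (\<lambda>i. fst w ((snd w [^]\<^bsub>sym_right \<Gamma>\<^esub> i) \<gamma>)) [0..<top_order \<Gamma> w])"

text \<open>
  For a wreath cycle, the conjugacy class below does not depend on the chosen point \<open>\<alpha>\<close> of
  the territory.
\<close>

type_synonym 'k load = "'k set \<times> nat"

definition load :: "('k, 'm) monoid_scheme \<Rightarrow> 'g set \<Rightarrow> ('g, 'k) welt \<Rightarrow> 'k load" where
  "load K \<Gamma> w =
     (conj_class K (yade K \<Gamma> (SOME \<alpha>. \<alpha> \<in> terr K \<Gamma> w) w), top_order \<Gamma> w)"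

definition loads :: "('k, 'm) monoid_scheme \<Rightarrow> 'g set \<Rightarrow> ('g, 'k) welt \<Rightarrow> 'k load set" where
  "loads K \<Gamma> w = load K \<Gamma> ` cycles K \<Gamma> w"

definition cycles_load ::
  "('k, 'm) monoid_scheme \<Rightarrow> 'g set \<Rightarrow> 'k load \<Rightarrow> ('g, 'k) welt \<Rightarrow> ('g, 'k) welt set" where
  "cycles_load K \<Gamma> L w = {z \<in> cycles K \<Gamma> w. load K \<Gamma> z = L}"


section \<open>The territory decomposition and its stabiliser\<close>

definition terr_decomp ::
  "('k, 'm) monoid_scheme \<Rightarrow> 'g set \<Rightarrow> ('g, 'k) welt \<Rightarrow> 'k load \<Rightarrow> 'g set set" where
  "terr_decomp K \<Gamma> w = (\<lambda>L\<in>loads K \<Gamma> w. terr K \<Gamma> ` cycles_load K \<Gamma> L w)"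

definition family_action :: "'i set \<Rightarrow> ('g \<Rightarrow> 'g) \<Rightarrow> ('i \<Rightarrow> 'g set set) \<Rightarrow> ('i \<Rightarrow> 'g set set)" where
  "family_action I t P = (\<lambda>L\<in>I. (\<lambda>T. t ` T) ` P L)"

text \<open>For \<open>w = (f,h)\<close>: the stabiliser in the centraliser of \<open>h\<close> in \<open>H\<close>.\<close>

definition terr_stab ::
  "('k, 'm) monoid_scheme \<Rightarrow> 'g set \<Rightarrow> ('g \<Rightarrow> 'g) set \<Rightarrow> ('g, 'k) welt \<Rightarrow> ('g \<Rightarrow> 'g) set" where
  "terr_stab K \<Gamma> H w =
     stabilizer ((sym_right \<Gamma>)\<lparr>carrier := centraliser (sym_right \<Gamma>) H (snd w)\<rparr>)
       (family_action (loads K \<Gamma> w)) (terr_decomp K \<Gamma> w)"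


section \<open>Parametrisation of the centraliser\<close>

text \<open>
  The chosen points \<open>gam z\<close>, the representatives \<open>rep L\<close> of the cycles of load \<open>L\<close>, and
  the conjugating elements \<open>x z\<close>.
\<close>

definition wreath_choices ::
  "('k, 'm) monoid_scheme \<Rightarrow> 'g set \<Rightarrow> ('g, 'k) welt \<Rightarrow> (('g, 'k) welt \<Rightarrow> 'g) \<Rightarrow>
   ('k load \<Rightarrow> ('g, 'k) welt) \<Rightarrow> (('g, 'k) welt \<Rightarrow> 'k) \<Rightarrow> bool" where
  "wreath_choices K \<Gamma> u gam rep x \<longleftrightarrow>
     (\<forall>z\<in>cycles K \<Gamma> u. gam z \<in> terr K \<Gamma> z \<and>
        (\<forall>\<gamma>\<in>terr K \<Gamma> z - {gam z}. fst u \<gamma> = \<one>\<^bsub>K\<^esub>)) \<and>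
     (\<forall>L\<in>loads K \<Gamma> u. rep L \<in> cycles_load K \<Gamma> L u \<and> x (rep L) = \<one>\<^bsub>K\<^esub> \<and>
        (\<forall>z\<in>cycles_load K \<Gamma> L u - {rep L}. x z \<in> carrier K \<and>
           fst u (gam z) = inv\<^bsub>K\<^esub> (x z) \<otimes>\<^bsub>K\<^esub> fst u (gam (rep L)) \<otimes>\<^bsub>K\<^esub> x z))"

definition base_kernel ::
  "('k, 'm) monoid_scheme \<Rightarrow> 'g set \<Rightarrow> ('g, 'k) welt \<Rightarrow> (('g, 'k) welt \<Rightarrow> 'g) \<Rightarrow>
   ('k load \<Rightarrow> ('g, 'k) welt) \<Rightarrow> (('k load \<Rightarrow> 'g set \<Rightarrow> 'k) \<times> ('g \<Rightarrow> 'k)) monoid" where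
  "base_kernel K \<Gamma> u gam rep =
     product_group (loads K \<Gamma> u)
       (\<lambda>L. product_group (terr K \<Gamma> ` cycles_load K \<Gamma> L u)
         (\<lambda>_. K\<lparr>carrier := centraliser K (carrier K) (fst u (gam (rep L)))\<rparr>))
     \<times>\<times> fun_group K (\<Gamma> - terr K \<Gamma> u)"

definition psi ::
  "('k, 'm) monoid_scheme \<Rightarrow> 'g set \<Rightarrow> ('g, 'k) welt \<Rightarrow> (('g, 'k) welt \<Rightarrow> 'g) \<Rightarrow> 'k load \<Rightarrow>
   (('g, 'k) welt \<Rightarrow> ('g, 'k) welt) \<Rightarrow> 'g \<Rightarrow> 'g" where
  "psi K \<Gamma> u gam L \<sigma> =
     (THE p. p permutes \<Gamma> \<and>
        (\<forall>z\<in>cycles_load K \<Gamma> L u. \<forall>j::int.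
           p ((snd z [^]\<^bsub>sym_right \<Gamma>\<^esub> j) (gam z)) =
             (snd (\<sigma> z) [^]\<^bsub>sym_right \<Gamma>\<^esub> j) (gam (\<sigma> z))) \<and>
        (\<forall>\<gamma>. (\<forall>z\<in>cycles_load K \<Gamma> L u. \<forall>j::int. \<gamma> \<noteq> (snd z [^]\<^bsub>sym_right \<Gamma>\<^esub> j) (gam z))
           \<longrightarrow> p \<gamma> = \<gamma>))"

text \<open>
  \<open>(e, \<sigma>, \<pi>0)\<close> are the exponents, the permutations of the cycles of each load, and the
  permutation off the territory in the factorisation of \<open>t\<close>. The first two are extensional
  functions, so that they are determined by \<open>t\<close>.
\<close>

definition is_top_factorisation ::
  "('k, 'm) monoid_scheme \<Rightarrow> 'g set \<Rightarrow> ('g, 'k) welt \<Rightarrow> (('g, 'k) welt \<Rightarrow> 'g) \<Rightarrow> ('g \<Rightarrow> 'g) \<Rightarrow>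
   (('g, 'k) welt \<Rightarrow> nat) \<Rightarrow> ('k load \<Rightarrow> ('g, 'k) welt \<Rightarrow> ('g, 'k) welt) \<Rightarrow> ('g \<Rightarrow> 'g) \<Rightarrow> bool" where
  "is_top_factorisation K \<Gamma> u gam t e \<sigma> \<pi>0 \<longleftrightarrow>
     e \<in> (\<Pi>\<^sub>E z\<in>cycles K \<Gamma> u. {0..<top_order \<Gamma> z}) \<and>
     \<sigma> \<in> (\<Pi>\<^sub>E L\<in>loads K \<Gamma> u. {p. p permutes cycles_load K \<Gamma> L u}) \<and>
     \<pi>0 permutes (\<Gamma> - terr K \<Gamma> u) \<and>
     t = set_product (sym_right \<Gamma>)
           (\<lambda>L. set_product (sym_right \<Gamma>) (\<lambda>z. snd z [^]\<^bsub>sym_right \<Gamma>\<^esub> e z) (cycles_load K \<Gamma> L u)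
                \<otimes>\<^bsub>sym_right \<Gamma>\<^esub> psi K \<Gamma> u gam L (\<sigma> L))
           (loads K \<Gamma> u)
         \<otimes>\<^bsub>sym_right \<Gamma>\<^esub> \<pi>0"

text \<open>
  The component of \<open>c\<close> at the territory of \<open>z\<close> is \<open>c L (terr K \<Gamma> z)\<close> with \<open>L\<close> the load of \<open>z\<close>.
  Both definite descriptions pick out the unique coordinates: those of \<open>t\<close>, and those of the
  point \<open>\<gamma>\<close> of the territory relative to the shift by \<open>e z\<close>. As \<open>j\<close> is less than the order of
  \<open>z\<close>, the \<open>else\<close> case of the inner conditional is \<open>1 \<le> j \<le> e z\<close>.
\<close>

definition phi ::
  "('k, 'm) monoid_scheme \<Rightarrow> 'g set \<Rightarrow> ('g, 'k) welt \<Rightarrow> (('g, 'k) welt \<Rightarrow> 'g) \<Rightarrow>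
   (('g, 'k) welt \<Rightarrow> 'k) \<Rightarrow>
   (('k load \<Rightarrow> 'g set \<Rightarrow> 'k) \<times> ('g \<Rightarrow> 'k)) \<times> ('g \<Rightarrow> 'g) \<Rightarrow> ('g, 'k) welt" where
  "phi K \<Gamma> u gam x = (\<lambda>((c, c0), t).
     let (e, \<sigma>, \<pi>0) = (THE (e, \<sigma>, \<pi>0). is_top_factorisation K \<Gamma> u gam t e \<sigma> \<pi>0);
         s = (\<lambda>\<gamma>\<in>\<Gamma>.
           if \<gamma> \<in> terr K \<Gamma> u then
             let (z, j) = (THE (z, j). z \<in> cycles K \<Gamma> u \<and> j < top_order \<Gamma> z \<and>
                    \<gamma> = (snd u [^]\<^bsub>sym_right \<Gamma>\<^esub> (int j - int (e z))) (gam z));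
                 L = load K \<Gamma> z;
                 y = \<sigma> L z;
                 v = inv\<^bsub>K\<^esub> (x z) \<otimes>\<^bsub>K\<^esub> c L (terr K \<Gamma> z) \<otimes>\<^bsub>K\<^esub> x y
             in if e z < j \<or> j = 0 then v else v \<otimes>\<^bsub>K\<^esub> fst u (gam y)
           else c0 \<gamma>)
     in (s, t))"

end

theory Submission
  imports Defs
begin

text \<open>
  Let \<open>u = (f, h)\<close> be sparse. Comparing components, \<open>(s, t)\<close> commutes with \<open>u\<close> if and only if
  \<open>t\<close> commutes with \<open>h\<close> and \<open>s \<gamma> \<cdot> f (t \<gamma>) = f \<gamma> \<cdot> s (h \<gamma>)\<close> for all \<open>\<gamma>\<close>. The whole theorem is the
  solution of this equation for a given \<open>t\<close>.

  The possible \<open>t\<close> are found first. Conjugating by an element of the wreath product carries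
  wreath cycles to wreath cycles, moves territories by the top component and keeps loads
  (\<open>cycles_conj\<close>, \<open>load_conj\<close>). An element of the centraliser therefore permutes the wreath
  cycles of \<open>u\<close> within each load, so its top component stabilises the territory decomposition
  (\<open>centraliser_top_in_terr_stab\<close>). The same invariance, applied to an element with trivial top
  component, shows that \<open>w\<close> and its conjugate \<open>u\<close> have the same territory decomposition
  (\<open>terr_stab_base_conj\<close>). This is why the quotient in the exact sequence can be described by \<open>w\<close>.

  Now fix such a \<open>t\<close>. A wreath cycle \<open>z\<close> of \<open>u\<close> gets coordinates: the point \<open>pt z j\<close> is reached
  from the chosen point of \<open>z\<close> after \<open>j\<close> steps of \<open>h\<close>. As \<open>t\<close> commutes with \<open>h\<close>, it sends \<open>pt z j\<close> to
  \<open>pt y (j + e)\<close>, where \<open>y\<close> has the load of \<open>z\<close> and \<open>e\<close> is a shift modulo the length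
  (\<open>is_top_factorisation_iff\<close>). On the territory of \<open>z\<close> the function \<open>f\<close> is trivial except
  for the value \<open>F z\<close> at \<open>pt z 0\<close>. So along the cycle the equation says that \<open>s\<close> is constant except for
  two jumps: it is multiplied by \<open>F y\<close> on the right when \<open>t \<gamma>\<close> is the chosen point of \<open>y\<close>, and by the
  inverse of \<open>F z\<close> on the left when \<open>\<gamma>\<close> is the chosen point of \<open>z\<close>. Hence \<open>s\<close> is determined by its
  value \<open>v\<close> at \<open>pt z (- e)\<close>, and going once around closes up exactly if \<open>F z \<cdot> v = v \<cdot> F y\<close>
  (\<open>shifted_intertwiner_sequence\<close>, \<open>commute_iff\<close>). Because \<open>F z\<close> and \<open>F y\<close> are the conjugates of one
  element \<open>g\<close> by \<open>x z\<close> and \<open>x y\<close>, the solutions \<open>v\<close> are the products of the inverse of \<open>x z\<close>, an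
  element of the centraliser of \<open>g\<close>, and \<open>x y\<close> (\<open>intertwiner_iff\<close>). Off the territory of \<open>u\<close> the
  equation is void. These free choices are the coordinates of \<open>c\<close>, which gives the bijection.

  For \<open>t = 1\<close> all shifts vanish and \<open>s\<close> is the conjugate of \<open>c\<close> by \<open>x z\<close> on each territory, so
  \<open>\<Phi>\<close> is multiplicative there, and the exact sequence follows from the bijection.
\<close>

section \<open>Products, conjugation and centralisers in groups\<close>

lemma list_product_simps [simp]:
  "list_product G [] = \<one>\<^bsub>G\<^esub>"
  "list_product G (x # xs) = x \<otimes>\<^bsub>G\<^esub> list_product G xs"
  by (simp_all add: list_product_def)

lemma set_product_list:
  assumes "finite A"
  obtains xs where "distinct xs" "set xs = A" "set_product G f A = list_product G (map f xs)"
proof -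
  have "\<exists>xs. distinct xs \<and> set xs = A" using finite_distinct_list[OF assms] by blast
  then have "distinct (SOME xs. distinct xs \<and> set xs = A) \<and> set (SOME xs. distinct xs \<and> set xs = A) = A"
    by (rule someI_ex)
  then show thesis using that[of "SOME xs. distinct xs \<and> set xs = A"] by (simp add: set_product_def)
qed

context group
begin

lemma list_product_closed: "set xs \<subseteq> carrier G \<Longrightarrow> list_product G xs \<in> carrier G"
  by (induction xs) auto

lemma list_product_snoc:
  "set xs \<subseteq> carrier G \<Longrightarrow> y \<in> carrier G \<Longrightarrow> list_product G (xs @ [y]) = list_product G xs \<otimes> y"
  by (induction xs) (auto simp: m_assoc list_product_closed)

text \<open>Consecutive factors cancel. Conjugating a wreath cycle changes the factors of its Yade in this way,
so this is what makes the load invariant.\<close>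

lemma list_product_telescope:
  assumes "\<And>i. i \<le> n \<Longrightarrow> s i \<in> carrier G" "\<And>i. i < n \<Longrightarrow> f i \<in> carrier G"
    and "\<And>i. i < n \<Longrightarrow> g i = inv (s i) \<otimes> f i \<otimes> s (Suc i)"
  shows "list_product G (map g [0..<n]) = inv (s 0) \<otimes> list_product G (map f [0..<n]) \<otimes> s n"
  using assms
proof (induction n)
  case (Suc n)
  have c: "set (map f [0..<n]) \<subseteq> carrier G" using Suc.prems by auto
  have "list_product G (map g [0..<Suc n]) = list_product G (map g [0..<n]) \<otimes> g n"
    using Suc.prems by (simp add: list_product_snoc image_subset_iff)
  also have "\<dots> = inv (s 0) \<otimes> list_product G (map f [0..<n]) \<otimes> s n \<otimes> (inv (s n) \<otimes> f n \<otimes> s (Suc n))"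
    using Suc by simp
  also have "\<dots> = inv (s 0) \<otimes> (list_product G (map f [0..<n]) \<otimes> f n) \<otimes> s (Suc n)"
    using Suc.prems list_product_closed[OF c] by (simp add: m_assoc inv_solve_left' r_inv l_inv flip: m_assoc[of "s n"])
  also have "list_product G (map f [0..<n]) \<otimes> f n = list_product G (map f [0..<Suc n])"
    using Suc.prems c by (simp add: list_product_snoc)
  finally show ?case .
qed simp

lemma conj_eq_one_iff:
  assumes "x \<in> carrier G" "a \<in> carrier G"
  shows "inv a \<otimes> x \<otimes> a = \<one> \<longleftrightarrow> x = \<one>"
proof
  assume "inv a \<otimes> x \<otimes> a = \<one>"
  then have "inv a \<otimes> (x \<otimes> a) = inv a \<otimes> a" using assms by (simp add: m_assoc)
  then have "x \<otimes> a = \<one> \<otimes> a" using assms by (simp only: l_cancel inv_closed m_closed l_one)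
  then show "x = \<one>" using assms by (simp only: r_cancel one_closed)
qed (use assms in simp)

lemma conj_class_conj:
  assumes "x \<in> carrier G" "a \<in> carrier G"
  shows "conj_class G (inv a \<otimes> x \<otimes> a) = conj_class G x"
proof
  show "conj_class G (inv a \<otimes> x \<otimes> a) \<subseteq> conj_class G x"
  proof
    fix v assume "v \<in> conj_class G (inv a \<otimes> x \<otimes> a)"
    then obtain y where y: "y \<in> carrier G" "v = inv y \<otimes> (inv a \<otimes> x \<otimes> a) \<otimes> y"
      by (auto simp: conj_class_def)
    then have "v = inv (a \<otimes> y) \<otimes> x \<otimes> (a \<otimes> y)" using assms by (simp add: inv_mult_group m_assoc)
    then show "v \<in> conj_class G x" using assms y by (auto simp: conj_class_def)
  qed
  show "conj_class G x \<subseteq> conj_class G (inv a \<otimes> x \<otimes> a)"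
  proof
    fix v assume "v \<in> conj_class G x"
    then obtain y where y: "y \<in> carrier G" "v = inv y \<otimes> x \<otimes> y"
      by (auto simp: conj_class_def)
    then have "v = inv (inv a \<otimes> y) \<otimes> (inv a \<otimes> x \<otimes> a) \<otimes> (inv a \<otimes> y)"
      using assms by (simp add: inv_mult_group m_assoc) (simp flip: m_assoc)
    then show "v \<in> conj_class G (inv a \<otimes> x \<otimes> a)" using assms y by (auto simp: conj_class_def)
  qed
qed

lemma subgroup_centraliser:
  assumes A: "subgroup A G" and x: "x \<in> carrier G"
  shows "subgroup (centraliser G A x) G"
proof (rule subgroupI)
  note sub = subgroup.mem_carrier[OF A]
  show "centraliser G A x \<subseteq> carrier G" using sub by (auto simp: centraliser_def)
  show "centraliser G A x \<noteq> {}"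
    using subgroup.one_closed[OF A] x by (auto simp: centraliser_def)
  fix b assume b: "b \<in> centraliser G A x"
  then have bc: "b \<in> carrier G" and bx: "b \<otimes> x = x \<otimes> b" using sub by (auto simp: centraliser_def)
  have "inv b \<otimes> x = inv b \<otimes> (x \<otimes> b) \<otimes> inv b" using bc x by (simp add: m_assoc)
  also have "\<dots> = x \<otimes> inv b" unfolding bx[symmetric] using bc x by (simp flip: m_assoc)
  finally show "inv b \<in> centraliser G A x"
    using b subgroup.m_inv_closed[OF A] by (simp add: centraliser_def)
  fix c assume c: "c \<in> centraliser G A x"
  then have cc: "c \<in> carrier G" and cx: "c \<otimes> x = x \<otimes> c" using sub by (auto simp: centraliser_def)
  have "b \<otimes> c \<otimes> x = b \<otimes> x \<otimes> c" using bc cc x cx by (simp add: m_assoc)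
  also have "\<dots> = x \<otimes> (b \<otimes> c)" unfolding bx using bc cc x by (simp add: m_assoc)
  finally show "b \<otimes> c \<in> centraliser G A x"
    using b c subgroup.m_closed[OF A] by (simp add: centraliser_def)
qed

lemma centraliser_conj:
  assumes A: "subgroup A G" and a: "a \<in> A" and w: "w \<in> carrier G"
  shows "centraliser G A w = (\<lambda>b. a \<otimes> b \<otimes> inv a) ` centraliser G A (inv a \<otimes> w \<otimes> a)"
proof (rule subset_antisym)
  note sub = subgroup.mem_carrier[OF A] note ac = sub[OF a]
  note clo = subgroup.m_closed[OF A] subgroup.m_inv_closed[OF A]
  have cancel: "a \<otimes> (inv a \<otimes> z) = z" "inv a \<otimes> (a \<otimes> z) = z" if "z \<in> carrier G" for z
    using that ac by (simp_all flip: m_assoc)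
  show "centraliser G A w \<subseteq> (\<lambda>b. a \<otimes> b \<otimes> inv a) ` centraliser G A (inv a \<otimes> w \<otimes> a)"
  proof
    fix b assume b: "b \<in> centraliser G A w"
    then have bA: "b \<in> A" and bw: "b \<otimes> w = w \<otimes> b" by (auto simp: centraliser_def)
    note bc = sub[OF bA]
    have "(inv a \<otimes> b \<otimes> a) \<otimes> (inv a \<otimes> w \<otimes> a) = inv a \<otimes> (b \<otimes> w) \<otimes> a"
      using ac bc w by (simp add: m_assoc cancel)
    also have "\<dots> = (inv a \<otimes> w \<otimes> a) \<otimes> (inv a \<otimes> b \<otimes> a)"
      unfolding bw using ac bc w by (simp add: m_assoc cancel)
    finally have "inv a \<otimes> b \<otimes> a \<in> centraliser G A (inv a \<otimes> w \<otimes> a)"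
      using a bA clo by (simp add: centraliser_def)
    moreover have "b = a \<otimes> (inv a \<otimes> b \<otimes> a) \<otimes> inv a"
      using ac bc by (simp add: m_assoc cancel)
    ultimately show "b \<in> (\<lambda>b. a \<otimes> b \<otimes> inv a) ` centraliser G A (inv a \<otimes> w \<otimes> a)" by blast
  qed
  show "(\<lambda>b. a \<otimes> b \<otimes> inv a) ` centraliser G A (inv a \<otimes> w \<otimes> a) \<subseteq> centraliser G A w"
  proof
    fix v assume "v \<in> (\<lambda>b. a \<otimes> b \<otimes> inv a) ` centraliser G A (inv a \<otimes> w \<otimes> a)"
    then obtain b where v: "v = a \<otimes> b \<otimes> inv a" and bA: "b \<in> A"
      and bw: "b \<otimes> (inv a \<otimes> w \<otimes> a) = (inv a \<otimes> w \<otimes> a) \<otimes> b" by (auto simp: centraliser_def)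
    note bc = sub[OF bA]
    have "v \<otimes> w = a \<otimes> (b \<otimes> (inv a \<otimes> w \<otimes> a)) \<otimes> inv a"
      unfolding v using ac bc w by (simp add: m_assoc cancel)
    also have "\<dots> = w \<otimes> v"
      unfolding v bw using ac bc w by (simp add: m_assoc cancel)
    finally show "v \<in> centraliser G A w" using a bA clo by (simp add: centraliser_def v)
  qed
qed

text \<open>The commutation equation along one wreath cycle of length \<open>n\<close> whose image is shifted by \<open>e\<close>.
The sequence \<open>S\<close> is the function \<open>s\<close> read from the point that is sent to a chosen point, so that
the right jump happens at \<open>0\<close> and the left jump at \<open>e\<close>. The intertwining relation is the condition
that the sequence closes up after \<open>n\<close> steps.\<close>

lemma shifted_intertwiner_sequence:
  fixes S :: "int \<Rightarrow> 'a" and n e :: int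
  assumes n: "0 \<le> e" "e < n" and per: "\<And>j. S (j mod n) = S j"
    and G: "\<And>j. S j \<in> carrier G" "a \<in> carrier G" "b \<in> carrier G"
  shows "(\<forall>j. S j \<otimes> (if n dvd j then b else \<one>) = (if n dvd j - e then a else \<one>) \<otimes> S (j + 1)) \<longleftrightarrow>
    a \<otimes> S 0 = S 0 \<otimes> b \<and> (\<forall>j. 0 \<le> j \<longrightarrow> j < n \<longrightarrow> S j = (if e < j \<or> j = 0 then S 0 else S 0 \<otimes> b))"
    (is "?L \<longleftrightarrow> ?R")
proof
  have dv: "n dvd j - i \<longleftrightarrow> j = i" if "0 \<le> j" "j < n" "0 \<le> i" "i < n" for i j
    using that by (metis mod_eq_dvd_iff mod_pos_pos_trivial)
  have Sn: "S n = S 0" using per[of n] n by simp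
  show ?R if L: ?L
  proof -
    \<comment> \<open>After the right jump the sequence keeps its value up to position \<open>e\<close>.\<close>
    have up: "S (1 + int k) = S 0 \<otimes> b" if "1 + int k \<le> e" for k
      using that
    proof (induction k)
      case 0
      then show ?case using L[rule_format, of 0] dv[of 0 e] n G by simp
    next
      case (Suc k)
      then show ?case using L[rule_format, of "1 + int k"] dv[of "1 + int k" e] dv[of "1 + int k" 0] n G
        by (simp add: add.commute)
    qed
    \<comment> \<open>Read backwards from \<open>S n = S 0\<close>, the sequence is constant until the left jump at \<open>e\<close>.\<close>
    have down: "S (n - int k) = S 0" if "e < n - int k" for k
      using that
    proof (induction k)
      case 0
      then show ?case using Sn by simp
    next
      case (Suc k)
      let ?j = "n - int (Suc k)"
      have "S ?j = S (?j + 1)"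
        using Suc.prems L[rule_format, of ?j] dv[of ?j e] dv[of ?j 0] n G by simp
      also have "?j + 1 = n - int k" by simp
      finally show ?case using Suc by simp
    qed
    have up': "S j = S 0 \<otimes> b" if "1 \<le> j" "j \<le> e" for j
      using up[of "nat (j - 1)"] that by simp
    have down': "S j = S 0" if "e < j" "j \<le> n" for j
      using down[of "nat (n - j)"] that by simp
    have "S e \<otimes> (if n dvd e then b else \<one>) = a \<otimes> S (e + 1)"
      using L[rule_format, of e] by simp
    then have "a \<otimes> S 0 = S 0 \<otimes> b"
      using up'[of e] down'[of "e + 1"] dv[of e 0] n G by (cases "e = 0") auto
    then show ?thesis using up' down' by auto
  qed
  show ?L if R: ?R
  proof
    fix j
    \<comment> \<open>By periodicity one period suffices; the successor of \<open>n - 1\<close> wraps around to \<open>0\<close>.\<close>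
    define i where "i = j mod n"
    have i: "0 \<le> i" "i < n" using n by (simp_all add: i_def)
    have Sj: "S j = S i" "S (j + 1) = S ((i + 1) mod n)"
      using per[of j] per[of "j + 1"] by (simp_all add: i_def mod_simps)
    have d: "n dvd j \<longleftrightarrow> i = 0" "n dvd j - e \<longleftrightarrow> i = e"
      using n mod_eq_dvd_iff[of j n e] by (auto simp: i_def mod_pos_pos_trivial)
    have S': "S k = (if e < k \<or> k = 0 then S 0 else S 0 \<otimes> b)" if "0 \<le> k" "k < n" for k
      using R that by blast
    have "S i \<otimes> (if i = 0 then b else \<one>) = (if i = e then a else \<one>) \<otimes> S ((i + 1) mod n)"
    proof -
      have "S ((i + 1) mod n) = (if e < i + 1 \<or> i + 1 = n then S 0 else S 0 \<otimes> b)"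
      proof (cases "i + 1 = n")
        case False
        then have "(i + 1) mod n = i + 1" using i by (simp add: mod_pos_pos_trivial)
        then show ?thesis using S'[of "i + 1"] i False by simp
      qed simp
      moreover have "S i = (if e < i \<or> i = 0 then S 0 else S 0 \<otimes> b)" by (rule S'[OF i])
      moreover have "a \<otimes> S 0 = S 0 \<otimes> b" using R by blast
      moreover have "e < i \<or> i = e \<or> i < e" by linarith
      ultimately show ?thesis using i n G by (elim disjE) (simp_all split: if_splits)
    qed
    then show "S j \<otimes> (if n dvd j then b else \<one>) = (if n dvd j - e then a else \<one>) \<otimes> S (j + 1)"
      by (simp add: Sj d)
  qed
qed

text \<open>Intertwiners between two conjugates of \<open>g\<close> form a double translate of the centraliser of \<open>g\<close>.\<close>

lemma conj_intertwiner_iff: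
  assumes "a \<in> carrier G" "b \<in> carrier G" "g \<in> carrier G" "d \<in> carrier G"
  shows "(inv a \<otimes> g \<otimes> a) \<otimes> (inv a \<otimes> d \<otimes> b) = (inv a \<otimes> d \<otimes> b) \<otimes> (inv b \<otimes> g \<otimes> b) \<longleftrightarrow> d \<otimes> g = g \<otimes> d"
proof -
  have cancel: "y \<otimes> (inv y \<otimes> z) = z" if "y \<in> carrier G" "z \<in> carrier G" for y z
    using that by (simp flip: m_assoc)
  have "(inv a \<otimes> g \<otimes> a) \<otimes> (inv a \<otimes> d \<otimes> b) = inv a \<otimes> (g \<otimes> d \<otimes> b)"
    using assms by (simp add: m_assoc cancel)
  moreover have "(inv a \<otimes> d \<otimes> b) \<otimes> (inv b \<otimes> g \<otimes> b) = inv a \<otimes> (d \<otimes> g \<otimes> b)"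
    using assms by (simp add: m_assoc cancel)
  moreover have "inv a \<otimes> (g \<otimes> d \<otimes> b) = inv a \<otimes> (d \<otimes> g \<otimes> b) \<longleftrightarrow> g \<otimes> d \<otimes> b = d \<otimes> g \<otimes> b"
    using assms by (intro Units_l_cancel) (auto simp: Units_eq)
  moreover have "g \<otimes> d \<otimes> b = d \<otimes> g \<otimes> b \<longleftrightarrow> g \<otimes> d = d \<otimes> g"
    using assms by (intro right_cancel) auto
  ultimately show ?thesis by metis
qed

end

section \<open>Permutations acting from the right\<close>

lemma sym_right_carrier: "carrier (sym_right \<Gamma>) = {h. h permutes \<Gamma>}"
  by (simp add: sym_right_def)

lemma sym_right_simps [simp]:
  "h \<otimes>\<^bsub>sym_right \<Gamma>\<^esub> g = g \<circ> h"
  "\<one>\<^bsub>sym_right \<Gamma>\<^esub> = id"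
  by (simp_all add: sym_right_def)

lemma group_sym_right: "group (sym_right \<Gamma>)"
proof (rule groupI)
  fix h assume "h \<in> carrier (sym_right \<Gamma>)"
  then show "\<exists>g\<in>carrier (sym_right \<Gamma>). g \<otimes>\<^bsub>sym_right \<Gamma>\<^esub> h = \<one>\<^bsub>sym_right \<Gamma>\<^esub>"
    by (intro bexI[of _ "Hilbert_Choice.inv h"]) (auto simp: sym_right_carrier permutes_inv permutes_inv_o)
qed (auto simp: sym_right_carrier permutes_compose permutes_id o_assoc)

lemma sym_right_nat_pow: "h [^]\<^bsub>sym_right \<Gamma>\<^esub> (n::nat) = h ^^ n"
  by (induction n) (auto simp: nat_pow_def sym_right_def)

text \<open>On the block of one factor all other factors act trivially, so the product can be evaluated
pointwise, whatever the enumeration is.\<close>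

lemma sym_right_list_product_apply:
  assumes "distinct xs" "\<And>x. x \<in> set xs \<Longrightarrow> F x permutes A x"
    and "\<And>x y. x \<in> set xs \<Longrightarrow> y \<in> set xs \<Longrightarrow> x \<noteq> y \<Longrightarrow> A x \<inter> A y = {}"
  shows "(\<forall>x\<in>set xs. \<forall>\<gamma>\<in>A x. list_product (sym_right \<Gamma>) (map F xs) \<gamma> = F x \<gamma>) \<and>
    (\<forall>\<gamma>. \<gamma> \<notin> (\<Union>x\<in>set xs. A x) \<longrightarrow> list_product (sym_right \<Gamma>) (map F xs) \<gamma> = \<gamma>)"
  using assms
proof (induction xs)
  case (Cons y ys)
  have IH: "\<forall>x\<in>set ys. \<forall>\<gamma>\<in>A x. list_product (sym_right \<Gamma>) (map F ys) \<gamma> = F x \<gamma>"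
    "\<forall>\<gamma>. \<gamma> \<notin> (\<Union>x\<in>set ys. A x) \<longrightarrow> list_product (sym_right \<Gamma>) (map F ys) \<gamma> = \<gamma>"
    using Cons by auto
  have Fy: "F y permutes A y" using Cons by auto
  have disj: "A y \<inter> A x = {}" if "x \<in> set ys" for x
    using that Cons.prems(1) Cons.prems(3)[of y x] by auto
  show ?case
  proof (intro conjI ballI allI impI)
    fix x \<gamma> assume x: "x \<in> set (y # ys)" and g: "\<gamma> \<in> A x"
    show "list_product (sym_right \<Gamma>) (map F (y # ys)) \<gamma> = F x \<gamma>"
    proof (cases "x = y")
      case True
      then have "F y \<gamma> \<in> A y" using g Fy by (simp add: permutes_in_image)
      then have "F y \<gamma> \<notin> (\<Union>x\<in>set ys. A x)" using disj by blast
      then show ?thesis using IH(2) True by simp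
    next
      case False
      then have "x \<in> set ys" "\<gamma> \<notin> A y" using x g disj[of x] by auto
      moreover have "F y \<gamma> = \<gamma>" using \<open>\<gamma> \<notin> A y\<close> Fy by (simp add: permutes_def)
      ultimately show ?thesis using IH(1) g by simp
    qed
  next
    fix \<gamma> assume g: "\<gamma> \<notin> (\<Union>x\<in>set (y # ys). A x)"
    then have "F y \<gamma> = \<gamma>" using Fy by (simp add: permutes_def)
    then show "list_product (sym_right \<Gamma>) (map F (y # ys)) \<gamma> = \<gamma>" using IH(2) g by simp
  qed
qed simp

lemma sym_right_set_product_apply:
  assumes "finite I" "\<And>i. i \<in> I \<Longrightarrow> F i permutes A i"
    and "\<And>i j. i \<in> I \<Longrightarrow> j \<in> I \<Longrightarrow> i \<noteq> j \<Longrightarrow> A i \<inter> A j = {}"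
  shows "\<And>i \<gamma>. i \<in> I \<Longrightarrow> \<gamma> \<in> A i \<Longrightarrow> set_product (sym_right \<Gamma>) F I \<gamma> = F i \<gamma>"
    and "\<And>\<gamma>. \<gamma> \<notin> (\<Union>i\<in>I. A i) \<Longrightarrow> set_product (sym_right \<Gamma>) F I \<gamma> = \<gamma>"
proof -
  obtain xs where xs: "distinct xs" "set xs = I"
    "set_product (sym_right \<Gamma>) F I = list_product (sym_right \<Gamma>) (map F xs)"
    using set_product_list[OF assms(1)] by metis
  have *: "(\<forall>x\<in>set xs. \<forall>\<gamma>\<in>A x. list_product (sym_right \<Gamma>) (map F xs) \<gamma> = F x \<gamma>) \<and>
    (\<forall>\<gamma>. \<gamma> \<notin> (\<Union>x\<in>set xs. A x) \<longrightarrow> list_product (sym_right \<Gamma>) (map F xs) \<gamma> = \<gamma>)"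
    by (rule sym_right_list_product_apply) (use assms xs in auto)
  show "\<And>i \<gamma>. i \<in> I \<Longrightarrow> \<gamma> \<in> A i \<Longrightarrow> set_product (sym_right \<Gamma>) F I \<gamma> = F i \<gamma>"
    and "\<And>\<gamma>. \<gamma> \<notin> (\<Union>i\<in>I. A i) \<Longrightarrow> set_product (sym_right \<Gamma>) F I \<gamma> = \<gamma>"
    using * xs by auto
qed

lemma sym_right_set_product_permutes:
  assumes "finite I" "\<And>i. i \<in> I \<Longrightarrow> F i permutes A i"
  shows "set_product (sym_right \<Gamma>) F I permutes (\<Union>i\<in>I. A i)"
proof -
  obtain xs where xs: "set xs = I"
    "set_product (sym_right \<Gamma>) F I = list_product (sym_right \<Gamma>) (map F xs)"
    using set_product_list[OF assms(1)] by metis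
  have "set ys \<subseteq> I \<Longrightarrow> list_product (sym_right \<Gamma>) (map F ys) permutes (\<Union>i\<in>I. A i)" for ys
  proof (induction ys)
    case (Cons y ys)
    have "F y permutes (\<Union>i\<in>I. A i)"
      using Cons.prems assms(2)[of y] by (auto intro: permutes_subset)
    then show ?case using Cons by (auto simp: comp_def dest: permutes_compose)
  qed (simp add: permutes_id)
  then show ?thesis using xs by auto
qed

text \<open>A finite set closed under a permutation is closed under its inverse. This allows integer exponents
below although closure is only known for single forward steps.\<close>

lemma permutes_closed_finite:
  assumes "h permutes \<Gamma>" "finite A" "\<And>\<gamma>. \<gamma> \<in> A \<Longrightarrow> h \<gamma> \<in> A" "h \<delta> \<in> A"
  shows "\<delta> \<in> A"
proof -
  have "h ` A = A"
    using assms by (intro card_subset_eq) (auto intro: card_image permutes_inj_on[THEN inj_on_subset])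
  then obtain \<gamma> where "\<gamma> \<in> A" "h \<gamma> = h \<delta>" using assms(4) by force
  then show ?thesis using permutes_inj[OF assms(1)] by (auto dest: injD)
qed

locale finite_wreath = group K for K :: "('k, 'm) monoid_scheme" (structure) +
  fixes \<Gamma> :: "'g set"
  assumes finite_\<Gamma>: "finite \<Gamma>"
begin

sublocale sym: group "sym_right \<Gamma>"
  by (rule group_sym_right)

abbreviation ipow :: "('g \<Rightarrow> 'g) \<Rightarrow> int \<Rightarrow> 'g \<Rightarrow> 'g" where
  "ipow h j \<equiv> h [^]\<^bsub>sym_right \<Gamma>\<^esub> j"

lemma ipow_add: "h permutes \<Gamma> \<Longrightarrow> ipow h i (ipow h j \<gamma>) = ipow h (i + j) \<gamma>"
  using sym.int_pow_mult[of h j i] by (simp add: sym_right_carrier add.commute)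

lemma ipow_Suc: "h permutes \<Gamma> \<Longrightarrow> ipow h (j + 1) \<gamma> = h (ipow h j \<gamma>)"
  using ipow_add[of h 1 j \<gamma>] sym.int_pow_1[of h] by (simp add: sym_right_carrier add.commute)

lemma ipow_int: "ipow h (int n) = h ^^ n"
  by (simp add: int_pow_int sym_right_nat_pow)

text \<open>Commutation with \<open>p\<close> is needed only along the orbit of \<open>\<gamma>\<close>, as \<open>A\<close> may be a single territory.\<close>

lemma ipow_intertwine:
  assumes "h permutes \<Gamma>" "h' permutes \<Gamma>" "\<And>\<gamma>. \<gamma> \<in> A \<Longrightarrow> p (h \<gamma>) = h' (p \<gamma>)"
    and "\<And>j. ipow h j \<gamma> \<in> A"
  shows "p (ipow h j \<gamma>) = ipow h' j (p \<gamma>)"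
proof (induction j rule: int_induct[where k = 0])
  case base show ?case by simp
next
  case (step1 i) then show ?case using assms by (simp add: ipow_Suc)
next
  case (step2 i)
  have "h' (p (ipow h (i - 1) \<gamma>)) = h' (ipow h' (i - 1) (p \<gamma>))"
    using step2 assms(3)[OF assms(4), of "i - 1"] ipow_Suc[OF assms(1), of "i - 1" \<gamma>]
      ipow_Suc[OF assms(2), of "i - 1" "p \<gamma>"] by simp
  then show ?case using permutes_inj[OF assms(2)] by (auto dest: injD)
qed

lemma ipow_closed:
  assumes "h permutes \<Gamma>" "finite A" "\<And>\<gamma>. \<gamma> \<in> A \<Longrightarrow> h \<gamma> \<in> A" "\<gamma> \<in> A"
  shows "ipow h j \<gamma> \<in> A"
proof (induction j rule: int_induct[where k = 0])
  case base show ?case using assms by simp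
next
  case (step1 i) then show ?case using assms by (simp add: ipow_Suc)
next
  case (step2 i)
  then show ?case using permutes_closed_finite[OF assms(1-3), of "ipow h (i - 1) \<gamma>"]
      ipow_Suc[OF assms(1), of "i - 1" \<gamma>] by simp
qed

lemma ipow_cong:
  assumes "h permutes \<Gamma>" "g permutes \<Gamma>" "finite A" "\<And>\<gamma>. \<gamma> \<in> A \<Longrightarrow> h \<gamma> \<in> A"
    "\<And>\<gamma>. \<gamma> \<in> A \<Longrightarrow> g \<gamma> = h \<gamma>" "\<gamma> \<in> A"
  shows "ipow g j \<gamma> = ipow h j \<gamma>"
  using ipow_intertwine[of h g A "\<lambda>x. x" \<gamma> j] ipow_closed[of h A] assms by simp

lemma ord_permutation_pos: "h permutes \<Gamma> \<Longrightarrow> sym.ord h > 0"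
  using sym.ord_ge_1[of h] finite_permutations[OF finite_\<Gamma>] by (fastforce simp: sym_right_carrier)

section \<open>The wreath product as a group\<close>

lemma wreath_mult:
  "w \<otimes>\<^bsub>wreath K \<Gamma> H\<^esub> v = (\<lambda>\<gamma>\<in>\<Gamma>. fst w \<gamma> \<otimes> fst v (snd w \<gamma>), snd v \<circ> snd w)"
  by (auto simp: wreath_def split_def restrict_def)

lemma wreath_one: "\<one>\<^bsub>wreath K \<Gamma> H\<^esub> = (\<lambda>\<gamma>\<in>\<Gamma>. \<one>, id)"
  by (simp add: wreath_def)

lemma wreath_carrier:
  "w \<in> carrier (wreath K \<Gamma> H) \<longleftrightarrow> fst w \<in> (\<Pi>\<^sub>E \<gamma>\<in>\<Gamma>. carrier K) \<and> snd w \<in> H"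
  by (auto simp: wreath_def mem_Times_iff)

lemma swreath_carrier:
  "w \<in> carrier (swreath K \<Gamma>) \<longleftrightarrow> fst w \<in> (\<Pi>\<^sub>E \<gamma>\<in>\<Gamma>. carrier K) \<and> snd w permutes \<Gamma>"
  by (simp add: wreath_carrier sym_right_carrier)

lemma swreath_closed:
  "w \<in> carrier (swreath K \<Gamma>) \<Longrightarrow> \<gamma> \<in> \<Gamma> \<Longrightarrow> fst w \<gamma> \<in> carrier K"
  "w \<in> carrier (swreath K \<Gamma>) \<Longrightarrow> snd w permutes \<Gamma>"
  "w \<in> carrier (swreath K \<Gamma>) \<Longrightarrow> snd w \<gamma> \<in> \<Gamma> \<longleftrightarrow> \<gamma> \<in> \<Gamma>"
  by (auto simp: swreath_carrier permutes_in_image)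

lemma swreath_eqI:
  assumes "w \<in> carrier (swreath K \<Gamma>)" "v \<in> carrier (swreath K \<Gamma>)"
    and "\<And>\<gamma>. \<gamma> \<in> \<Gamma> \<Longrightarrow> fst w \<gamma> = fst v \<gamma>" "\<And>\<gamma>. \<gamma> \<in> \<Gamma> \<Longrightarrow> snd w \<gamma> = snd v \<gamma>"
  shows "w = v"
proof (rule prod_eqI)
  show "fst w = fst v" using assms by (intro PiE_ext[of _ \<Gamma> "\<lambda>_. carrier K"]) (auto simp: swreath_carrier)
  show "snd w = snd v"
  proof
    fix \<gamma> show "snd w \<gamma> = snd v \<gamma>"
      using assms by (cases "\<gamma> \<in> \<Gamma>") (auto simp: swreath_carrier permutes_def)
  qed
qed

sublocale wr: group "swreath K \<Gamma>"
proof (rule groupI)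
  fix x assume x: "x \<in> carrier (swreath K \<Gamma>)"
  let ?g = "Hilbert_Choice.inv (snd x)"
  let ?y = "(\<lambda>\<gamma>\<in>\<Gamma>. inv (fst x (?g \<gamma>)), ?g)"
  have g: "?g permutes \<Gamma>" using x by (simp add: permutes_inv swreath_closed)
  have go: "snd x \<circ> ?g = id" using x by (auto intro: permutes_inv_o(1)[of _ \<Gamma>] simp: swreath_closed)
  from g have gin: "\<And>\<gamma>. ?g \<gamma> \<in> \<Gamma> \<longleftrightarrow> \<gamma> \<in> \<Gamma>" by (simp add: permutes_in_image)
  have "?y \<in> carrier (swreath K \<Gamma>)"
    using x g gin by (auto simp: swreath_carrier)
  moreover have "?y \<otimes>\<^bsub>swreath K \<Gamma>\<^esub> x = \<one>\<^bsub>swreath K \<Gamma>\<^esub>"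
    using x g gin by (auto simp: wreath_mult wreath_one go swreath_closed)
  ultimately show "\<exists>y\<in>carrier (swreath K \<Gamma>). y \<otimes>\<^bsub>swreath K \<Gamma>\<^esub> x = \<one>\<^bsub>swreath K \<Gamma>\<^esub>" by blast
next
  fix x assume "x \<in> carrier (swreath K \<Gamma>)"
  then show "\<one>\<^bsub>swreath K \<Gamma>\<^esub> \<otimes>\<^bsub>swreath K \<Gamma>\<^esub> x = x"
    by (intro swreath_eqI) (auto simp: wreath_mult wreath_one swreath_carrier PiE_iff permutes_compose permutes_id)
next
  fix x y z assume "x \<in> carrier (swreath K \<Gamma>)" "y \<in> carrier (swreath K \<Gamma>)" "z \<in> carrier (swreath K \<Gamma>)"
  then show "x \<otimes>\<^bsub>swreath K \<Gamma>\<^esub> y \<otimes>\<^bsub>swreath K \<Gamma>\<^esub> z = x \<otimes>\<^bsub>swreath K \<Gamma>\<^esub> (y \<otimes>\<^bsub>swreath K \<Gamma>\<^esub> z)"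
    by (auto simp: wreath_mult swreath_closed o_assoc m_assoc restrict_def fun_eq_iff)
qed (auto simp: wreath_mult wreath_one swreath_carrier PiE_iff permutes_compose permutes_id permutes_in_image)

text \<open>The starting point of all computations with commuting or conjugate elements: stated for four
elements so that it covers both \<open>w b = b w'\<close> and \<open>b u = u b\<close>.\<close>

lemma wreath_mult_eq_iff:
  "w \<otimes>\<^bsub>wreath K \<Gamma> H\<^esub> v = v' \<otimes>\<^bsub>wreath K \<Gamma> H'\<^esub> w' \<longleftrightarrow>
    (\<forall>\<gamma>\<in>\<Gamma>. fst w \<gamma> \<otimes> fst v (snd w \<gamma>) = fst v' \<gamma> \<otimes> fst w' (snd v' \<gamma>)) \<and>
    (\<forall>\<gamma>. snd v (snd w \<gamma>) = snd w' (snd v' \<gamma>))"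
  by (auto simp: wreath_mult fun_eq_iff restrict_def split: if_splits)

lemma snd_hom: "group_hom (swreath K \<Gamma>) (sym_right \<Gamma>) snd"
proof (rule group_hom.intro[OF wr.group_axioms sym.group_axioms group_hom_axioms.intro])
  show "snd \<in> hom (swreath K \<Gamma>) (sym_right \<Gamma>)"
  proof (rule homI)
    fix v w assume "v \<in> carrier (swreath K \<Gamma>)"
    then show "snd v \<in> carrier (sym_right \<Gamma>)" by (simp add: wreath_carrier)
    show "snd (v \<otimes>\<^bsub>swreath K \<Gamma>\<^esub> w) = snd v \<otimes>\<^bsub>sym_right \<Gamma>\<^esub> snd w"
      by (simp add: wreath_mult)
  qed
qed

lemma wreath_carrier_swreath_iff:
  assumes "subgroup H (sym_right \<Gamma>)"
  shows "w \<in> carrier (wreath K \<Gamma> H) \<longleftrightarrow> w \<in> carrier (swreath K \<Gamma>) \<and> snd w \<in> H"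
  using subgroup.subset[OF assms] by (auto simp: wreath_carrier)

lemma subgroup_wreath:
  assumes H: "subgroup H (sym_right \<Gamma>)"
  shows "subgroup (carrier (wreath K \<Gamma> H)) (swreath K \<Gamma>)"
proof -
  interpret p: group_hom "swreath K \<Gamma>" "sym_right \<Gamma>" snd by (rule snd_hom)
  note iff = wreath_carrier_swreath_iff[OF H]
  show ?thesis
  proof (rule wr.subgroupI)
    show "carrier (wreath K \<Gamma> H) \<subseteq> carrier (swreath K \<Gamma>)" using iff by blast
    have "\<one>\<^bsub>swreath K \<Gamma>\<^esub> \<in> carrier (wreath K \<Gamma> H)"
      unfolding iff using subgroup.one_closed[OF H] by (simp add: p.hom_one)
    then show "carrier (wreath K \<Gamma> H) \<noteq> {}" by blast
    fix v assume v: "v \<in> carrier (wreath K \<Gamma> H)"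
    then show "inv\<^bsub>swreath K \<Gamma>\<^esub> v \<in> carrier (wreath K \<Gamma> H)"
      unfolding iff using subgroup.m_inv_closed[OF H] by simp
    fix w assume "w \<in> carrier (wreath K \<Gamma> H)"
    then show "v \<otimes>\<^bsub>swreath K \<Gamma>\<^esub> w \<in> carrier (wreath K \<Gamma> H)"
      using v unfolding iff using subgroup.m_closed[OF H, of "snd v" "snd w"]
      by (metis p.hom_mult wr.m_closed)
  qed
qed

lemma base_in_wreath:
  assumes H: "subgroup H (sym_right \<Gamma>)" and a: "a \<in> carrier (fun_group K \<Gamma>) \<times> {\<one>\<^bsub>sym_right \<Gamma>\<^esub>}"
  shows "a \<in> carrier (wreath K \<Gamma> H)" "snd a = id"
  using a subgroup.one_closed[OF H] by (auto simp: wreath_carrier)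

text \<open>Conjugation by a base element does not change the projection to the top group.\<close>

lemma snd_conj_base:
  assumes a: "a \<in> carrier (swreath K \<Gamma>)" "snd a = id" and b: "b \<in> carrier (swreath K \<Gamma>)"
  shows "snd (a \<otimes>\<^bsub>swreath K \<Gamma>\<^esub> b \<otimes>\<^bsub>swreath K \<Gamma>\<^esub> inv\<^bsub>swreath K \<Gamma>\<^esub> a) = snd b"
proof -
  interpret p: group_hom "swreath K \<Gamma>" "sym_right \<Gamma>" snd by (rule snd_hom)
  have "snd (inv\<^bsub>swreath K \<Gamma>\<^esub> a) = inv\<^bsub>sym_right \<Gamma>\<^esub> \<one>\<^bsub>sym_right \<Gamma>\<^esub>"
    using p.hom_inv[OF a(1)] a(2) by simp
  then have "snd (inv\<^bsub>swreath K \<Gamma>\<^esub> a) = id" unfolding sym.inv_one by simp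
  then show ?thesis using a(2) by (simp add: wreath_mult)
qed

section \<open>Wreath cycle decompositions\<close>

lemma terr_subset: "w \<in> carrier (swreath K \<Gamma>) \<Longrightarrow> terr K \<Gamma> w \<subseteq> \<Gamma>"
  by (auto simp: terr_def supp_def swreath_carrier permutes_def)

lemma not_in_terr:
  "\<gamma> \<notin> terr K \<Gamma> w \<Longrightarrow> snd w \<gamma> = \<gamma>"
  "\<gamma> \<notin> terr K \<Gamma> w \<Longrightarrow> \<gamma> \<in> \<Gamma> \<Longrightarrow> fst w \<gamma> = \<one>"
  by (auto simp: terr_def supp_def)

text \<open>A moved point has a moved image, and a fixed point stays where it is.\<close>

lemma terr_closed:
  assumes "w \<in> carrier (swreath K \<Gamma>)" "\<gamma> \<in> terr K \<Gamma> w"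
  shows "snd w \<gamma> \<in> terr K \<Gamma> w"
proof (cases "snd w \<gamma> = \<gamma>")
  case False
  then have "snd w (snd w \<gamma>) \<noteq> snd w \<gamma>"
    using permutes_inj[of "snd w" \<Gamma>] assms(1) by (auto simp: swreath_carrier dest: injD)
  then show ?thesis by (simp add: terr_def supp_def)
qed (use assms in simp)

lemma wreath_cycle_carrier: "wreath_cycle K \<Gamma> z \<Longrightarrow> z \<in> carrier (swreath K \<Gamma>)"
  by (simp add: wreath_cycle_def)

text \<open>Both kinds of wreath cycles are cyclic on their territory; for a trivial top component this is the
degenerate cycle of length one.\<close>

lemma wreath_cycle_terr:
  assumes "wreath_cycle K \<Gamma> z"
  shows "terr K \<Gamma> z \<noteq> {}" "finite (terr K \<Gamma> z)" "snd z permutes terr K \<Gamma> z"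
    "cyclic_on (snd z) (terr K \<Gamma> z)"
proof -
  have z: "z \<in> carrier (swreath K \<Gamma>)" using assms by (rule wreath_cycle_carrier)
  show fin: "finite (terr K \<Gamma> z)" using terr_subset[OF z] finite_\<Gamma> finite_subset by blast
  show c: "cyclic_on (snd z) (terr K \<Gamma> z)"
    using assms unfolding wreath_cycle_def
  proof (elim conjE disjE)
    assume "snd z = id" "card (terr K \<Gamma> z) = 1"
    then show ?thesis
      by (auto simp: card_1_singleton_iff cyclic_on_def orbit_eq_singleton_iff[THEN iffD2, of id] dest: sym)
  qed simp
  show "terr K \<Gamma> z \<noteq> {}" using c by (auto simp: cyclic_on_def)
  have "inj (snd z)" using z by (auto simp: swreath_carrier intro: permutes_inj)
  then have "bij_betw (snd z) (terr K \<Gamma> z) (terr K \<Gamma> z)"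
    using endo_inj_surj[OF fin, of "snd z"] terr_closed[OF z] inj_on_subset[of "snd z" UNIV]
    by (simp add: bij_betw_def image_subset_iff)
  then show "snd z permutes terr K \<Gamma> z" by (rule bij_imp_permutes) (rule not_in_terr)
qed

lemma list_product_cycles:
  assumes "distinct zs" "\<And>z. z \<in> set zs \<Longrightarrow> wreath_cycle K \<Gamma> z"
    and "pairwise (\<lambda>y z. terr K \<Gamma> y \<inter> terr K \<Gamma> z = {}) (set zs)"
  defines "p \<equiv> list_product (swreath K \<Gamma>) zs"
  shows "p \<in> carrier (swreath K \<Gamma>) \<and>
    (\<forall>z\<in>set zs. \<forall>\<gamma>\<in>terr K \<Gamma> z. fst p \<gamma> = fst z \<gamma> \<and> snd p \<gamma> = snd z \<gamma>) \<and>
    (\<forall>\<gamma>. \<gamma> \<notin> (\<Union>z\<in>set zs. terr K \<Gamma> z) \<longrightarrow> (\<gamma> \<in> \<Gamma> \<longrightarrow> fst p \<gamma> = \<one>) \<and> snd p \<gamma> = \<gamma>)"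
  using assms(1-3) unfolding p_def
proof (induction zs)
  case Nil
  show ?case using wr.one_closed by (simp add: wreath_one)
next
  case (Cons y ys)
  let ?q = "list_product (swreath K \<Gamma>) ys"
  have q: "?q \<in> carrier (swreath K \<Gamma>)"
    "\<And>z \<gamma>. z \<in> set ys \<Longrightarrow> \<gamma> \<in> terr K \<Gamma> z \<Longrightarrow> fst ?q \<gamma> = fst z \<gamma> \<and> snd ?q \<gamma> = snd z \<gamma>"
    "\<And>\<gamma>. \<gamma> \<notin> (\<Union>z\<in>set ys. terr K \<Gamma> z) \<Longrightarrow> (\<gamma> \<in> \<Gamma> \<longrightarrow> fst ?q \<gamma> = \<one>) \<and> snd ?q \<gamma> = \<gamma>"
    using Cons by (auto simp: pairwise_insert)
  have y: "wreath_cycle K \<Gamma> y" "y \<in> carrier (swreath K \<Gamma>)"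
    using Cons.prems wreath_cycle_carrier[of y] by simp_all
  have zs: "z \<in> carrier (swreath K \<Gamma>)" if "z \<in> set ys" for z
    using that Cons.prems wreath_cycle_carrier[of z] by simp
  have disj: "terr K \<Gamma> y \<inter> terr K \<Gamma> z = {}" if "z \<in> set ys" for z
    using that Cons.prems unfolding pairwise_def by (metis distinct.simps(2) list.set_intros)
  show ?case
  proof (intro conjI ballI allI impI)
    show "list_product (swreath K \<Gamma>) (y # ys) \<in> carrier (swreath K \<Gamma>)"
      using q y by simp
  next
    fix z \<gamma> assume z: "z \<in> set (y # ys)" and g: "\<gamma> \<in> terr K \<Gamma> z"
    have gG: "\<gamma> \<in> \<Gamma>" using z g y zs[of z] terr_subset[of z] by (cases "z = y") auto
    have "fst (list_product (swreath K \<Gamma>) (y # ys)) \<gamma> = fst z \<gamma> \<and>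
      snd (list_product (swreath K \<Gamma>) (y # ys)) \<gamma> = snd z \<gamma>"
    proof (cases "z = y")
      case True
      then have "snd y \<gamma> \<in> terr K \<Gamma> y" using g y terr_closed by blast
      then have "snd y \<gamma> \<notin> (\<Union>z\<in>set ys. terr K \<Gamma> z)" using disj by blast
      then show ?thesis using q(3)[of "snd y \<gamma>"] True y gG by (simp add: wreath_mult swreath_closed)
    next
      case False
      then have "z \<in> set ys" "\<gamma> \<notin> terr K \<Gamma> y" using z g disj[of z] by auto
      then show ?thesis using q(2)[of z \<gamma>] g gG zs[of z]
        by (simp add: wreath_mult not_in_terr swreath_closed)
    qed
    then show "fst (list_product (swreath K \<Gamma>) (y # ys)) \<gamma> = fst z \<gamma>"
      "snd (list_product (swreath K \<Gamma>) (y # ys)) \<gamma> = snd z \<gamma>" by auto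
  next
    fix \<gamma> assume "\<gamma> \<notin> (\<Union>z\<in>set (y # ys). terr K \<Gamma> z)"
    then have g: "\<gamma> \<notin> terr K \<Gamma> y" "\<gamma> \<notin> (\<Union>z\<in>set ys. terr K \<Gamma> z)" by auto
    show "snd (list_product (swreath K \<Gamma>) (y # ys)) \<gamma> = \<gamma>"
      using q(3)[OF g(2)] g(1) by (simp add: wreath_mult not_in_terr)
    show "fst (list_product (swreath K \<Gamma>) (y # ys)) \<gamma> = \<one>" if "\<gamma> \<in> \<Gamma>"
      using q(3)[OF g(2)] g(1) that by (simp add: wreath_mult not_in_terr)
  qed
qed

text \<open>Disjoint factors do not interfere, so a decomposition amounts to agreeing with each factor on its
territory. This pointwise form makes uniqueness and the behaviour under conjugation accessible.\<close>

lemma is_cycle_decomp_iff: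
  "is_cycle_decomp K \<Gamma> w D \<longleftrightarrow>
    w \<in> carrier (swreath K \<Gamma>) \<and> finite D \<and> (\<forall>z\<in>D. wreath_cycle K \<Gamma> z) \<and>
    pairwise (\<lambda>y z. terr K \<Gamma> y \<inter> terr K \<Gamma> z = {}) D \<and>
    (\<forall>z\<in>D. \<forall>\<gamma>\<in>terr K \<Gamma> z. fst w \<gamma> = fst z \<gamma> \<and> snd w \<gamma> = snd z \<gamma>) \<and>
    terr K \<Gamma> w \<subseteq> (\<Union>z\<in>D. terr K \<Gamma> z)"
proof (cases "finite D \<and> (\<forall>z\<in>D. wreath_cycle K \<Gamma> z) \<and>
    pairwise (\<lambda>y z. terr K \<Gamma> y \<inter> terr K \<Gamma> z = {}) D")
  case True
  obtain zs where zs: "distinct zs" "set zs = D"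
    "set_product (swreath K \<Gamma>) (\<lambda>z. z) D = list_product (swreath K \<Gamma>) zs"
    using set_product_list[of D "swreath K \<Gamma>" "\<lambda>z. z"] True by auto
  let ?p = "set_product (swreath K \<Gamma>) (\<lambda>z. z) D"
  have "?p \<in> carrier (swreath K \<Gamma>) \<and>
    (\<forall>z\<in>D. \<forall>\<gamma>\<in>terr K \<Gamma> z. fst ?p \<gamma> = fst z \<gamma> \<and> snd ?p \<gamma> = snd z \<gamma>) \<and>
    (\<forall>\<gamma>. \<gamma> \<notin> (\<Union>z\<in>D. terr K \<Gamma> z) \<longrightarrow> (\<gamma> \<in> \<Gamma> \<longrightarrow> fst ?p \<gamma> = \<one>) \<and> snd ?p \<gamma> = \<gamma>)"
    using list_product_cycles[OF zs(1)] True zs by auto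
  then have p: "?p \<in> carrier (swreath K \<Gamma>)"
    "\<And>z \<gamma>. z \<in> D \<Longrightarrow> \<gamma> \<in> terr K \<Gamma> z \<Longrightarrow> fst ?p \<gamma> = fst z \<gamma> \<and> snd ?p \<gamma> = snd z \<gamma>"
    "\<And>\<gamma>. \<gamma> \<notin> (\<Union>z\<in>D. terr K \<Gamma> z) \<Longrightarrow> (\<gamma> \<in> \<Gamma> \<longrightarrow> fst ?p \<gamma> = \<one>) \<and> snd ?p \<gamma> = \<gamma>"
    by auto
  have "terr K \<Gamma> ?p \<subseteq> (\<Union>z\<in>D. terr K \<Gamma> z)"
    using p(3) by (auto simp: terr_def[of K \<Gamma> ?p] supp_def)
  moreover have "w = ?p" if w: "w \<in> carrier (swreath K \<Gamma>)"
    "\<forall>z\<in>D. \<forall>\<gamma>\<in>terr K \<Gamma> z. fst w \<gamma> = fst z \<gamma> \<and> snd w \<gamma> = snd z \<gamma>"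
    "terr K \<Gamma> w \<subseteq> (\<Union>z\<in>D. terr K \<Gamma> z)"
  proof -
    have "fst w \<gamma> = fst ?p \<gamma> \<and> snd w \<gamma> = snd ?p \<gamma>" if "\<gamma> \<in> \<Gamma>" for \<gamma>
    proof (cases "\<gamma> \<in> (\<Union>z\<in>D. terr K \<Gamma> z)")
      case True then show ?thesis using p(2) w(2) by auto
    next
      case False
      then have "\<gamma> \<notin> terr K \<Gamma> w" using w(3) by blast
      then show ?thesis using p(3)[OF False] that by (simp add: not_in_terr)
    qed
    then show ?thesis using w(1) p(1) by (intro swreath_eqI) auto
  qed
  ultimately show ?thesis using True p(1,2) unfolding is_cycle_decomp_def by blast
qed (auto simp: is_cycle_decomp_def)

definition welt_restrict :: "('g, 'k) welt \<Rightarrow> 'g set \<Rightarrow> ('g, 'k) welt" where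
  "welt_restrict w T = (\<lambda>\<gamma>\<in>\<Gamma>. if \<gamma> \<in> T then fst w \<gamma> else \<one>, perm_restrict (snd w) T)"

text \<open>Each orbit of the top component that meets the territory carries one wreath cycle. An orbit with
more than one point has no fixed points, hence it is the support.\<close>

lemma welt_restrict_orbit:
  assumes w: "w \<in> carrier (swreath K \<Gamma>)" and g: "\<gamma> \<in> terr K \<Gamma> w"
  defines "T \<equiv> orbit (snd w) \<gamma>"
  shows "wreath_cycle K \<Gamma> (welt_restrict w T)" "terr K \<Gamma> (welt_restrict w T) = T" "\<gamma> \<in> T"
proof -
  let ?h = "snd w"
  have h: "?h permutes \<Gamma>" "permutation ?h"
    using w finite_\<Gamma> by (auto simp: swreath_carrier permutation_permutes)
  have "\<gamma> \<in> \<Gamma>" using terr_subset[OF w] g by blast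
  then have T: "T \<subseteq> \<Gamma>" unfolding T_def by (rule permutes_orbit_subset[OF h(1)])
  show gT: "\<gamma> \<in> T" unfolding T_def by (rule permutation_self_in_orbit[OF h(2)])
  have cyc: "cyclic_on ?h T" unfolding T_def by (rule cyclic_on_orbit'[OF h(2)])
  have "inj_on ?h T" by (rule permutes_inj_on[OF h(1)])
  then have "?h ` T = T"
    using cyclic_on_inI[OF cyc] finite_cyclic_on[OF cyc] by (intro endo_inj_surj) auto
  then have "bij_betw (perm_restrict ?h T) T T"
    using \<open>inj_on ?h T\<close> by (simp add: bij_betw_def perm_restrict_def cong: inj_on_cong)
  then have "perm_restrict ?h T permutes T"
    by (rule bij_imp_permutes) (simp add: perm_restrict_def)
  then have "perm_restrict ?h T permutes \<Gamma>" using T by (rule permutes_subset)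
  then have car: "welt_restrict w T \<in> carrier (swreath K \<Gamma>)"
    using w T by (auto simp: swreath_carrier welt_restrict_def)
  have "wreath_cycle K \<Gamma> (welt_restrict w T) \<and> terr K \<Gamma> (welt_restrict w T) = T"
  proof (cases "?h \<gamma> = \<gamma>")
    case True
    then have T1: "T = {\<gamma>}" unfolding T_def by (simp add: orbit_eq_singleton_iff)
    then have "snd (welt_restrict w T) = id" using True by (auto simp: welt_restrict_def perm_restrict_def)
    moreover have "terr K \<Gamma> (welt_restrict w T) = {\<gamma>}"
      using g True T1 T by (auto simp: terr_def supp_def welt_restrict_def perm_restrict_def)
    ultimately show ?thesis using car T1 by (simp add: wreath_cycle_def)
  next
    case False
    have mv: "?h \<delta> \<noteq> \<delta>" if "\<delta> \<in> T" for \<delta>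
    proof
      assume "?h \<delta> = \<delta>"
      then have "orbit ?h \<delta> = {\<delta>}" by (simp add: orbit_eq_singleton_iff)
      then have "T = {\<delta>}" using orbit_cyclic_eq3[OF cyc that] by simp
      then show False using gT False \<open>?h \<delta> = \<delta>\<close> by auto
    qed
    then have s: "supp (snd (welt_restrict w T)) = T"
      by (auto simp: supp_def welt_restrict_def perm_restrict_def)
    then have "terr K \<Gamma> (welt_restrict w T) = T"
      by (auto simp: terr_def welt_restrict_def)
    moreover have "cyclic_on (snd (welt_restrict w T)) T"
      using cyc by (simp add: welt_restrict_def cyclic_on_perm_restrict)
    ultimately show ?thesis using car s by (simp add: wreath_cycle_def)
  qed
  then show "wreath_cycle K \<Gamma> (welt_restrict w T)" "terr K \<Gamma> (welt_restrict w T) = T" by auto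
qed

lemma is_cycle_decomp_orbits:
  assumes w: "w \<in> carrier (swreath K \<Gamma>)"
  shows "is_cycle_decomp K \<Gamma> w ((\<lambda>\<gamma>. welt_restrict w (orbit (snd w) \<gamma>)) ` terr K \<Gamma> w)"
  unfolding is_cycle_decomp_iff
proof (intro conjI)
  have h: "permutation (snd w)"
    using w finite_\<Gamma> by (auto simp: swreath_carrier permutation_permutes)
  note fin = finite_subset[OF terr_subset[OF w] finite_\<Gamma>]
  note r = welt_restrict_orbit[OF w]
  show "w \<in> carrier (swreath K \<Gamma>)" by fact
  show "finite ((\<lambda>\<gamma>. welt_restrict w (orbit (snd w) \<gamma>)) ` terr K \<Gamma> w)" using fin by simp
  show "pairwise (\<lambda>y z. terr K \<Gamma> y \<inter> terr K \<Gamma> z = {}) ((\<lambda>\<gamma>. welt_restrict w (orbit (snd w) \<gamma>)) ` terr K \<Gamma> w)"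
  proof (rule pairwiseI)
    fix y z assume yz: "y \<in> (\<lambda>\<gamma>. welt_restrict w (orbit (snd w) \<gamma>)) ` terr K \<Gamma> w"
      "z \<in> (\<lambda>\<gamma>. welt_restrict w (orbit (snd w) \<gamma>)) ` terr K \<Gamma> w" "y \<noteq> z"
    then obtain \<gamma> \<delta> where gd: "\<gamma> \<in> terr K \<Gamma> w" "y = welt_restrict w (orbit (snd w) \<gamma>)"
      "\<delta> \<in> terr K \<Gamma> w" "z = welt_restrict w (orbit (snd w) \<delta>)" by blast
    have "orbit (snd w) \<gamma> \<inter> orbit (snd w) \<delta> = {}"
    proof (rule ccontr)
      assume "orbit (snd w) \<gamma> \<inter> orbit (snd w) \<delta> \<noteq> {}"
      then obtain \<epsilon> where "\<epsilon> \<in> orbit (snd w) \<gamma>" "\<epsilon> \<in> orbit (snd w) \<delta>" by blast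
      then have "orbit (snd w) \<gamma> = orbit (snd w) \<delta>"
        using cyclic_on_orbit'[OF h] by (metis orbit_cyclic_eq3)
      then show False using gd yz(3) by simp
    qed
    then show "terr K \<Gamma> y \<inter> terr K \<Gamma> z = {}" using gd r(2) by simp
  qed
  show "\<forall>z\<in>(\<lambda>\<gamma>. welt_restrict w (orbit (snd w) \<gamma>)) ` terr K \<Gamma> w. wreath_cycle K \<Gamma> z"
    using r by simp
  show "\<forall>z\<in>(\<lambda>\<gamma>. welt_restrict w (orbit (snd w) \<gamma>)) ` terr K \<Gamma> w.
    \<forall>\<gamma>\<in>terr K \<Gamma> z. fst w \<gamma> = fst z \<gamma> \<and> snd w \<gamma> = snd z \<gamma>"
  proof (intro ballI)
    fix z \<delta> assume "z \<in> (\<lambda>\<gamma>. welt_restrict w (orbit (snd w) \<gamma>)) ` terr K \<Gamma> w" and d: "\<delta> \<in> terr K \<Gamma> z"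
    then obtain \<gamma> where g: "\<gamma> \<in> terr K \<Gamma> w" "z = welt_restrict w (orbit (snd w) \<gamma>)" by blast
    have "\<delta> \<in> orbit (snd w) \<gamma>" using r(2)[OF g(1)] g(2) d by simp
    moreover have "\<delta> \<in> \<Gamma>"
      using r(1)[OF g(1)] g(2) d terr_subset[OF wreath_cycle_carrier, of z] by blast
    ultimately show "fst w \<delta> = fst z \<delta> \<and> snd w \<delta> = snd z \<delta>"
      by (simp add: g(2) welt_restrict_def perm_restrict_def)
  qed
  show "terr K \<Gamma> w \<subseteq> (\<Union>z\<in>(\<lambda>\<gamma>. welt_restrict w (orbit (snd w) \<gamma>)) ` terr K \<Gamma> w. terr K \<Gamma> z)"
  proof
    fix \<gamma> assume g: "\<gamma> \<in> terr K \<Gamma> w"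
    then have "\<gamma> \<in> terr K \<Gamma> (welt_restrict w (orbit (snd w) \<gamma>))" using r by simp
    then show "\<gamma> \<in> (\<Union>z\<in>(\<lambda>\<gamma>. welt_restrict w (orbit (snd w) \<gamma>)) ` terr K \<Gamma> w. terr K \<Gamma> z)"
      using g by blast
  qed
qed

text \<open>The territory of a wreath cycle in a decomposition is an orbit of the top component of \<open>w\<close>, and
\<open>w\<close> determines the wreath cycle on it.\<close>

lemma is_cycle_decomp_subset:
  assumes D: "is_cycle_decomp K \<Gamma> w D" and D': "is_cycle_decomp K \<Gamma> w D'"
  shows "D \<subseteq> D'"
proof
  fix z assume z: "z \<in> D"
  have wc: "wreath_cycle K \<Gamma> z" using D z by (simp add: is_cycle_decomp_iff)
  then obtain \<gamma> where g: "\<gamma> \<in> terr K \<Gamma> z" using wreath_cycle_terr(1) by blast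
  note zc = wreath_cycle_carrier[OF wc]
  have eq: "\<And>\<delta>. \<delta> \<in> terr K \<Gamma> z \<Longrightarrow> fst w \<delta> = fst z \<delta> \<and> snd w \<delta> = snd z \<delta>"
    using D z by (simp add: is_cycle_decomp_iff)
  then have "\<gamma> \<in> terr K \<Gamma> w" using g eq[OF g] by (auto simp: terr_def supp_def)
  then obtain y where y: "y \<in> D'" "\<gamma> \<in> terr K \<Gamma> y" using D' by (auto simp: is_cycle_decomp_iff)
  have wy: "wreath_cycle K \<Gamma> y" using D' y by (simp add: is_cycle_decomp_iff)
  note yc = wreath_cycle_carrier[OF wy]
  have eqy: "\<And>\<delta>. \<delta> \<in> terr K \<Gamma> y \<Longrightarrow> fst w \<delta> = fst y \<delta> \<and> snd w \<delta> = snd y \<delta>"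
    using D' y by (simp add: is_cycle_decomp_iff)
  have "cyclic_on (snd w) (terr K \<Gamma> z)" "cyclic_on (snd w) (terr K \<Gamma> y)"
    using wreath_cycle_terr(4)[OF wc] wreath_cycle_terr(4)[OF wy] eq eqy
    by (auto cong: cyclic_cong)
  then have T: "terr K \<Gamma> z = terr K \<Gamma> y" using g y(2) by (metis orbit_cyclic_eq3)
  have "fst z \<delta> = fst y \<delta> \<and> snd z \<delta> = snd y \<delta>" if "\<delta> \<in> \<Gamma>" for \<delta>
    using that eq[of \<delta>] eqy[of \<delta>] T not_in_terr[of \<delta> z] not_in_terr[of \<delta> y]
    by (cases "\<delta> \<in> terr K \<Gamma> z") auto
  then have "z = y" using zc yc by (intro swreath_eqI) auto
  then show "z \<in> D'" using y by simp
qed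

lemma cycles_eqI: "is_cycle_decomp K \<Gamma> w D \<Longrightarrow> cycles K \<Gamma> w = D"
  unfolding cycles_def by (rule the_equality) (auto intro: is_cycle_decomp_subset[THEN subsetD])

lemma is_cycle_decomp_cycles:
  "w \<in> carrier (swreath K \<Gamma>) \<Longrightarrow> is_cycle_decomp K \<Gamma> w (cycles K \<Gamma> w)"
  using is_cycle_decomp_orbits cycles_eqI by metis

text \<open>The decomposition exists and is unique, so the definite description in \<open>cycles\<close> may be replaced by
these properties.\<close>

lemma cyclesD:
  assumes "w \<in> carrier (swreath K \<Gamma>)"
  shows "finite (cycles K \<Gamma> w)"
    "\<And>z. z \<in> cycles K \<Gamma> w \<Longrightarrow> wreath_cycle K \<Gamma> z"
    "\<And>y z. y \<in> cycles K \<Gamma> w \<Longrightarrow> z \<in> cycles K \<Gamma> w \<Longrightarrow> \<gamma> \<in> terr K \<Gamma> y \<Longrightarrow> \<gamma> \<in> terr K \<Gamma> z \<Longrightarrow> y = z"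
    "\<And>z \<gamma>. z \<in> cycles K \<Gamma> w \<Longrightarrow> \<gamma> \<in> terr K \<Gamma> z \<Longrightarrow> fst w \<gamma> = fst z \<gamma>"
    "\<And>z \<gamma>. z \<in> cycles K \<Gamma> w \<Longrightarrow> \<gamma> \<in> terr K \<Gamma> z \<Longrightarrow> snd w \<gamma> = snd z \<gamma>"
    "terr K \<Gamma> w = (\<Union>z\<in>cycles K \<Gamma> w. terr K \<Gamma> z)"
proof -
  note D = is_cycle_decomp_cycles[OF assms, unfolded is_cycle_decomp_iff]
  show "finite (cycles K \<Gamma> w)"
    "\<And>z. z \<in> cycles K \<Gamma> w \<Longrightarrow> wreath_cycle K \<Gamma> z"
    "\<And>y z. y \<in> cycles K \<Gamma> w \<Longrightarrow> z \<in> cycles K \<Gamma> w \<Longrightarrow> \<gamma> \<in> terr K \<Gamma> y \<Longrightarrow> \<gamma> \<in> terr K \<Gamma> z \<Longrightarrow> y = z"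
    "\<And>z \<gamma>. z \<in> cycles K \<Gamma> w \<Longrightarrow> \<gamma> \<in> terr K \<Gamma> z \<Longrightarrow> fst w \<gamma> = fst z \<gamma>"
    "\<And>z \<gamma>. z \<in> cycles K \<Gamma> w \<Longrightarrow> \<gamma> \<in> terr K \<Gamma> z \<Longrightarrow> snd w \<gamma> = snd z \<gamma>"
    using D by (simp_all add: pairwise_def disjoint_iff) metis
  have "\<gamma> \<in> terr K \<Gamma> w" if "z \<in> cycles K \<Gamma> w" "\<gamma> \<in> terr K \<Gamma> z" for z \<gamma>
  proof -
    have "fst w \<gamma> = fst z \<gamma> \<and> snd w \<gamma> = snd z \<gamma>" using D that by blast
    then show ?thesis using that(2) by (simp add: terr_def supp_def)
  qed
  then show "terr K \<Gamma> w = (\<Union>z\<in>cycles K \<Gamma> w. terr K \<Gamma> z)"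
    using D by blast
qed

section \<open>Conjugation, loads and territories\<close>

text \<open>The conjugate \<open>w'\<close> of \<open>w\<close> by \<open>b\<close> is given by the relation \<open>w b = b w'\<close>, which involves no inverse
in the wreath product and contains the case \<open>w' = w\<close> of commuting elements.\<close>

context
  fixes w b w' :: "('g, 'k) welt"
  assumes w: "w \<in> carrier (swreath K \<Gamma>)" and b: "b \<in> carrier (swreath K \<Gamma>)"
    and w': "w' \<in> carrier (swreath K \<Gamma>)"
    and wb: "w \<otimes>\<^bsub>swreath K \<Gamma>\<^esub> b = b \<otimes>\<^bsub>swreath K \<Gamma>\<^esub> w'"
begin

lemma conj_top: "snd b (snd w \<gamma>) = snd w' (snd b \<gamma>)"
  using wb by (simp add: wreath_mult_eq_iff)

lemma conj_top_funpow: "snd b ((snd w ^^ n) \<gamma>) = (snd w' ^^ n) (snd b \<gamma>)"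
  by (induction n) (simp_all add: conj_top)

lemma conj_base:
  assumes "\<gamma> \<in> \<Gamma>"
  shows "fst w' (snd b \<gamma>) = inv (fst b \<gamma>) \<otimes> fst w \<gamma> \<otimes> fst b (snd w \<gamma>)"
proof -
  have "fst w \<gamma> \<otimes> fst b (snd w \<gamma>) = fst b \<gamma> \<otimes> fst w' (snd b \<gamma>)"
    using wb assms by (simp add: wreath_mult_eq_iff)
  then show ?thesis using assms w b w' by (simp add: swreath_closed m_assoc inv_solve_left)
qed

lemma conj_supp: "supp (snd w') = snd b ` supp (snd w)"
proof -
  have bp: "snd b permutes \<Gamma>" using b by (rule swreath_closed)
  have "\<delta> \<in> supp (snd w') \<longleftrightarrow> \<delta> \<in> snd b ` supp (snd w)" for \<delta>
  proof -
    obtain \<gamma> where d: "\<delta> = snd b \<gamma>" using permutes_surj[OF bp] by blast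
    show ?thesis
      using permutes_inj[OF bp] by (simp add: d inj_image_mem_iff supp_def inj_eq flip: conj_top)
  qed
  then show ?thesis by blast
qed

lemma conj_terr: "terr K \<Gamma> w' = snd b ` terr K \<Gamma> w"
proof -
  have bp: "snd b permutes \<Gamma>" using b by (rule swreath_closed)
  have "\<delta> \<in> terr K \<Gamma> w' \<longleftrightarrow> \<delta> \<in> snd b ` terr K \<Gamma> w" for \<delta>
  proof -
    obtain \<gamma> where d: "\<delta> = snd b \<gamma>" using permutes_surj[OF bp] by blast
    have "snd b \<gamma> \<in> terr K \<Gamma> w' \<longleftrightarrow> \<gamma> \<in> terr K \<Gamma> w"
    proof (cases "snd w \<gamma> = \<gamma>")
      case True
      have "fst w' (snd b \<gamma>) = \<one> \<longleftrightarrow> fst w \<gamma> = \<one>" if g: "\<gamma> \<in> \<Gamma>"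
        using conj_base[OF g] w b w' g True by (simp add: swreath_closed conj_eq_one_iff)
      then show ?thesis using True b conj_top[of \<gamma>] by (auto simp: terr_def supp_def swreath_closed)
    next
      case False
      then have "snd b (snd w \<gamma>) \<noteq> snd b \<gamma>" using permutes_inj[OF bp] by (simp add: inj_eq)
      then have "snd w' (snd b \<gamma>) \<noteq> snd b \<gamma>" by (simp add: conj_top)
      then show ?thesis using False by (simp add: terr_def supp_def)
    qed
    then show ?thesis using permutes_inj[OF bp] by (simp add: d inj_image_mem_iff)
  qed
  then show ?thesis by blast
qed

lemma conj_top_order: "top_order \<Gamma> w' = top_order \<Gamma> w"
proof -
  have p: "snd w permutes \<Gamma>" "snd w' permutes \<Gamma>" "snd b permutes \<Gamma>"
    using w w' b by (auto intro: swreath_closed)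
  have "snd w ^^ n = id \<longleftrightarrow> snd w' ^^ n = id" for n
  proof
    assume "snd w ^^ n = id"
    then have "(snd w' ^^ n) (snd b \<gamma>) = snd b \<gamma>" for \<gamma> using conj_top_funpow[of n \<gamma>] by simp
    then show "snd w' ^^ n = id" using permutes_surj[OF p(3)] by (metis eq_id_iff surjE)
  next
    assume "snd w' ^^ n = id"
    then show "snd w ^^ n = id" using conj_top_funpow[of n] permutes_inj[OF p(3)] by (auto simp: fun_eq_iff inj_eq)
  qed
  then show ?thesis
    unfolding top_order_def using p sym.pow_eq_id
    by (subst sym.ord_unique) (auto simp: sym_right_carrier sym_right_nat_pow)
qed

lemma conj_wreath_cycle:
  assumes "wreath_cycle K \<Gamma> w"
  shows "wreath_cycle K \<Gamma> w'"
  using assms unfolding wreath_cycle_def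
proof (elim conjE disjE)
  have bp: "snd b permutes \<Gamma>" using b by (rule swreath_closed)
  assume 1: "snd w = id" "card (terr K \<Gamma> w) = 1"
  then have "snd w' (snd b \<gamma>) = snd b \<gamma>" for \<gamma> using conj_top[of \<gamma>] by simp
  then have "snd w' = id" using permutes_surj[OF bp] by (metis eq_id_iff surjE)
  moreover have "card (terr K \<Gamma> w') = 1"
    using 1 permutes_inj_on[OF bp] by (simp add: conj_terr card_image)
  ultimately show "w' \<in> carrier (swreath K \<Gamma>) \<and> (snd w' = id \<and> card (terr K \<Gamma> w') = 1 \<or>
    cyclic_on (snd w') (supp (snd w')) \<and> terr K \<Gamma> w' = supp (snd w'))"
    using w' by simp
next
  assume 1: "cyclic_on (snd w) (supp (snd w))" "terr K \<Gamma> w = supp (snd w)"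
  then have "cyclic_on (snd w') (supp (snd w'))"
    unfolding conj_supp by (intro cyclic_on_image[OF 1(1)]) (simp add: conj_top)
  then show "w' \<in> carrier (swreath K \<Gamma>) \<and> (snd w' = id \<and> card (terr K \<Gamma> w') = 1 \<or>
    cyclic_on (snd w') (supp (snd w')) \<and> terr K \<Gamma> w' = supp (snd w'))"
    using w' 1 by (simp add: conj_terr conj_supp)
qed

lemma yade_conj:
  assumes g: "\<gamma> \<in> \<Gamma>"
  shows "yade K \<Gamma> (snd b \<gamma>) w' = inv (fst b \<gamma>) \<otimes> yade K \<Gamma> \<gamma> w \<otimes> fst b \<gamma>"
proof -
  let ?n = "top_order \<Gamma> w"
  have p: "snd w permutes \<Gamma>" using w by (rule swreath_closed)
  have G: "(snd w ^^ i) \<gamma> \<in> \<Gamma>" for i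
    using g w by (induction i) (auto simp: swreath_closed)
  have n: "(snd w ^^ ?n) \<gamma> = \<gamma>"
    using sym.pow_ord_eq_1[of "snd w"] p by (simp add: top_order_def sym_right_carrier sym_right_nat_pow)
  have "list_product K (map (\<lambda>i. fst w' ((snd w' ^^ i) (snd b \<gamma>))) [0..<?n]) =
    inv (fst b ((snd w ^^ 0) \<gamma>)) \<otimes> list_product K (map (\<lambda>i. fst w ((snd w ^^ i) \<gamma>)) [0..<?n])
      \<otimes> fst b ((snd w ^^ ?n) \<gamma>)"
    by (rule list_product_telescope) (use w b G conj_base in \<open>simp_all add: swreath_closed flip: conj_top_funpow\<close>)
  then show ?thesis using n by (simp add: yade_def conj_top_order sym_right_nat_pow)
qed

end

lemma yade_closed:
  assumes "w \<in> carrier (swreath K \<Gamma>)" "\<gamma> \<in> \<Gamma>"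
  shows "yade K \<Gamma> \<gamma> w \<in> carrier K"
proof -
  have "(snd w ^^ i) \<gamma> \<in> \<Gamma>" for i
    using assms by (induction i) (auto simp: swreath_closed)
  then show ?thesis unfolding yade_def using assms
    by (intro list_product_closed) (auto simp: sym_right_nat_pow swreath_closed)
qed

text \<open>Conjugating a wreath cycle by itself fixes it and moves the base point one step along the cycle.\<close>

lemma yade_conj_class:
  assumes z: "wreath_cycle K \<Gamma> z" and "\<gamma> \<in> terr K \<Gamma> z" "\<delta> \<in> terr K \<Gamma> z"
  shows "conj_class K (yade K \<Gamma> \<delta> z) = conj_class K (yade K \<Gamma> \<gamma> z)"
proof -
  note zc = wreath_cycle_carrier[OF z]
  have G: "\<gamma> \<in> \<Gamma>" using assms terr_subset[OF zc] by blast
  have Gn: "(snd z ^^ n) \<gamma> \<in> \<Gamma>" for n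
    using G zc by (induction n) (auto simp: swreath_closed)
  have "\<delta> \<in> orbit (snd z) \<gamma>"
    using assms wreath_cycle_terr(4)[OF z] orbit_cyclic_eq3 by metis
  then obtain n where "\<delta> = (snd z ^^ n) \<gamma>" by (auto simp: orbit_altdef)
  moreover have "conj_class K (yade K \<Gamma> ((snd z ^^ n) \<gamma>) z) = conj_class K (yade K \<Gamma> \<gamma> z)"
  proof (induction n)
    case (Suc n)
    then show ?case using yade_conj[OF zc zc zc refl Gn[of n]] Gn[of n] zc
      by (simp add: conj_class_conj yade_closed swreath_closed)
  qed simp
  ultimately show ?thesis by simp
qed

lemma load_eq:
  assumes z: "wreath_cycle K \<Gamma> z" and "\<gamma> \<in> terr K \<Gamma> z"
  shows "load K \<Gamma> z = (conj_class K (yade K \<Gamma> \<gamma> z), top_order \<Gamma> z)"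
  unfolding load_def prod.inject
  by (intro conjI refl yade_conj_class[OF z assms(2)] someI[of "\<lambda>\<alpha>. \<alpha> \<in> terr K \<Gamma> z" \<gamma>] assms(2))

lemma load_conj:
  assumes z: "wreath_cycle K \<Gamma> z" and b: "b \<in> carrier (swreath K \<Gamma>)"
    and y: "y \<in> carrier (swreath K \<Gamma>)" and zb: "z \<otimes>\<^bsub>swreath K \<Gamma>\<^esub> b = b \<otimes>\<^bsub>swreath K \<Gamma>\<^esub> y"
  shows "load K \<Gamma> y = load K \<Gamma> z"
proof -
  note zc = wreath_cycle_carrier[OF z]
  obtain \<gamma> where g: "\<gamma> \<in> terr K \<Gamma> z" using wreath_cycle_terr(1)[OF z] by blast
  have G: "\<gamma> \<in> \<Gamma>" using g terr_subset[OF zc] by blast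
  have "snd b \<gamma> \<in> terr K \<Gamma> y" using g by (simp add: conj_terr[OF zc b y zb])
  then have "load K \<Gamma> y = (conj_class K (yade K \<Gamma> (snd b \<gamma>) y), top_order \<Gamma> y)"
    by (rule load_eq[OF conj_wreath_cycle[OF zc b y zb z]])
  then show ?thesis using load_eq[OF z g] yade_conj[OF zc b y zb G] conj_top_order[OF zc b y zb] G zc b
    by (simp add: conj_class_conj yade_closed swreath_closed)
qed

text \<open>The conjugates of the wreath cycles decompose the conjugate element, and by uniqueness there is no
other decomposition.\<close>

lemma cycles_conj:
  assumes w: "w \<in> carrier (swreath K \<Gamma>)" and b: "b \<in> carrier (swreath K \<Gamma>)"
    and w': "w' \<in> carrier (swreath K \<Gamma>)"
    and wb: "w \<otimes>\<^bsub>swreath K \<Gamma>\<^esub> b = b \<otimes>\<^bsub>swreath K \<Gamma>\<^esub> w'"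
  defines "c \<equiv> (\<lambda>z. inv\<^bsub>swreath K \<Gamma>\<^esub> b \<otimes>\<^bsub>swreath K \<Gamma>\<^esub> z \<otimes>\<^bsub>swreath K \<Gamma>\<^esub> b)"
  shows "cycles K \<Gamma> w' = c ` cycles K \<Gamma> w"
    and "\<And>z. z \<in> cycles K \<Gamma> w \<Longrightarrow> load K \<Gamma> (c z) = load K \<Gamma> z"
    and "\<And>z. z \<in> cycles K \<Gamma> w \<Longrightarrow> terr K \<Gamma> (c z) = snd b ` terr K \<Gamma> z"
proof -
  note cy = cyclesD[OF w]
  have zc: "z \<in> carrier (swreath K \<Gamma>)" if "z \<in> cycles K \<Gamma> w" for z
    using cy(2)[OF that] by (rule wreath_cycle_carrier)
  have cz: "c z \<in> carrier (swreath K \<Gamma>)" "z \<otimes>\<^bsub>swreath K \<Gamma>\<^esub> b = b \<otimes>\<^bsub>swreath K \<Gamma>\<^esub> c z"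
    if "z \<in> cycles K \<Gamma> w" for z
  proof -
    show "c z \<in> carrier (swreath K \<Gamma>)" using zc[OF that] b by (simp add: c_def)
    show "z \<otimes>\<^bsub>swreath K \<Gamma>\<^esub> b = b \<otimes>\<^bsub>swreath K \<Gamma>\<^esub> c z"
      using zc[OF that] b by (simp add: c_def flip: wr.m_assoc)
  qed
  have bp: "snd b permutes \<Gamma>" using b by (rule swreath_closed)
  show ld: "load K \<Gamma> (c z) = load K \<Gamma> z" and te: "terr K \<Gamma> (c z) = snd b ` terr K \<Gamma> z"
    if "z \<in> cycles K \<Gamma> w" for z
    by (rule load_conj[OF cy(2)[OF that] b cz[OF that]])
      (rule conj_terr[OF zc[OF that] b cz[OF that]])
  show "cycles K \<Gamma> w' = c ` cycles K \<Gamma> w"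
  proof (rule cycles_eqI, unfold is_cycle_decomp_iff, intro conjI)
    show "\<forall>z\<in>c ` cycles K \<Gamma> w. wreath_cycle K \<Gamma> z"
      using conj_wreath_cycle[OF zc b cz cy(2)] by blast
    show "pairwise (\<lambda>y z. terr K \<Gamma> y \<inter> terr K \<Gamma> z = {}) (c ` cycles K \<Gamma> w)"
    proof (rule pairwiseI)
      fix y z assume "y \<in> c ` cycles K \<Gamma> w" "z \<in> c ` cycles K \<Gamma> w" "y \<noteq> z"
      then obtain y' z' where yz: "y = c y'" "z = c z'" "y' \<in> cycles K \<Gamma> w" "z' \<in> cycles K \<Gamma> w" "y' \<noteq> z'"
        by blast
      then have "terr K \<Gamma> y' \<inter> terr K \<Gamma> z' = {}" using cy(3) by blast
      then show "terr K \<Gamma> y \<inter> terr K \<Gamma> z = {}"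
        using yz te permutes_inj[OF bp] by (simp flip: image_Int)
    qed
    show "\<forall>z\<in>c ` cycles K \<Gamma> w. \<forall>\<gamma>\<in>terr K \<Gamma> z. fst w' \<gamma> = fst z \<gamma> \<and> snd w' \<gamma> = snd z \<gamma>"
    proof (intro ballI)
      fix z \<delta> assume "z \<in> c ` cycles K \<Gamma> w" "\<delta> \<in> terr K \<Gamma> z"
      then obtain z' \<gamma> where z': "z' \<in> cycles K \<Gamma> w" "z = c z'" "\<gamma> \<in> terr K \<Gamma> z'" "\<delta> = snd b \<gamma>"
        using te by auto
      have G: "\<gamma> \<in> \<Gamma>" using z' terr_subset[OF zc[OF z'(1)]] by blast
      show "fst w' \<delta> = fst z \<delta> \<and> snd w' \<delta> = snd z \<delta>"
        using conj_base[OF w b w' wb G] conj_top[OF w b w' wb, of \<gamma>]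
          conj_base[OF zc[OF z'(1)] b cz[OF z'(1)] G] conj_top[OF zc[OF z'(1)] b cz[OF z'(1)], of \<gamma>]
          cy(4,5)[OF z'(1,3)] z'(2,4) by simp
    qed
    show "terr K \<Gamma> w' \<subseteq> (\<Union>z\<in>c ` cycles K \<Gamma> w. terr K \<Gamma> z)"
      using te cy(6) by (auto simp: conj_terr[OF w b w' wb])
  qed (use w' cy in auto)
qed

lemma terr_decomp_conj:
  assumes w: "w \<in> carrier (swreath K \<Gamma>)" and b: "b \<in> carrier (swreath K \<Gamma>)"
    and w': "w' \<in> carrier (swreath K \<Gamma>)"
    and wb: "w \<otimes>\<^bsub>swreath K \<Gamma>\<^esub> b = b \<otimes>\<^bsub>swreath K \<Gamma>\<^esub> w'"
  shows "loads K \<Gamma> w' = loads K \<Gamma> w"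
    and "terr_decomp K \<Gamma> w' = family_action (loads K \<Gamma> w) (snd b) (terr_decomp K \<Gamma> w)"
proof -
  note cc = cycles_conj[OF w b w' wb]
  show l: "loads K \<Gamma> w' = loads K \<Gamma> w"
    unfolding loads_def cc(1) image_image by (rule image_cong) (simp_all add: cc(2))
  have "terr K \<Gamma> ` cycles_load K \<Gamma> L w' = (\<lambda>T. snd b ` T) ` terr K \<Gamma> ` cycles_load K \<Gamma> L w" for L
  proof -
    have "cycles_load K \<Gamma> L w' = (\<lambda>z. inv\<^bsub>swreath K \<Gamma>\<^esub> b \<otimes>\<^bsub>swreath K \<Gamma>\<^esub> z \<otimes>\<^bsub>swreath K \<Gamma>\<^esub> b) ` cycles_load K \<Gamma> L w"
      using cc(2) unfolding cycles_load_def cc(1) by auto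
    then show ?thesis using cc(3) by (auto simp: image_image cycles_load_def intro!: image_cong)
  qed
  then show "terr_decomp K \<Gamma> w' = family_action (loads K \<Gamma> w) (snd b) (terr_decomp K \<Gamma> w)"
    by (simp add: terr_decomp_def family_action_def l cong: restrict_cong)
qed

lemma terr_stab_iff:
  "t \<in> terr_stab K \<Gamma> H w \<longleftrightarrow> t \<in> H \<and> snd w \<circ> t = t \<circ> snd w \<and>
    family_action (loads K \<Gamma> w) t (terr_decomp K \<Gamma> w) = terr_decomp K \<Gamma> w"
  unfolding terr_stab_def stabilizer_def centraliser_def by simp

text \<open>Conjugation by an element of the base group leaves all territories in place and keeps their loads.\<close>

lemma terr_stab_base_conj:
  assumes w: "w \<in> carrier (swreath K \<Gamma>)" and b: "b \<in> carrier (swreath K \<Gamma>)"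
    and w': "w' \<in> carrier (swreath K \<Gamma>)"
    and wb: "w \<otimes>\<^bsub>swreath K \<Gamma>\<^esub> b = b \<otimes>\<^bsub>swreath K \<Gamma>\<^esub> w'" and t: "snd b = id"
  shows "snd w' = snd w" "terr_stab K \<Gamma> H w' = terr_stab K \<Gamma> H w"
proof -
  show s: "snd w' = snd w"
  proof
    fix \<gamma> show "snd w' \<gamma> = snd w \<gamma>" using conj_top[OF w b w' wb, of \<gamma>] unfolding t by simp
  qed
  have "family_action (loads K \<Gamma> w) id (terr_decomp K \<Gamma> w) = terr_decomp K \<Gamma> w"
    by (rule ext) (simp add: family_action_def terr_decomp_def)
  then have "terr_decomp K \<Gamma> w' = terr_decomp K \<Gamma> w"
    using terr_decomp_conj(2)[OF w b w' wb] unfolding t by (rule trans[rotated])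
  then show "terr_stab K \<Gamma> H w' = terr_stab K \<Gamma> H w"
    unfolding terr_stab_def terr_decomp_conj(1)[OF w b w' wb] s by (rule arg_cong)
qed

text \<open>Conjugation by \<open>b\<close> maps \<open>w\<close> to itself, hence permutes its wreath cycles within each load.\<close>

lemma centraliser_top_in_terr_stab:
  assumes w: "w \<in> carrier (swreath K \<Gamma>)" and b: "b \<in> carrier (swreath K \<Gamma>)" "snd b \<in> H"
    and wb: "b \<otimes>\<^bsub>swreath K \<Gamma>\<^esub> w = w \<otimes>\<^bsub>swreath K \<Gamma>\<^esub> b"
  shows "snd b \<in> terr_stab K \<Gamma> H w"
  unfolding terr_stab_iff
proof (intro conjI)
  show "snd b \<in> H" by fact
  show "snd w \<circ> snd b = snd b \<circ> snd w"
    by (rule ext) (simp add: conj_top[OF w b(1) w wb[symmetric]])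
  show "family_action (loads K \<Gamma> w) (snd b) (terr_decomp K \<Gamma> w) = terr_decomp K \<Gamma> w"
    by (rule terr_decomp_conj(2)[OF w b(1) w wb[symmetric], symmetric])
qed

section \<open>Sparse conjugates\<close>

text \<open>Choose a point in each orbit of the top component and let \<open>a\<close> at \<open>\<gamma>\<close> be the inverse of the product
of the values of \<open>w\<close> on the way from the chosen point to \<open>\<gamma>\<close>. Conjugation by \<open>a\<close> then cancels the
value at every step except the one that returns to the chosen point.\<close>

lemma sparse_conjugate_exists:
  assumes w: "w \<in> carrier (swreath K \<Gamma>)"
  shows "\<exists>a\<in>carrier (fun_group K \<Gamma>) \<times> {\<one>\<^bsub>sym_right \<Gamma>\<^esub>}.
    sparse_decomp K \<Gamma> (inv\<^bsub>swreath K \<Gamma>\<^esub> a \<otimes>\<^bsub>swreath K \<Gamma>\<^esub> w \<otimes>\<^bsub>swreath K \<Gamma>\<^esub> a)"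
proof -
  let ?h = "snd w" and ?f = "fst w"
  have h: "?h permutes \<Gamma>" "permutation ?h"
    using w finite_\<Gamma> by (auto simp: swreath_carrier permutation_permutes)
  note cyc = cyclic_on_orbit'[OF h(2)]
  define r where "r \<gamma> = (SOME \<delta>. \<delta> \<in> orbit ?h \<gamma>)" for \<gamma>
  have r_in: "r \<gamma> \<in> orbit ?h \<gamma>" for \<gamma>
    unfolding r_def using orbit.base[of ?h \<gamma>] by (rule someI)
  have r_cong: "r \<delta> = r \<gamma>" if "\<delta> \<in> orbit ?h \<gamma>" for \<gamma> \<delta>
    unfolding r_def using orbit_cyclic_eq3[OF cyc that] by simp
  have r_\<Gamma>: "r \<gamma> \<in> \<Gamma>" if "\<gamma> \<in> \<Gamma>" for \<gamma>
    using permutes_orbit_subset[OF h(1) that] r_in by blast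
  \<comment> \<open>The number of steps from the chosen point of the orbit to \<open>\<gamma>\<close>.\<close>
  define k where "k \<gamma> = (LEAST n. (?h ^^ n) (r \<gamma>) = \<gamma>)" for \<gamma>
  define A where "A \<delta> n = list_product K (map (\<lambda>i. ?f ((?h ^^ i) \<delta>)) [0..<n])" for \<delta> n
  have pw: "(?h ^^ i) \<delta> \<in> \<Gamma>" if "\<delta> \<in> \<Gamma>" for i \<delta>
    using that w by (induction i) (auto simp: swreath_closed)
  have A_closed: "A \<delta> n \<in> carrier K" if "\<delta> \<in> \<Gamma>" for \<delta> n
    unfolding A_def using pw[OF that] w by (intro list_product_closed) (auto simp: swreath_closed)
  have A_Suc: "A \<delta> (Suc n) = A \<delta> n \<otimes> ?f ((?h ^^ n) \<delta>)" if "\<delta> \<in> \<Gamma>" for \<delta> n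
    unfolding A_def using pw[OF that] w
    by (simp add: list_product_snoc image_subset_iff swreath_closed)
  define a where "a = ((\<lambda>\<gamma>\<in>\<Gamma>. inv (A (r \<gamma>) (k \<gamma>))), id :: 'g \<Rightarrow> 'g)"
  have a_base: "a \<in> carrier (fun_group K \<Gamma>) \<times> {\<one>\<^bsub>sym_right \<Gamma>\<^esub>}"
    using A_closed r_\<Gamma> by (auto simp: a_def)
  then have a: "a \<in> carrier (swreath K \<Gamma>)"
    by (auto simp: swreath_carrier permutes_id)
  let ?u = "inv\<^bsub>swreath K \<Gamma>\<^esub> a \<otimes>\<^bsub>swreath K \<Gamma>\<^esub> w \<otimes>\<^bsub>swreath K \<Gamma>\<^esub> a"
  have u: "?u \<in> carrier (swreath K \<Gamma>)" using a w by simp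
  have wa: "w \<otimes>\<^bsub>swreath K \<Gamma>\<^esub> a = a \<otimes>\<^bsub>swreath K \<Gamma>\<^esub> ?u"
    using a w by (simp flip: wr.m_assoc)
  have ida: "snd a = id" by (simp add: a_def)
  have top: "snd ?u = ?h" by (rule terr_stab_base_conj(1)[OF w a u wa ida])
  \<comment> \<open>Unless the step from \<open>\<gamma>\<close> returns to the chosen point, it increases the distance by one.\<close>
  have one: "fst ?u \<gamma> = \<one>" if g: "\<gamma> \<in> \<Gamma>" and ne: "?h \<gamma> \<noteq> r \<gamma>" for \<gamma>
  proof -
    have rh: "r (?h \<gamma>) = r \<gamma>" by (rule r_cong) (rule orbit.base)
    have g_orb: "\<gamma> \<in> orbit ?h (r \<gamma>)"
      using orbit_cyclic_eq3[OF cyc r_in] permutation_self_in_orbit[OF h(2)] by metis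
    obtain n where n: "(?h ^^ n) (r \<gamma>) = \<gamma>" using g_orb unfolding orbit_altdef mem_Collect_eq by metis
    have kg: "(?h ^^ k \<gamma>) (r \<gamma>) = \<gamma>" unfolding k_def by (rule LeastI[of _ n]) (rule n)
    have "k (?h \<gamma>) = (LEAST n. (?h ^^ n) (r \<gamma>) = ?h \<gamma>)" unfolding k_def rh ..
    also have "\<dots> = Suc (LEAST n. (?h ^^ Suc n) (r \<gamma>) = ?h \<gamma>)"
      by (rule Least_Suc[of _ "Suc n"]) (use n ne in auto)
    also have "(\<lambda>n. (?h ^^ Suc n) (r \<gamma>) = ?h \<gamma>) = (\<lambda>n. (?h ^^ n) (r \<gamma>) = \<gamma>)"
      using permutes_inj[OF h(1)] by (simp add: inj_eq)
    finally have kh: "k (?h \<gamma>) = Suc (k \<gamma>)" by (simp add: k_def)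
    have hg: "?h \<gamma> \<in> \<Gamma>" using g w by (simp add: swreath_closed)
    have fg: "?f \<gamma> \<in> carrier K" using g w by (simp add: swreath_closed)
    have Ac: "A (r \<gamma>) (k \<gamma>) \<in> carrier K" using A_closed r_\<Gamma>[OF g] by blast
    have "fst ?u \<gamma> = inv (fst a \<gamma>) \<otimes> ?f \<gamma> \<otimes> fst a (?h \<gamma>)"
      using conj_base[OF w a u wa g] unfolding ida by simp
    also have "\<dots> = A (r \<gamma>) (k \<gamma>) \<otimes> ?f \<gamma> \<otimes> inv (A (r \<gamma>) (k \<gamma>) \<otimes> ?f \<gamma>)"
      using g hg A_Suc[OF r_\<Gamma>[OF g], of "k \<gamma>"] Ac by (simp add: a_def rh kh kg)
    also have "\<dots> = \<one>" using Ac fg by simp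
    finally show ?thesis .
  qed
  have "sparse K \<Gamma> z" if z: "z \<in> cycles K \<Gamma> ?u" for z
  proof -
    note wc = cyclesD(2)[OF u z]
    note zc = wreath_cycle_carrier[OF wc]
    obtain \<gamma> where g: "\<gamma> \<in> terr K \<Gamma> z" using wreath_cycle_terr(1)[OF wc] by blast
    then have gG: "\<gamma> \<in> \<Gamma>" using terr_subset[OF zc] by blast
    have "orbit ?h \<gamma> = orbit (snd z) \<gamma>"
      by (rule orbit_cong0[OF g]) (use terr_closed[OF zc] cyclesD(5)[OF u z] top in auto)
    then have T: "terr K \<Gamma> z = orbit ?h \<gamma>"
      using wreath_cycle_terr(4)[OF wc] g orbit_cyclic_eq3 by metis
    \<comment> \<open>The predecessor of the chosen point is the only point that may carry a nontrivial value.\<close>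
    obtain \<gamma>0 where g0: "?h \<gamma>0 = r \<gamma>" using permutes_surj[OF h(1)] by (metis surjD)
    have "\<gamma>0 \<in> \<Gamma>" using r_\<Gamma>[OF gG] w by (simp add: swreath_closed flip: g0)
    moreover have "fst z \<delta> = \<one>" if d: "\<delta> \<in> \<Gamma>" "\<delta> \<noteq> \<gamma>0" for \<delta>
    proof (cases "\<delta> \<in> terr K \<Gamma> z")
      case True
      then have "r \<delta> = r \<gamma>" using T r_cong by blast
      then have "?h \<delta> \<noteq> r \<delta>" using d(2) g0 permutes_inj[OF h(1)] by (metis injD)
      then show ?thesis using one[OF d(1)] cyclesD(4)[OF u z True] by simp
    qed (use d not_in_terr in blast)
    ultimately show ?thesis by (auto simp: sparse_def)
  qed
  then show ?thesis using a_base unfolding sparse_decomp_def by blast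
qed

end

section \<open>Coordinates on the territory of a sparse element\<close>

text \<open>Sparsity enters through the choices: all values on a territory are trivial except possibly the one
at the chosen point.\<close>

locale sparse_element = finite_wreath K \<Gamma>
  for K :: "('k, 'm) monoid_scheme" (structure) and \<Gamma> :: "'g set" +
  fixes u :: "('g, 'k) welt" and gam rep x
  assumes u: "u \<in> carrier (swreath K \<Gamma>)"
    and choices: "wreath_choices K \<Gamma> u gam rep x"
begin

abbreviation cyc :: "('g, 'k) welt set" where
  "cyc \<equiv> cycles K \<Gamma> u"

abbreviation len :: "('g, 'k) welt \<Rightarrow> int" where
  "len z \<equiv> int (top_order \<Gamma> z)"

definition pt :: "('g, 'k) welt \<Rightarrow> int \<Rightarrow> 'g" where
  "pt z j = ipow (snd z) j (gam z)"

lemma cyc_carrier: "z \<in> cyc \<Longrightarrow> z \<in> carrier (swreath K \<Gamma>)"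
  using cyclesD(2)[OF u] wreath_cycle_carrier by blast

lemma cyc_permutes: "z \<in> cyc \<Longrightarrow> snd z permutes \<Gamma>"
  using cyc_carrier swreath_closed(2) by blast

lemma top_permutes: "snd u permutes \<Gamma>"
  using u by (rule swreath_closed)

lemma cyc_terr_subset: "z \<in> cyc \<Longrightarrow> terr K \<Gamma> z \<subseteq> \<Gamma>"
  using cyc_carrier terr_subset by blast

lemma terr_u: "terr K \<Gamma> u = (\<Union>z\<in>cyc. terr K \<Gamma> z)"
  by (rule cyclesD(6)[OF u])

lemma cyc_disjoint: "\<gamma> \<in> terr K \<Gamma> y \<Longrightarrow> \<gamma> \<in> terr K \<Gamma> z \<Longrightarrow> y \<in> cyc \<Longrightarrow> z \<in> cyc \<Longrightarrow> y = z"
  using cyclesD(3)[OF u] by blast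

lemma cyc_terr_finite: "z \<in> cyc \<Longrightarrow> finite (terr K \<Gamma> z)"
  using wreath_cycle_terr(2) cyclesD(2)[OF u] by blast

lemma gam_in_terr: "z \<in> cyc \<Longrightarrow> gam z \<in> terr K \<Gamma> z"
  using choices by (simp add: wreath_choices_def)

lemma pt_in_terr: "z \<in> cyc \<Longrightarrow> pt z j \<in> terr K \<Gamma> z"
  unfolding pt_def
  by (rule ipow_closed[OF cyc_permutes cyc_terr_finite terr_closed[OF cyc_carrier] gam_in_terr])

lemma pt_in_\<Gamma>: "z \<in> cyc \<Longrightarrow> pt z j \<in> \<Gamma>"
  using pt_in_terr cyc_terr_subset by blast

lemma pt_in_terr_u: "z \<in> cyc \<Longrightarrow> pt z j \<in> terr K \<Gamma> u"
  using pt_in_terr terr_u by blast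

lemma pt_cycle_unique: "pt y i = pt z j \<Longrightarrow> y \<in> cyc \<Longrightarrow> z \<in> cyc \<Longrightarrow> y = z"
  using cyc_disjoint[of "pt y i"] pt_in_terr[of y i] pt_in_terr[of z j] by simp

lemma ipow_pt: "z \<in> cyc \<Longrightarrow> ipow (snd z) i (pt z j) = pt z (i + j)"
  unfolding pt_def by (rule ipow_add[OF cyc_permutes])

lemma ipow_top_pt:
  assumes z: "z \<in> cyc"
  shows "ipow (snd u) i (pt z j) = pt z (i + j)"
proof -
  have "ipow (snd u) i (pt z j) = ipow (snd z) i (pt z j)"
    by (rule ipow_cong[OF cyc_permutes[OF z] top_permutes cyc_terr_finite[OF z]
          terr_closed[OF cyc_carrier[OF z]] cyclesD(5)[OF u z] pt_in_terr[OF z]])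
  then show ?thesis using ipow_pt[OF z] by simp
qed

lemma pt_0: "pt z 0 = gam z"
  by (simp add: pt_def)

lemma top_pt: "z \<in> cyc \<Longrightarrow> snd u (pt z j) = pt z (j + 1)"
  using ipow_top_pt[of z 1 j] sym.int_pow_1[of "snd u"] top_permutes
  by (simp add: sym_right_carrier add.commute)

lemma pt_surj:
  assumes z: "z \<in> cyc" and g: "\<gamma> \<in> terr K \<Gamma> z"
  obtains j where "\<gamma> = pt z j"
proof -
  have "\<gamma> \<in> orbit (snd z) (gam z)"
    using wreath_cycle_terr(4)[OF cyclesD(2)[OF u z]] gam_in_terr[OF z] g orbit_cyclic_eq3 by metis
  then obtain n where "\<gamma> = (snd z ^^ n) (gam z)" by (auto simp: orbit_altdef)
  then have "\<gamma> = pt z (int n)" by (simp add: pt_def ipow_int)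
  then show thesis by (rule that)
qed

lemma len_pos: "z \<in> cyc \<Longrightarrow> len z > 0"
  using ord_permutation_pos[OF cyc_permutes] by (simp add: top_order_def)

text \<open>A power of a cycle that fixes one point of the cycle fixes all of them, as the powers commute.\<close>

lemma pt_eq_iff:
  assumes z: "z \<in> cyc"
  shows "pt z i = pt z j \<longleftrightarrow> len z dvd i - j"
proof -
  have "pt z i = pt z j \<longleftrightarrow> ipow (snd z) (i - j) = id"
  proof
    assume eq: "pt z i = pt z j"
    have "ipow (snd z) (i - j) \<delta> = \<delta>" for \<delta>
    proof (cases "\<delta> \<in> terr K \<Gamma> z")
      case True
      then obtain k where d: "\<delta> = pt z k" using pt_surj[OF z] by blast
      have "ipow (snd z) (i - j) \<delta> = ipow (snd z) (k - j) (pt z i)"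
        unfolding d ipow_pt[OF z] by (simp add: algebra_simps)
      also have "\<dots> = \<delta>" unfolding eq d ipow_pt[OF z] by simp
      finally show ?thesis .
    next
      case False
      then show ?thesis
        using ipow_closed[OF cyc_permutes[OF z], of "{\<delta>}" \<delta>] by (simp add: not_in_terr)
    qed
    then show "ipow (snd z) (i - j) = id" by auto
  next
    assume "ipow (snd z) (i - j) = id"
    then have "ipow (snd z) (i - j) (pt z j) = pt z j" by simp
    then show "pt z i = pt z j" by (simp add: ipow_pt[OF z])
  qed
  also have "\<dots> \<longleftrightarrow> len z dvd i - j"
    using sym.int_pow_eq_id[of "snd z" "i - j"] cyc_permutes[OF z]
    by (simp add: top_order_def sym_right_carrier)
  finally show ?thesis .
qed

lemma pt_mod: "z \<in> cyc \<Longrightarrow> pt z (j mod len z) = pt z j"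
  by (simp add: pt_eq_iff) (metis dvd_minus_mod dvd_diff_commute)

text \<open>The chosen point recurs at the multiples of the length, and elsewhere on the territory the values
are trivial.\<close>

lemma base_pt:
  assumes z: "z \<in> cyc"
  shows "fst u (pt z j) = (if len z dvd j then fst u (gam z) else \<one>)"
proof (cases "len z dvd j")
  case True
  then have "pt z j = gam z" using pt_eq_iff[OF z, of j 0] by (simp add: pt_0)
  then show ?thesis using True by simp
next
  case False
  then have "pt z j \<noteq> gam z" using pt_eq_iff[OF z, of j 0] by (simp add: pt_0)
  then show ?thesis using False choices z pt_in_terr[OF z, of j] by (simp add: wreath_choices_def)
qed

lemma point_cases:
  assumes "\<gamma> \<in> \<Gamma>"
  obtains z j where "z \<in> cyc" "\<gamma> = pt z j" | "\<gamma> \<notin> terr K \<Gamma> u"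
  using assms pt_surj terr_u by blast

lemma load_in_loads: "z \<in> cyc \<Longrightarrow> load K \<Gamma> z \<in> loads K \<Gamma> u"
  by (simp add: loads_def)

lemma cycles_load_iff: "z \<in> cycles_load K \<Gamma> L u \<longleftrightarrow> z \<in> cyc \<and> load K \<Gamma> z = L"
  by (simp add: cycles_load_def)

lemma finite_cycles_load: "finite (cycles_load K \<Gamma> L u)"
  using cyclesD(1)[OF u] by (auto simp: cycles_load_def)

lemma len_load_cong: "load K \<Gamma> y = load K \<Gamma> z \<Longrightarrow> len y = len z"
  by (simp add: load_def)

section \<open>Top components that stabilise the territory decomposition\<close>

definition block :: "'k load \<Rightarrow> 'g set" where
  "block L = (\<Union>z\<in>cycles_load K \<Gamma> L u. terr K \<Gamma> z)"

lemma block_subset: "block L \<subseteq> \<Gamma>"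
proof
  fix \<gamma> assume "\<gamma> \<in> block L"
  then obtain z where "z \<in> cycles_load K \<Gamma> L u" "\<gamma> \<in> terr K \<Gamma> z"
    by (auto simp: block_def)
  then show "\<gamma> \<in> \<Gamma>" using cyc_terr_subset[of z] by (auto simp: cycles_load_iff)
qed

lemma block_cases:
  assumes "\<gamma> \<in> block L"
  obtains z j where "z \<in> cycles_load K \<Gamma> L u" "\<gamma> = pt z j"
proof -
  obtain z where z: "z \<in> cycles_load K \<Gamma> L u" "\<gamma> \<in> terr K \<Gamma> z"
    using assms by (auto simp: block_def)
  then obtain j where "\<gamma> = pt z j" using pt_surj by (metis cycles_load_iff)
  then show thesis using that z by blast
qed

lemma permuted_cycle:
  assumes "\<sigma> permutes cycles_load K \<Gamma> L u" "z \<in> cycles_load K \<Gamma> L u"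
  shows "\<sigma> z \<in> cyc" "load K \<Gamma> (\<sigma> z) = load K \<Gamma> z" "len (\<sigma> z) = len z"
proof -
  have "\<sigma> z \<in> cycles_load K \<Gamma> L u" using assms by (simp add: permutes_in_image)
  then show "\<sigma> z \<in> cyc" and l: "load K \<Gamma> (\<sigma> z) = load K \<Gamma> z"
    using assms(2) by (simp_all add: cycles_load_iff)
  show "len (\<sigma> z) = len z" by (rule len_load_cong[OF l])
qed

text \<open>The prescription is well defined because cycles of equal load have equal length.\<close>

lemma psi_exists:
  assumes s: "\<sigma> permutes cycles_load K \<Gamma> L u"
  obtains p where "p permutes \<Gamma>" "\<And>z j. z \<in> cycles_load K \<Gamma> L u \<Longrightarrow> p (pt z j) = pt (\<sigma> z) j"
    "\<And>\<gamma>. \<gamma> \<notin> block L \<Longrightarrow> p \<gamma> = \<gamma>"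
proof -
  let ?C = "cycles_load K \<Gamma> L u"
  \<comment> \<open>The cycle is unique and the coordinate is unique modulo the length, which is all that matters.\<close>
  define q where "q \<gamma> = (SOME (z, j). z \<in> ?C \<and> \<gamma> = pt z j)" for \<gamma>
  define p where "p \<gamma> = (if \<gamma> \<in> block L then pt (\<sigma> (fst (q \<gamma>))) (snd (q \<gamma>)) else \<gamma>)" for \<gamma>
  have p_pt: "p (pt z j) = pt (\<sigma> z) j" if z: "z \<in> ?C" for z j
  proof -
    have zc: "z \<in> cyc" using z by (simp add: cycles_load_iff)
    have b: "pt z j \<in> block L" using z pt_in_terr[OF zc] by (auto simp: block_def)
    have "case q (pt z j) of (y, i) \<Rightarrow> y \<in> ?C \<and> pt z j = pt y i"
      unfolding q_def by (rule someI[of _ "(z, j)"]) (use z in simp)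
    then obtain y i where yi: "q (pt z j) = (y, i)" "y \<in> ?C" "pt z j = pt y i"
      by (cases "q (pt z j)") auto
    then have "y = z" using pt_cycle_unique[OF yi(3)[symmetric]] zc by (simp add: cycles_load_iff)
    then have "len z dvd i - j" using yi pt_eq_iff[OF zc] by metis
    then have "pt (\<sigma> z) i = pt (\<sigma> z) j"
      using pt_eq_iff[OF permuted_cycle(1)[OF s z]] permuted_cycle(3)[OF s z] by simp
    then show ?thesis using b yi \<open>y = z\<close> by (simp add: p_def)
  qed
  have out: "p \<gamma> = \<gamma>" if "\<gamma> \<notin> block L" for \<gamma> using that by (simp add: p_def)
  have sub: "p ` block L \<subseteq> block L"
  proof
    fix \<delta> assume "\<delta> \<in> p ` block L"
    then obtain z j where zj: "z \<in> ?C" "\<delta> = p (pt z j)" using block_cases by (metis imageE)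
    then have "\<delta> \<in> terr K \<Gamma> (\<sigma> z)" using p_pt pt_in_terr permuted_cycle(1)[OF s] by simp
    moreover have "\<sigma> z \<in> ?C" using zj s by (simp add: permutes_in_image)
    ultimately show "\<delta> \<in> block L" by (auto simp: block_def)
  qed
  have inj: "inj_on p (block L)"
  proof (rule inj_onI)
    fix \<gamma> \<delta> assume gd: "\<gamma> \<in> block L" "\<delta> \<in> block L" "p \<gamma> = p \<delta>"
    obtain z j where zj: "z \<in> ?C" "\<gamma> = pt z j" using gd(1) by (rule block_cases)
    obtain y i where yi: "y \<in> ?C" "\<delta> = pt y i" using gd(2) by (rule block_cases)
    have eq: "pt (\<sigma> z) j = pt (\<sigma> y) i" using gd(3) zj yi p_pt by simp
    then have "\<sigma> z = \<sigma> y" by (rule pt_cycle_unique) (use permuted_cycle(1)[OF s] zj yi in auto)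
    then have zy: "z = y" using permutes_inj[OF s] by (simp add: inj_eq)
    then have "len z dvd j - i"
      using eq pt_eq_iff[OF permuted_cycle(1)[OF s zj(1)]] permuted_cycle(3)[OF s zj(1)] by simp
    then show "\<gamma> = \<delta>" using zj yi zy pt_eq_iff[of z j i] by (simp add: cycles_load_iff)
  qed
  have "finite (block L)" using block_subset finite_\<Gamma> finite_subset by blast
  then have "bij_betw p (block L) (block L)"
    using endo_inj_surj[OF _ sub inj] inj by (simp add: bij_betw_def)
  then have "p permutes block L" using out by (rule bij_imp_permutes)
  then have "p permutes \<Gamma>" using block_subset by (rule permutes_subset)
  then show thesis using p_pt out that by blast
qed

lemma not_in_block_iff:
  "\<gamma> \<notin> block L \<longleftrightarrow> (\<forall>z\<in>cycles_load K \<Gamma> L u. \<forall>j. \<gamma> \<noteq> pt z j)"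
proof
  assume "\<gamma> \<notin> block L"
  then show "\<forall>z\<in>cycles_load K \<Gamma> L u. \<forall>j. \<gamma> \<noteq> pt z j"
    using pt_in_terr by (auto simp: block_def cycles_load_iff)
next
  assume a: "\<forall>z\<in>cycles_load K \<Gamma> L u. \<forall>j. \<gamma> \<noteq> pt z j"
  show "\<gamma> \<notin> block L"
  proof
    assume "\<gamma> \<in> block L"
    then obtain z j where "z \<in> cycles_load K \<Gamma> L u" "\<gamma> = pt z j" by (rule block_cases)
    then show False using a by blast
  qed
qed

text \<open>The images of the coordinates and the fixed points leave no freedom, so the definite description in
\<open>psi\<close> is the permutation just constructed.\<close>

lemma psi_props:
  assumes s: "\<sigma> permutes cycles_load K \<Gamma> L u"
  defines "p \<equiv> psi K \<Gamma> u gam L \<sigma>"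
  shows "p permutes block L"
    and "\<And>z j. z \<in> cycles_load K \<Gamma> L u \<Longrightarrow> p (pt z j) = pt (\<sigma> z) j"
proof -
  let ?C = "cycles_load K \<Gamma> L u"
  let ?Q = "\<lambda>p. p permutes \<Gamma> \<and> (\<forall>z\<in>?C. \<forall>j. p (pt z j) = pt (\<sigma> z) j) \<and> (\<forall>\<gamma>. \<gamma> \<notin> block L \<longrightarrow> p \<gamma> = \<gamma>)"
  obtain p0 where p0: "p0 permutes \<Gamma>" "\<And>z j. z \<in> ?C \<Longrightarrow> p0 (pt z j) = pt (\<sigma> z) j"
    "\<And>\<gamma>. \<gamma> \<notin> block L \<Longrightarrow> p0 \<gamma> = \<gamma>"
    using psi_exists[OF s] by blast
  have "p = (THE p. ?Q p)"
    unfolding p_def psi_def pt_def[symmetric] not_in_block_iff ..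
  also have "\<dots> = p0"
  proof (rule the_equality)
    show "?Q p0" using p0 by blast
    fix p' assume p': "?Q p'"
    show "p' = p0"
    proof
      fix \<gamma> show "p' \<gamma> = p0 \<gamma>"
      proof (cases "\<gamma> \<in> block L")
        case True
        then obtain z j where "z \<in> ?C" "\<gamma> = pt z j" by (rule block_cases)
        then show ?thesis using p' p0(2) by simp
      qed (use p' p0(3) in simp)
    qed
  qed
  finally have "p = p0" .
  then show "p permutes block L" "\<And>z j. z \<in> ?C \<Longrightarrow> p (pt z j) = pt (\<sigma> z) j"
    using p0 by (auto intro: permutes_superset)
qed

abbreviation sig :: "('k load \<Rightarrow> ('g, 'k) welt \<Rightarrow> ('g, 'k) welt) \<Rightarrow> ('g, 'k) welt \<Rightarrow> ('g, 'k) welt" where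
  "sig \<sigma> z \<equiv> \<sigma> (load K \<Gamma> z) z"

abbreviation load_perms :: "('k load \<Rightarrow> ('g, 'k) welt \<Rightarrow> ('g, 'k) welt) set" where
  "load_perms \<equiv> (\<Pi>\<^sub>E L\<in>loads K \<Gamma> u. {p. p permutes cycles_load K \<Gamma> L u})"

lemma sig_props:
  assumes s: "\<sigma> \<in> load_perms" and z: "z \<in> cyc"
  shows "sig \<sigma> z \<in> cyc" "load K \<Gamma> (sig \<sigma> z) = load K \<Gamma> z" "len (sig \<sigma> z) = len z"
proof -
  have "\<sigma> (load K \<Gamma> z) permutes cycles_load K \<Gamma> (load K \<Gamma> z) u"
    using s load_in_loads[OF z] by blast
  then show "sig \<sigma> z \<in> cyc" "load K \<Gamma> (sig \<sigma> z) = load K \<Gamma> z" "len (sig \<sigma> z) = len z"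
    using permuted_cycle z by (simp_all add: cycles_load_iff)
qed

lemma block_disjoint: "L \<noteq> M \<Longrightarrow> block L \<inter> block M = {}"
proof (rule ccontr)
  assume "L \<noteq> M" "block L \<inter> block M \<noteq> {}"
  then obtain \<gamma> where g: "\<gamma> \<in> block L" "\<gamma> \<in> block M" by blast
  then obtain y z where "y \<in> cycles_load K \<Gamma> L u" "\<gamma> \<in> terr K \<Gamma> y"
    "z \<in> cycles_load K \<Gamma> M u" "\<gamma> \<in> terr K \<Gamma> z" unfolding block_def by blast
  then show False using cyc_disjoint[of \<gamma> y z] \<open>L \<noteq> M\<close> by (simp add: cycles_load_iff)
qed

lemma terr_u_blocks: "terr K \<Gamma> u = (\<Union>L\<in>loads K \<Gamma> u. block L)"
  unfolding terr_u block_def cycles_load_def loads_def by blast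

text \<open>On one block the inner product shifts the coordinates of each cycle and \<open>psi\<close> then permutes the
cycles; distinct loads have disjoint blocks.\<close>

lemma top_product:
  fixes e :: "('g, 'k) welt \<Rightarrow> nat"
  assumes s: "\<sigma> \<in> load_perms"
  defines "p \<equiv> set_product (sym_right \<Gamma>)
           (\<lambda>L. set_product (sym_right \<Gamma>) (\<lambda>z. snd z [^]\<^bsub>sym_right \<Gamma>\<^esub> e z) (cycles_load K \<Gamma> L u)
                \<otimes>\<^bsub>sym_right \<Gamma>\<^esub> psi K \<Gamma> u gam L (\<sigma> L))
           (loads K \<Gamma> u)"
  shows "p permutes terr K \<Gamma> u"
    and "\<And>z j. z \<in> cyc \<Longrightarrow> p (pt z j) = pt (sig \<sigma> z) (j + int (e z))"
proof -
  define Q where "Q L = set_product (sym_right \<Gamma>) (\<lambda>z. snd z [^]\<^bsub>sym_right \<Gamma>\<^esub> e z) (cycles_load K \<Gamma> L u)" for L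
  have fin: "finite (loads K \<Gamma> u)" using cyclesD(1)[OF u] by (simp add: loads_def)
  have zp: "snd z [^]\<^bsub>sym_right \<Gamma>\<^esub> e z permutes terr K \<Gamma> z" if "z \<in> cycles_load K \<Gamma> L u" for z L
    using that wreath_cycle_terr(3)[OF cyclesD(2)[OF u], of z]
    by (simp add: cycles_load_iff sym_right_nat_pow permutes_funpow)
  have disj: "terr K \<Gamma> y \<inter> terr K \<Gamma> z = {}"
    if "y \<in> cycles_load K \<Gamma> L u" "z \<in> cycles_load K \<Gamma> L u" "y \<noteq> z" for y z L
    using that cyc_disjoint[of _ y z] unfolding cycles_load_iff by blast
  have Qp: "Q L permutes block L" for L
    unfolding Q_def block_def by (rule sym_right_set_product_permutes[OF finite_cycles_load zp])
  have Qpt: "Q L (pt z j) = pt z (j + int (e z))" if z: "z \<in> cycles_load K \<Gamma> L u" for L z j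
  proof -
    have zc: "z \<in> cyc" using z by (simp add: cycles_load_iff)
    have "Q L (pt z j) = (snd z [^]\<^bsub>sym_right \<Gamma>\<^esub> e z) (pt z j)"
      unfolding Q_def
      by (rule sym_right_set_product_apply(1)[where A = "terr K \<Gamma>", OF finite_cycles_load zp disj z pt_in_terr[OF zc]])
    also have "\<dots> = ipow (snd z) (int (e z)) (pt z j)" by (simp add: int_pow_int)
    finally show ?thesis using ipow_pt[OF zc] by (simp add: add.commute)
  qed
  have psi: "psi K \<Gamma> u gam L (\<sigma> L) permutes block L"
    "\<And>z j. z \<in> cycles_load K \<Gamma> L u \<Longrightarrow> psi K \<Gamma> u gam L (\<sigma> L) (pt z j) = pt (\<sigma> L z) j"
    if "L \<in> loads K \<Gamma> u" for L
    using psi_props[of "\<sigma> L" L] s that by blast+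
  have QL: "Q L \<otimes>\<^bsub>sym_right \<Gamma>\<^esub> psi K \<Gamma> u gam L (\<sigma> L) permutes block L" if "L \<in> loads K \<Gamma> u" for L
    unfolding sym_right_simps by (rule permutes_compose[OF Qp psi(1)[OF that]])
  have p: "p = set_product (sym_right \<Gamma>) (\<lambda>L. Q L \<otimes>\<^bsub>sym_right \<Gamma>\<^esub> psi K \<Gamma> u gam L (\<sigma> L)) (loads K \<Gamma> u)"
    unfolding p_def Q_def ..
  show "p permutes terr K \<Gamma> u"
    unfolding p terr_u_blocks by (rule sym_right_set_product_permutes[OF fin QL])
  fix z j assume z: "z \<in> cyc"
  define L where "L = load K \<Gamma> z"
  have zL: "z \<in> cycles_load K \<Gamma> L u" "L \<in> loads K \<Gamma> u"
    using z load_in_loads by (simp_all add: L_def cycles_load_iff)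
  have zb: "pt z j \<in> block L" using pt_in_terr[OF z] zL by (auto simp: block_def)
  have "p (pt z j) = (Q L \<otimes>\<^bsub>sym_right \<Gamma>\<^esub> psi K \<Gamma> u gam L (\<sigma> L)) (pt z j)"
    unfolding p by (rule sym_right_set_product_apply(1)[where A = block, OF fin QL block_disjoint zL(2) zb])
  also have "\<dots> = pt (\<sigma> L z) (j + int (e z))"
    using Qpt[OF zL(1)] psi(2)[OF zL(2,1)] by simp
  finally show "p (pt z j) = pt (sig \<sigma> z) (j + int (e z))" by (simp add: L_def)
qed

text \<open>In coordinates a factorisation is an explicit formula for \<open>t\<close>. Existence and uniqueness are read
off from it.\<close>

lemma is_top_factorisation_iff:
  assumes t: "t permutes \<Gamma>"
  shows "is_top_factorisation K \<Gamma> u gam t e \<sigma> \<pi>0 \<longleftrightarrow>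
    e \<in> (\<Pi>\<^sub>E z\<in>cyc. {0..<top_order \<Gamma> z}) \<and> \<sigma> \<in> load_perms \<and> \<pi>0 permutes (\<Gamma> - terr K \<Gamma> u) \<and>
    (\<forall>z\<in>cyc. \<forall>j. t (pt z j) = pt (sig \<sigma> z) (j + int (e z))) \<and>
    (\<forall>\<gamma>. \<gamma> \<notin> terr K \<Gamma> u \<longrightarrow> t \<gamma> = \<pi>0 \<gamma>)"
proof (cases "\<sigma> \<in> load_perms \<and> \<pi>0 permutes (\<Gamma> - terr K \<Gamma> u)")
  case True
  define p where "p = set_product (sym_right \<Gamma>)
           (\<lambda>L. set_product (sym_right \<Gamma>) (\<lambda>z. snd z [^]\<^bsub>sym_right \<Gamma>\<^esub> e z) (cycles_load K \<Gamma> L u)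
                \<otimes>\<^bsub>sym_right \<Gamma>\<^esub> psi K \<Gamma> u gam L (\<sigma> L))
           (loads K \<Gamma> u)"
  have p: "p permutes terr K \<Gamma> u" "\<And>z j. z \<in> cyc \<Longrightarrow> p (pt z j) = pt (sig \<sigma> z) (j + int (e z))"
    using top_product True unfolding p_def by blast+
  have p1: "\<pi>0 (p (pt z j)) = pt (sig \<sigma> z) (j + int (e z))" if z: "z \<in> cyc" for z j
  proof -
    have "pt (sig \<sigma> z) (j + int (e z)) \<in> terr K \<Gamma> u"
      using pt_in_terr_u sig_props(1) True z by blast
    then show ?thesis using p(2)[OF z] True by (simp add: permutes_def)
  qed
  have p2: "\<pi>0 (p \<gamma>) = \<pi>0 \<gamma>" if "\<gamma> \<notin> terr K \<Gamma> u" for \<gamma>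
    using p(1) that by (simp add: permutes_def)
  have "t = p \<otimes>\<^bsub>sym_right \<Gamma>\<^esub> \<pi>0 \<longleftrightarrow>
    (\<forall>z\<in>cyc. \<forall>j. t (pt z j) = pt (sig \<sigma> z) (j + int (e z))) \<and> (\<forall>\<gamma>. \<gamma> \<notin> terr K \<Gamma> u \<longrightarrow> t \<gamma> = \<pi>0 \<gamma>)"
    (is "?l \<longleftrightarrow> ?r")
  proof
    assume ?l then show ?r using p1 p2 by simp
  next
    assume r: ?r
    have "t \<gamma> = \<pi>0 (p \<gamma>)" for \<gamma>
    proof (cases "\<gamma> \<in> terr K \<Gamma> u")
      case True
      then obtain z where "z \<in> cyc" "\<gamma> \<in> terr K \<Gamma> z" using terr_u by blast
      then obtain j where "z \<in> cyc" "\<gamma> = pt z j" using pt_surj by metis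
      then show ?thesis using r p1 by simp
    next
      case False
      then show ?thesis using r p2 by simp
    qed
    then show ?l by (simp add: fun_eq_iff)
  qed
  then show ?thesis using True unfolding is_top_factorisation_def p_def by blast
qed (auto simp: is_top_factorisation_def)

text \<open>The image of \<open>pt z 0\<close> lies on a unique cycle and has a unique coordinate in the admissible range,
and off the territory \<open>\<pi>0\<close> agrees with \<open>t\<close>.\<close>

lemma top_factorisation_unique:
  assumes t: "t permutes \<Gamma>"
    and 1: "is_top_factorisation K \<Gamma> u gam t e \<sigma> \<pi>0"
    and 2: "is_top_factorisation K \<Gamma> u gam t e' \<sigma>' \<pi>0'"
  shows "e = e' \<and> \<sigma> = \<sigma>' \<and> \<pi>0 = \<pi>0'"
proof -
  note 1 = 1[unfolded is_top_factorisation_iff[OF t]] and 2 = 2[unfolded is_top_factorisation_iff[OF t]]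
  have *: "sig \<sigma> z = sig \<sigma>' z \<and> e z = e' z" if z: "z \<in> cyc" for z
  proof -
    have eq: "pt (sig \<sigma> z) (int (e z)) = pt (sig \<sigma>' z) (int (e' z))"
      using 1 2 z by (metis add_0)
    then have s: "sig \<sigma> z = sig \<sigma>' z"
      by (rule pt_cycle_unique) (use sig_props(1) 1 2 z in blast)+
    have "len z dvd int (e z) - int (e' z)"
      using eq s pt_eq_iff[OF sig_props(1)] sig_props(3) 1 z by metis
    moreover have "e z < top_order \<Gamma> z" "e' z < top_order \<Gamma> z" using 1 2 z by auto
    ultimately have "e z = e' z"
      by (metis int_int_eq mod_eq_dvd_iff mod_less of_nat_mod)
    then show ?thesis using s by simp
  qed
  have "e = e'" using 1 2 * by (intro PiE_ext[of e cyc "\<lambda>z. {0..<top_order \<Gamma> z}"]) auto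
  moreover have "\<sigma> = \<sigma>'"
  proof (rule PiE_ext[of \<sigma> "loads K \<Gamma> u" "\<lambda>L. {p. p permutes cycles_load K \<Gamma> L u}"])
    fix L assume L: "L \<in> loads K \<Gamma> u"
    show "\<sigma> L = \<sigma>' L"
    proof
      fix z show "\<sigma> L z = \<sigma>' L z"
      proof (cases "z \<in> cycles_load K \<Gamma> L u")
        case True then show ?thesis using *[of z] by (auto simp: cycles_load_iff)
      next
        case False
        moreover have "\<sigma> L permutes cycles_load K \<Gamma> L u" "\<sigma>' L permutes cycles_load K \<Gamma> L u"
          using 1 2 L by blast+
        ultimately show ?thesis by (simp add: permutes_not_in)
      qed
    qed
  qed (use 1 2 in blast)+
  moreover have "\<pi>0 = \<pi>0'"
  proof
    fix \<gamma> show "\<pi>0 \<gamma> = \<pi>0' \<gamma>"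
      using 1 2 by (cases "\<gamma> \<in> terr K \<Gamma> u") (simp_all add: permutes_def)
  qed
  ultimately show ?thesis by simp
qed

lemma terr_inj: "inj_on (terr K \<Gamma>) cyc"
proof (rule inj_onI)
  fix y z assume "y \<in> cyc" "z \<in> cyc" "terr K \<Gamma> y = terr K \<Gamma> z"
  then show "y = z" using cyc_disjoint[of "gam y" y z] gam_in_terr[of y] by simp
qed

lemma terr_stab_image:
  assumes t: "t \<in> terr_stab K \<Gamma> H u" and z: "z \<in> cycles_load K \<Gamma> L u"
  obtains y where "y \<in> cycles_load K \<Gamma> L u" "t ` terr K \<Gamma> z = terr K \<Gamma> y"
proof -
  have L: "L \<in> loads K \<Gamma> u" using z load_in_loads[of z] by (auto simp: cycles_load_iff)
  have "family_action (loads K \<Gamma> u) t (terr_decomp K \<Gamma> u) L = terr_decomp K \<Gamma> u L"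
    using t by (simp add: terr_stab_iff)
  then have "(\<lambda>T. t ` T) ` terr K \<Gamma> ` cycles_load K \<Gamma> L u = terr K \<Gamma> ` cycles_load K \<Gamma> L u"
    using L by (simp add: family_action_def terr_decomp_def)
  then have "t ` terr K \<Gamma> z \<in> terr K \<Gamma> ` cycles_load K \<Gamma> L u" using z by blast
  then show thesis using that by blast
qed

text \<open>A permutation in the stabiliser sends each territory to one of the same load. Since it commutes
with the top component of \<open>u\<close>, the image of one point fixes the images of the whole cycle.\<close>

lemma top_factorisation_exists:
  assumes tp: "t permutes \<Gamma>" and t: "t \<in> terr_stab K \<Gamma> H u"
  obtains e \<sigma> \<pi>0 where "is_top_factorisation K \<Gamma> u gam t e \<sigma> \<pi>0"
proof -
  \<comment> \<open>The permutation of the wreath cycles that \<open>t\<close> induces on their territories.\<close>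
  define s where "s z = (SOME y. y \<in> cyc \<and> load K \<Gamma> y = load K \<Gamma> z \<and> t ` terr K \<Gamma> z = terr K \<Gamma> y)" for z
  have s: "s z \<in> cyc" "load K \<Gamma> (s z) = load K \<Gamma> z" "t ` terr K \<Gamma> z = terr K \<Gamma> (s z)"
    if z: "z \<in> cyc" for z
  proof -
    have "\<exists>y. y \<in> cyc \<and> load K \<Gamma> y = load K \<Gamma> z \<and> t ` terr K \<Gamma> z = terr K \<Gamma> y"
      using terr_stab_image[OF t, of z "load K \<Gamma> z"] z unfolding cycles_load_iff by metis
    then have "s z \<in> cyc \<and> load K \<Gamma> (s z) = load K \<Gamma> z \<and> t ` terr K \<Gamma> z = terr K \<Gamma> (s z)"
      unfolding s_def by (rule someI_ex)
    then show "s z \<in> cyc" "load K \<Gamma> (s z) = load K \<Gamma> z" "t ` terr K \<Gamma> z = terr K \<Gamma> (s z)" by blast+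
  qed
  have s_inj: "inj_on s cyc"
  proof (rule inj_onI)
    fix y z assume yz: "y \<in> cyc" "z \<in> cyc" "s y = s z"
    then have "t ` terr K \<Gamma> y = t ` terr K \<Gamma> z" using s(3) by simp
    then have "terr K \<Gamma> y = terr K \<Gamma> z" using permutes_inj[OF tp] by (simp add: inj_image_eq_iff)
    then show "y = z" using terr_inj yz by (simp add: inj_on_eq_iff)
  qed
  define \<sigma> where "\<sigma> = (\<lambda>L\<in>loads K \<Gamma> u. \<lambda>z. if z \<in> cycles_load K \<Gamma> L u then s z else z)"
  have \<sigma>: "\<sigma> \<in> load_perms"
  proof (rule PiE_I)
    fix L assume L: "L \<in> loads K \<Gamma> u"
    have sub: "cycles_load K \<Gamma> L u \<subseteq> cyc" unfolding cycles_load_iff subset_iff by blast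
    have inj: "inj_on s (cycles_load K \<Gamma> L u)" using s_inj sub by (rule inj_on_subset)
    have "s ` cycles_load K \<Gamma> L u \<subseteq> cycles_load K \<Gamma> L u"
    proof
      fix y assume "y \<in> s ` cycles_load K \<Gamma> L u"
      then obtain z where "z \<in> cycles_load K \<Gamma> L u" "y = s z" by blast
      then show "y \<in> cycles_load K \<Gamma> L u" using s(1,2)[of z] by (simp add: cycles_load_iff)
    qed
    then have "s ` cycles_load K \<Gamma> L u = cycles_load K \<Gamma> L u"
      using endo_inj_surj[OF finite_cycles_load _ inj] by simp
    then have "bij_betw (\<sigma> L) (cycles_load K \<Gamma> L u) (cycles_load K \<Gamma> L u)"
      using inj L by (simp add: \<sigma>_def bij_betw_def cong: inj_on_cong)
    then show "\<sigma> L \<in> {p. p permutes cycles_load K \<Gamma> L u}"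
      using L by (simp add: bij_imp_permutes \<sigma>_def)
  qed (simp add: \<sigma>_def)
  have sig: "sig \<sigma> z = s z" if "z \<in> cyc" for z
    using that load_in_loads by (simp add: \<sigma>_def cycles_load_iff)
  have "\<exists>e. e < top_order \<Gamma> z \<and> t (gam z) = pt (s z) (int e)" if z: "z \<in> cyc" for z
  proof -
    have "t (gam z) \<in> terr K \<Gamma> (s z)" using s(3)[OF z] gam_in_terr[OF z] by blast
    then obtain j where j: "t (gam z) = pt (s z) j" using pt_surj[OF s(1)[OF z]] by blast
    have "len (s z) = len z" by (rule len_load_cong[OF s(2)[OF z]])
    then have "t (gam z) = pt (s z) (int (nat (j mod len z)))" "nat (j mod len z) < top_order \<Gamma> z"
      using j pt_mod[OF s(1)[OF z], of j] len_pos[OF z] by (simp_all add: nat_less_iff)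
    then show ?thesis by blast
  qed
  then obtain e0 where e0: "\<And>z. z \<in> cyc \<Longrightarrow> e0 z < top_order \<Gamma> z \<and> t (gam z) = pt (s z) (int (e0 z))"
    by metis
  define e where "e = restrict e0 cyc"
  have th: "t (snd u \<gamma>) = snd u (t \<gamma>)" for \<gamma>
    using t by (simp add: terr_stab_iff fun_eq_iff)
  have tpt: "t (pt z j) = pt (sig \<sigma> z) (j + int (e z))" if z: "z \<in> cyc" for z j
  proof -
    have "pt z j = ipow (snd u) j (pt z 0)" by (simp add: ipow_top_pt[OF z])
    then have "t (pt z j) = ipow (snd u) j (t (pt z 0))"
      using ipow_intertwine[OF top_permutes top_permutes, of UNIV t "pt z 0" j] th by simp
    also have "\<dots> = ipow (snd u) j (pt (s z) (int (e0 z)))" using e0[OF z] by (simp add: pt_0)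
    also have "\<dots> = pt (s z) (j + int (e0 z))" by (rule ipow_top_pt[OF s(1)[OF z]])
    finally show ?thesis using z sig[OF z] by (simp add: e_def)
  qed
  have "t ` terr K \<Gamma> u \<subseteq> terr K \<Gamma> u"
    using s unfolding terr_u image_UN by blast
  moreover have fin: "finite (terr K \<Gamma> u)" using terr_subset[OF u] finite_\<Gamma> finite_subset by blast
  ultimately have tu: "t \<gamma> \<in> terr K \<Gamma> u \<Longrightarrow> \<gamma> \<in> terr K \<Gamma> u" for \<gamma>
    using permutes_closed_finite[OF tp, of "terr K \<Gamma> u" \<gamma>] by blast
  have tG: "t \<gamma> \<in> \<Gamma> \<longleftrightarrow> \<gamma> \<in> \<Gamma>" for \<gamma> using tp by (rule permutes_in_image)
  \<comment> \<open>As \<open>t\<close> preserves the territory of \<open>u\<close>, it also preserves the complement.\<close>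
  define \<pi>0 where "\<pi>0 = perm_restrict t (\<Gamma> - terr K \<Gamma> u)"
  have "t ` (\<Gamma> - terr K \<Gamma> u) = \<Gamma> - terr K \<Gamma> u"
    using tu tG finite_\<Gamma> permutes_inj_on[OF tp] by (intro endo_inj_surj) auto
  then have "bij_betw \<pi>0 (\<Gamma> - terr K \<Gamma> u) (\<Gamma> - terr K \<Gamma> u)"
    using permutes_inj_on[OF tp, of "\<Gamma> - terr K \<Gamma> u"]
    by (simp add: \<pi>0_def bij_betw_def perm_restrict_def inj_on_def cong: image_cong_simp)
  then have "\<pi>0 permutes \<Gamma> - terr K \<Gamma> u"
    by (rule bij_imp_permutes) (auto simp: \<pi>0_def perm_restrict_def)
  moreover have "\<forall>\<gamma>. \<gamma> \<notin> terr K \<Gamma> u \<longrightarrow> t \<gamma> = \<pi>0 \<gamma>"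
    using tp by (auto simp: \<pi>0_def perm_restrict_def permutes_def)
  moreover have "e \<in> (\<Pi>\<^sub>E z\<in>cyc. {0..<top_order \<Gamma> z})" using e0 by (auto simp: e_def)
  ultimately have "is_top_factorisation K \<Gamma> u gam t e \<sigma> \<pi>0"
    using \<sigma> tpt by (simp add: is_top_factorisation_iff[OF tp])
  then show thesis by (rule that)
qed

section \<open>The commutation equation in coordinates\<close>

abbreviation F :: "('g, 'k) welt \<Rightarrow> 'k" where
  "F z \<equiv> fst u (gam z)"

lemma F_closed: "z \<in> cyc \<Longrightarrow> F z \<in> carrier K"
  using swreath_closed(1)[OF u] pt_in_\<Gamma>[of z 0] by (simp add: pt_0)

lemma rep_props:
  assumes "L \<in> loads K \<Gamma> u"
  shows "rep L \<in> cycles_load K \<Gamma> L u" "x (rep L) = \<one>"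
  using choices assms by (simp_all add: wreath_choices_def)

text \<open>The representative of a load is its own conjugate by \<open>1\<close>, so the defining relation of the
conjugating elements holds for all wreath cycles alike.\<close>

lemma x_props:
  assumes z: "z \<in> cyc"
  shows "x z \<in> carrier K" "F (rep (load K \<Gamma> z)) \<in> carrier K"
    "F z = inv (x z) \<otimes> F (rep (load K \<Gamma> z)) \<otimes> x z"
proof -
  let ?L = "load K \<Gamma> z"
  have L: "?L \<in> loads K \<Gamma> u" by (rule load_in_loads[OF z])
  show Fc: "F (rep ?L) \<in> carrier K" using rep_props(1)[OF L] F_closed by (simp add: cycles_load_iff)
  have "x z \<in> carrier K \<and> F z = inv (x z) \<otimes> F (rep ?L) \<otimes> x z"
  proof (cases "z = rep ?L")
    case True
    then have "x z = \<one>" using rep_props(2)[OF L] by simp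
    then show ?thesis using Fc True by simp
  next
    case False
    then have "z \<in> cycles_load K \<Gamma> ?L u - {rep ?L}" using z by (simp add: cycles_load_iff)
    then show ?thesis using choices L unfolding wreath_choices_def by blast
  qed
  then show "x z \<in> carrier K" "F z = inv (x z) \<otimes> F (rep ?L) \<otimes> x z" by blast+
qed

text \<open>Splitting the commutation equation into one equation for each wreath cycle. Off the territory both
sides are \<open>s \<gamma>\<close>.\<close>

lemma commute_iff:
  assumes s: "s \<in> (\<Pi>\<^sub>E \<gamma>\<in>\<Gamma>. carrier K)" and t: "t permutes \<Gamma>"
    and th: "snd u \<circ> t = t \<circ> snd u"
    and fac: "is_top_factorisation K \<Gamma> u gam t e \<sigma> \<pi>0"
  shows "(s, t) \<otimes>\<^bsub>swreath K \<Gamma>\<^esub> u = u \<otimes>\<^bsub>swreath K \<Gamma>\<^esub> (s, t) \<longleftrightarrow>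
    (\<forall>z\<in>cyc. F z \<otimes> s (pt z (- int (e z))) = s (pt z (- int (e z))) \<otimes> F (sig \<sigma> z) \<and>
      (\<forall>j. 0 \<le> j \<longrightarrow> j < len z \<longrightarrow> s (pt z (j - int (e z))) =
         (if int (e z) < j \<or> j = 0 then s (pt z (- int (e z)))
          else s (pt z (- int (e z))) \<otimes> F (sig \<sigma> z))))"
proof -
  note f = fac[unfolded is_top_factorisation_iff[OF t]]
  have sc: "\<gamma> \<in> \<Gamma> \<Longrightarrow> s \<gamma> \<in> carrier K" for \<gamma> using s by blast
  have tG: "t \<gamma> \<in> \<Gamma> \<longleftrightarrow> \<gamma> \<in> \<Gamma>" for \<gamma> using t by (rule permutes_in_image)
  let ?eq = "\<lambda>\<gamma>. s \<gamma> \<otimes> fst u (t \<gamma>) = fst u \<gamma> \<otimes> s (snd u \<gamma>)"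
  have thp: "snd u (t \<gamma>) = t (snd u \<gamma>)" for \<gamma> using th by (simp add: fun_eq_iff)
  have out: "?eq \<gamma>" if g: "\<gamma> \<in> \<Gamma>" "\<gamma> \<notin> terr K \<Gamma> u" for \<gamma>
  proof -
    have "t \<gamma> = \<pi>0 \<gamma>" using f g(2) by blast
    moreover have "\<pi>0 \<gamma> \<in> \<Gamma> - terr K \<Gamma> u" using f g permutes_in_image[of \<pi>0 "\<Gamma> - terr K \<Gamma> u" \<gamma>] by blast
    ultimately show ?thesis using g sc by (simp add: not_in_terr)
  qed
  have "(s, t) \<otimes>\<^bsub>swreath K \<Gamma>\<^esub> u = u \<otimes>\<^bsub>swreath K \<Gamma>\<^esub> (s, t) \<longleftrightarrow> (\<forall>\<gamma>\<in>\<Gamma>. ?eq \<gamma>)"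
    by (simp add: wreath_mult_eq_iff thp)
  also have "\<dots> \<longleftrightarrow> (\<forall>z\<in>cyc. \<forall>j. ?eq (pt z (j - int (e z))))" (is "?A \<longleftrightarrow> ?B")
  proof
    assume ?A then show ?B using pt_in_\<Gamma> by blast
  next
    assume B: ?B
    show ?A
    proof
      fix \<gamma> assume g: "\<gamma> \<in> \<Gamma>"
      then show "?eq \<gamma>"
      proof (cases rule: point_cases)
        case (1 z j)
        then show ?thesis using B[rule_format, of z "j + int (e z)"] by simp
      qed (use out g in blast)
    qed
  qed
  also have "\<dots> \<longleftrightarrow> (\<forall>z\<in>cyc. F z \<otimes> s (pt z (- int (e z))) = s (pt z (- int (e z))) \<otimes> F (sig \<sigma> z) \<and>
      (\<forall>j. 0 \<le> j \<longrightarrow> j < len z \<longrightarrow> s (pt z (j - int (e z))) =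
         (if int (e z) < j \<or> j = 0 then s (pt z (- int (e z)))
          else s (pt z (- int (e z))) \<otimes> F (sig \<sigma> z))))"
  proof (rule ball_cong[OF refl])
    fix z assume z: "z \<in> cyc"
    have sz: "sig \<sigma> z \<in> cyc" "len (sig \<sigma> z) = len z" using sig_props z f by blast+
    \<comment> \<open>Position \<open>j\<close> is the point that \<open>t\<close> sends to coordinate \<open>j\<close> of the image cycle.\<close>
    define S where "S j = s (pt z (j - int (e z)))" for j
    have ez: "e z < top_order \<Gamma> z" using f z by auto
    have eqj: "?eq (pt z (j - int (e z))) \<longleftrightarrow> S j \<otimes> (if len z dvd j then F (sig \<sigma> z) else \<one>) =
      (if len z dvd j - int (e z) then F z else \<one>) \<otimes> S (j + 1)" for j
    proof -
      have "t (pt z (j - int (e z))) = pt (sig \<sigma> z) (j - int (e z) + int (e z))" using f z by blast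
      moreover have "snd u (pt z (j - int (e z))) = pt z (j + 1 - int (e z))"
        unfolding top_pt[OF z] by (simp add: algebra_simps)
      ultimately show ?thesis
        using base_pt[OF sz(1), of j] base_pt[OF z, of "j - int (e z)"] sz(2)
        by (simp only: S_def diff_add_cancel)
    qed
    have per: "S (j mod len z) = S j" for j
    proof -
      have "pt z (j mod len z - int (e z)) = pt z (j - int (e z))"
        unfolding pt_eq_iff[OF z] by (simp add: mod_eq_dvd_iff[symmetric] mod_simps)
      then show ?thesis by (simp add: S_def)
    qed
    have "(\<forall>j. ?eq (pt z (j - int (e z)))) \<longleftrightarrow> F z \<otimes> S 0 = S 0 \<otimes> F (sig \<sigma> z) \<and>
      (\<forall>j. 0 \<le> j \<longrightarrow> j < len z \<longrightarrow> S j = (if int (e z) < j \<or> j = 0 then S 0 else S 0 \<otimes> F (sig \<sigma> z)))"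
      unfolding eqj
      by (rule shifted_intertwiner_sequence)
        (use ez per sc pt_in_\<Gamma>[OF z] F_closed[OF z] F_closed[OF sz(1)] in \<open>simp_all add: S_def\<close>)
    then show "(\<forall>j. ?eq (pt z (j - int (e z)))) \<longleftrightarrow>
      F z \<otimes> s (pt z (- int (e z))) = s (pt z (- int (e z))) \<otimes> F (sig \<sigma> z) \<and>
      (\<forall>j. 0 \<le> j \<longrightarrow> j < len z \<longrightarrow> s (pt z (j - int (e z))) =
         (if int (e z) < j \<or> j = 0 then s (pt z (- int (e z)))
          else s (pt z (- int (e z))) \<otimes> F (sig \<sigma> z)))"
      by (simp add: S_def)
  qed
  finally show ?thesis .
qed

section \<open>The parametrisation of the centraliser\<close>

text \<open>The definite description of \<open>(z, j)\<close> inside \<open>phi\<close> has exactly one solution.\<close>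

lemma shifted_coordinates_unique:
  assumes z: "z \<in> cyc" and j: "j < top_order \<Gamma> z"
  shows "(THE (y, i). y \<in> cyc \<and> i < top_order \<Gamma> y \<and>
    pt z (int j - int (e z)) = (snd u [^]\<^bsub>sym_right \<Gamma>\<^esub> (int i - int (e y))) (gam y)) = (z, j)"
proof (rule the_equality)
  have eq: "(snd u [^]\<^bsub>sym_right \<Gamma>\<^esub> k) (gam y) = pt y k" if "y \<in> cyc" for y k
    using ipow_top_pt[OF that, of k 0] by (simp add: pt_0)
  show "case (z, j) of (y, i) \<Rightarrow> y \<in> cyc \<and> i < top_order \<Gamma> y \<and>
    pt z (int j - int (e z)) = (snd u [^]\<^bsub>sym_right \<Gamma>\<^esub> (int i - int (e y))) (gam y)"
    using z j eq by simp
  fix yi assume "case yi of (y, i) \<Rightarrow> y \<in> cyc \<and> i < top_order \<Gamma> y \<and>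
    pt z (int j - int (e z)) = (snd u [^]\<^bsub>sym_right \<Gamma>\<^esub> (int i - int (e y))) (gam y)"
  then obtain y i where yi: "yi = (y, i)" "y \<in> cyc" "i < top_order \<Gamma> y"
    "pt z (int j - int (e z)) = pt y (int i - int (e y))" using eq by (cases yi) auto
  have "z = y" by (rule pt_cycle_unique[OF yi(4) z yi(2)])
  then have "len z dvd int j - int i" using yi(4) pt_eq_iff[OF z] by simp
  then have "int j = int i" using j yi(3) \<open>z = y\<close>
    by (metis mod_eq_dvd_iff mod_less of_nat_mod)
  then show "yi = (z, j)" using yi \<open>z = y\<close> by simp
qed

text \<open>The value of \<open>\<Phi>\<close> at the point from which the cycle is read; all other values on the territory
differ from it at most by the factor \<open>F y\<close>.\<close>

definition cval :: "('k load \<Rightarrow> 'g set \<Rightarrow> 'k) \<Rightarrow> ('g, 'k) welt \<Rightarrow> ('g, 'k) welt \<Rightarrow> 'k" where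
  "cval c z y = inv (x z) \<otimes> c (load K \<Gamma> z) (terr K \<Gamma> z) \<otimes> x y"

text \<open>Evaluates the definite descriptions in \<open>phi\<close>, given the factorisation of \<open>t\<close>.\<close>

lemma phi_value:
  fixes c :: "'k load \<Rightarrow> 'g set \<Rightarrow> 'k" and d :: "'g \<Rightarrow> 'k"
  assumes t: "t permutes \<Gamma>" and fac: "is_top_factorisation K \<Gamma> u gam t e \<sigma> \<pi>0"
  defines "s \<equiv> fst (phi K \<Gamma> u gam x ((c, d), t))"
  shows "snd (phi K \<Gamma> u gam x ((c, d), t)) = t"
    and "s \<in> extensional \<Gamma>"
    and "\<And>z j. z \<in> cyc \<Longrightarrow> 0 \<le> j \<Longrightarrow> j < len z \<Longrightarrow> s (pt z (j - int (e z))) =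
      (if int (e z) < j \<or> j = 0 then cval c z (sig \<sigma> z) else cval c z (sig \<sigma> z) \<otimes> F (sig \<sigma> z))"
    and "\<And>\<gamma>. \<gamma> \<in> \<Gamma> - terr K \<Gamma> u \<Longrightarrow> s \<gamma> = d \<gamma>"
proof -
  have the: "(THE (e, \<sigma>, \<pi>0). is_top_factorisation K \<Gamma> u gam t e \<sigma> \<pi>0) = (e, \<sigma>, \<pi>0)"
    by (rule the_equality) (use fac top_factorisation_unique[OF t] in auto)
  show "snd (phi K \<Gamma> u gam x ((c, d), t)) = t"
    unfolding phi_def by (simp add: the)
  have s: "s = (\<lambda>\<gamma>\<in>\<Gamma>.
           if \<gamma> \<in> terr K \<Gamma> u then
             let (z, j) = (THE (z, j). z \<in> cycles K \<Gamma> u \<and> j < top_order \<Gamma> z \<and>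
                    \<gamma> = (snd u [^]\<^bsub>sym_right \<Gamma>\<^esub> (int j - int (e z))) (gam z));
                 L = load K \<Gamma> z;
                 y = \<sigma> L z;
                 v = inv (x z) \<otimes> c L (terr K \<Gamma> z) \<otimes> x y
             in if e z < j \<or> j = 0 then v else v \<otimes> fst u (gam y)
           else d \<gamma>)"
    unfolding s_def phi_def by (simp add: the)
  show "s \<in> extensional \<Gamma>" unfolding s by simp
  show "\<And>\<gamma>. \<gamma> \<in> \<Gamma> - terr K \<Gamma> u \<Longrightarrow> s \<gamma> = d \<gamma>" unfolding s by simp
  fix z and j :: int assume z: "z \<in> cyc" and j: "0 \<le> j" "j < len z"
  obtain i where i: "j = int i" "i < top_order \<Gamma> z" using j by (metis nonneg_int_cases of_nat_less_iff)
  have "s (pt z (j - int (e z))) =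
      (if e z < i \<or> i = 0 then cval c z (sig \<sigma> z) else cval c z (sig \<sigma> z) \<otimes> F (sig \<sigma> z))"
    unfolding s using pt_in_\<Gamma>[OF z] pt_in_terr_u[OF z] i
    by (simp add: shifted_coordinates_unique[OF z i(2)] cval_def Let_def)
  then show "s (pt z (j - int (e z))) =
      (if int (e z) < j \<or> j = 0 then cval c z (sig \<sigma> z) else cval c z (sig \<sigma> z) \<otimes> F (sig \<sigma> z))"
    by (simp add: i(1))
qed

lemma base_kernel_carrier:
  "(c, c0) \<in> carrier (base_kernel K \<Gamma> u gam rep) \<longleftrightarrow>
    c \<in> (\<Pi>\<^sub>E L\<in>loads K \<Gamma> u. \<Pi>\<^sub>E T\<in>terr K \<Gamma> ` cycles_load K \<Gamma> L u. centraliser K (carrier K) (F (rep L))) \<and>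
    c0 \<in> (\<Pi>\<^sub>E \<gamma>\<in>\<Gamma> - terr K \<Gamma> u. carrier K)"
  by (simp add: base_kernel_def DirProd_def)

lemma base_kernel_comp:
  assumes c: "(c, c0) \<in> carrier (base_kernel K \<Gamma> u gam rep)" and z: "z \<in> cyc"
  shows "c (load K \<Gamma> z) (terr K \<Gamma> z) \<in> carrier K"
    "c (load K \<Gamma> z) (terr K \<Gamma> z) \<otimes> F (rep (load K \<Gamma> z)) = F (rep (load K \<Gamma> z)) \<otimes> c (load K \<Gamma> z) (terr K \<Gamma> z)"
proof -
  have "c (load K \<Gamma> z) \<in> (\<Pi>\<^sub>E T\<in>terr K \<Gamma> ` cycles_load K \<Gamma> (load K \<Gamma> z) u. centraliser K (carrier K) (F (rep (load K \<Gamma> z))))"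
    using c load_in_loads[OF z] unfolding base_kernel_carrier by blast
  moreover have "terr K \<Gamma> z \<in> terr K \<Gamma> ` cycles_load K \<Gamma> (load K \<Gamma> z) u"
    using z by (simp add: cycles_load_iff)
  ultimately have "c (load K \<Gamma> z) (terr K \<Gamma> z) \<in> centraliser K (carrier K) (F (rep (load K \<Gamma> z)))" by blast
  then show "c (load K \<Gamma> z) (terr K \<Gamma> z) \<in> carrier K"
    "c (load K \<Gamma> z) (terr K \<Gamma> z) \<otimes> F (rep (load K \<Gamma> z)) = F (rep (load K \<Gamma> z)) \<otimes> c (load K \<Gamma> z) (terr K \<Gamma> z)"
    by (simp_all add: centraliser_def)
qed

lemma intertwiner_iff:
  assumes z: "z \<in> cyc" "y \<in> cyc" "load K \<Gamma> y = load K \<Gamma> z" and d: "d \<in> carrier K"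
  shows "F z \<otimes> (inv (x z) \<otimes> d \<otimes> x y) = (inv (x z) \<otimes> d \<otimes> x y) \<otimes> F y \<longleftrightarrow>
    d \<otimes> F (rep (load K \<Gamma> z)) = F (rep (load K \<Gamma> z)) \<otimes> d"
  unfolding x_props(3)[OF z(1)] x_props(3)[OF z(2)] z(3)
  by (rule conj_intertwiner_iff[OF x_props(1)[OF z(1)] x_props(1)[OF z(2)] x_props(2)[OF z(1)] d])

lemma cval_closed:
  "(c, c0) \<in> carrier (base_kernel K \<Gamma> u gam rep) \<Longrightarrow> z \<in> cyc \<Longrightarrow> y \<in> cyc \<Longrightarrow> cval c z y \<in> carrier K"
  using base_kernel_comp(1) x_props(1) by (simp add: cval_def)

lemma cval_intertwines:
  assumes "(c, c0) \<in> carrier (base_kernel K \<Gamma> u gam rep)" "z \<in> cyc" "y \<in> cyc"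
    and "load K \<Gamma> y = load K \<Gamma> z"
  shows "F z \<otimes> cval c z y = cval c z y \<otimes> F y"
  unfolding cval_def intertwiner_iff[OF assms(2-4) base_kernel_comp(1)[OF assms(1,2)]]
  by (rule base_kernel_comp(2)[OF assms(1,2)])

text \<open>For any shift \<open>i\<close>, each coordinate can be normalised to the range in which \<open>phi\<close> is given by cases.\<close>

lemma pt_shifted:
  assumes z: "z \<in> cyc"
  obtains k where "0 \<le> k" "k < len z" "pt z j = pt z (k - i)"
proof
  show "0 \<le> (j + i) mod len z" "(j + i) mod len z < len z" using len_pos[OF z] by simp_all
  have "len z dvd j - ((j + i) mod len z - i)"
    by (simp add: mod_eq_dvd_iff[symmetric] mod_simps)
  then show "pt z j = pt z ((j + i) mod len z - i)" unfolding pt_eq_iff[OF z] .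
qed

lemma phi_in_centraliser:
  assumes H: "subgroup H (sym_right \<Gamma>)"
    and c: "(c, c0) \<in> carrier (base_kernel K \<Gamma> u gam rep)" and t: "t \<in> terr_stab K \<Gamma> H u"
  shows "phi K \<Gamma> u gam x ((c, c0), t) \<in> centraliser (swreath K \<Gamma>) (carrier (wreath K \<Gamma> H)) u"
proof -
  have tH: "t \<in> H" and th: "snd u \<circ> t = t \<circ> snd u" using t by (auto simp: terr_stab_iff)
  have tp: "t permutes \<Gamma>" using tH subgroup.subset[OF H] by (auto simp: sym_right_carrier)
  obtain e \<sigma> \<pi>0 where fac: "is_top_factorisation K \<Gamma> u gam t e \<sigma> \<pi>0"
    using top_factorisation_exists[OF tp t] by blast
  note f = fac[unfolded is_top_factorisation_iff[OF tp]]
  note v = phi_value[OF tp fac, where c = c and d = c0]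
  define s where "s = fst (phi K \<Gamma> u gam x ((c, c0), t))"
  have phi: "phi K \<Gamma> u gam x ((c, c0), t) = (s, t)" using v(1) by (simp add: s_def prod_eq_iff)
  note v = v(2-4)[folded s_def]
  have s0: "s (pt z (- int (e z))) = cval c z (sig \<sigma> z)" if z: "z \<in> cyc" for z
    using v(2)[OF z, of 0] len_pos[OF z] by simp
  have sc: "s \<gamma> \<in> carrier K" if g: "\<gamma> \<in> \<Gamma>" for \<gamma>
    using g
  proof (cases rule: point_cases)
    case (1 z j)
    have sz: "sig \<sigma> z \<in> cyc" using sig_props(1)[OF _ 1(1)] f by blast
    obtain k where "0 \<le> k" "k < len z" "pt z j = pt z (k - int (e z))"
      using pt_shifted[OF 1(1)] by blast
    then show ?thesis
      using v(2)[OF 1(1), of k] 1(2) cval_closed[OF c 1(1) sz] F_closed[OF sz] by simp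
  next
    case 2
    then show ?thesis using v(3)[of \<gamma>] g c unfolding base_kernel_carrier by auto
  qed
  have s: "s \<in> (\<Pi>\<^sub>E \<gamma>\<in>\<Gamma>. carrier K)" using v(1) sc by (simp add: PiE_iff)
  have "(s, t) \<otimes>\<^bsub>swreath K \<Gamma>\<^esub> u = u \<otimes>\<^bsub>swreath K \<Gamma>\<^esub> (s, t)"
    unfolding commute_iff[OF s tp th fac]
  proof (intro ballI conjI allI impI)
    fix z assume z: "z \<in> cyc"
    have sz: "sig \<sigma> z \<in> cyc" "load K \<Gamma> (sig \<sigma> z) = load K \<Gamma> z" using sig_props[OF _ z] f by blast+
    show "F z \<otimes> s (pt z (- int (e z))) = s (pt z (- int (e z))) \<otimes> F (sig \<sigma> z)"
      unfolding s0[OF z] by (rule cval_intertwines[OF c z sz])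
    fix j assume "0 \<le> j" "j < len z"
    then show "s (pt z (j - int (e z))) =
         (if int (e z) < j \<or> j = 0 then s (pt z (- int (e z)))
          else s (pt z (- int (e z))) \<otimes> F (sig \<sigma> z))"
      using v(2)[OF z] s0[OF z] by simp
  qed
  then show ?thesis using s tH by (simp add: phi centraliser_def wreath_carrier)
qed

text \<open>The components of \<open>c\<close> are recovered from the values at the points \<open>pt z (- e z)\<close>.\<close>

lemma phi_inj:
  assumes H: "subgroup H (sym_right \<Gamma>)"
    and c: "(c, c0) \<in> carrier (base_kernel K \<Gamma> u gam rep)" and t: "t \<in> terr_stab K \<Gamma> H u"
    and d: "(d, d0) \<in> carrier (base_kernel K \<Gamma> u gam rep)" and t': "t' \<in> terr_stab K \<Gamma> H u"
    and eq: "phi K \<Gamma> u gam x ((c, c0), t) = phi K \<Gamma> u gam x ((d, d0), t')"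
  shows "c = d \<and> c0 = d0 \<and> t = t'"
proof -
  have tp: "t permutes \<Gamma>" "t' permutes \<Gamma>"
    using t t' subgroup.subset[OF H] by (auto simp: terr_stab_iff sym_right_carrier)
  obtain e \<sigma> \<pi>0 where fac: "is_top_factorisation K \<Gamma> u gam t e \<sigma> \<pi>0"
    using top_factorisation_exists[OF tp(1) t] by blast
  obtain e' \<sigma>' \<pi>0' where fac': "is_top_factorisation K \<Gamma> u gam t' e' \<sigma>' \<pi>0'"
    using top_factorisation_exists[OF tp(2) t'] by blast
  have tt: "t = t'" using phi_value(1)[OF tp(1) fac] phi_value(1)[OF tp(2) fac'] eq by metis
  note f = fac[unfolded is_top_factorisation_iff[OF tp(1)]]
  note v = phi_value[OF tp(1) fac]
  have comp: "c (load K \<Gamma> z) (terr K \<Gamma> z) = d (load K \<Gamma> z) (terr K \<Gamma> z)" if z: "z \<in> cyc" for z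
  proof -
    have sz: "sig \<sigma> z \<in> cyc" using sig_props(1)[OF _ z] f by blast
    have "cval c z (sig \<sigma> z) = cval d z (sig \<sigma> z)"
      using v(3)[OF z, of 0, where c = c and d = c0] v(3)[OF z, of 0, where c = d and d = d0] len_pos[OF z] eq tt by simp
    then show ?thesis
      unfolding cval_def
      using x_props(1)[OF z] x_props(1)[OF sz] base_kernel_comp(1)[OF c z] base_kernel_comp(1)[OF d z]
      by (simp add: m_assoc)
  qed
  note c' = c[unfolded base_kernel_carrier] and d' = d[unfolded base_kernel_carrier]
  have "c = d"
  proof (rule PiE_ext[OF c'[THEN conjunct1] d'[THEN conjunct1]])
    fix L assume L: "L \<in> loads K \<Gamma> u"
    have cL: "c L \<in> (\<Pi>\<^sub>E T\<in>terr K \<Gamma> ` cycles_load K \<Gamma> L u. centraliser K (carrier K) (F (rep L)))"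
      and dL: "d L \<in> (\<Pi>\<^sub>E T\<in>terr K \<Gamma> ` cycles_load K \<Gamma> L u. centraliser K (carrier K) (F (rep L)))"
      using c' d' L by blast+
    show "c L = d L"
    proof (rule PiE_ext[OF cL dL])
      fix T assume "T \<in> terr K \<Gamma> ` cycles_load K \<Gamma> L u"
      then obtain z where "z \<in> cycles_load K \<Gamma> L u" "T = terr K \<Gamma> z" by blast
      then show "c L T = d L T" using comp[of z] by (auto simp: cycles_load_iff)
    qed
  qed
  moreover have "c0 = d0"
  proof (rule PiE_ext[OF c'[THEN conjunct2] d'[THEN conjunct2]])
    fix \<gamma> assume "\<gamma> \<in> \<Gamma> - terr K \<Gamma> u"
    then show "c0 \<gamma> = d0 \<gamma>" using v(4)[where c = c and d = c0] v(4)[where c = d and d = d0] eq tt by simp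
  qed
  ultimately show ?thesis using tt by simp
qed

text \<open>The values of a commuting element at the points \<open>pt z (- e z)\<close> are intertwiners, so they have
the required form, and they determine all other values on the territory.\<close>

lemma phi_surj:
  assumes H: "subgroup H (sym_right \<Gamma>)"
    and b: "b \<in> centraliser (swreath K \<Gamma>) (carrier (wreath K \<Gamma> H)) u"
  obtains c c0 t where "(c, c0) \<in> carrier (base_kernel K \<Gamma> u gam rep)" "t \<in> terr_stab K \<Gamma> H u"
    "phi K \<Gamma> u gam x ((c, c0), t) = b"
proof -
  obtain s t where st: "b = (s, t)" by (cases b)
  have s: "s \<in> (\<Pi>\<^sub>E \<gamma>\<in>\<Gamma>. carrier K)" and tH: "t \<in> H"
    and bu: "(s, t) \<otimes>\<^bsub>swreath K \<Gamma>\<^esub> u = u \<otimes>\<^bsub>swreath K \<Gamma>\<^esub> (s, t)"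
    using b by (simp_all add: centraliser_def wreath_carrier st)
  have tp: "t permutes \<Gamma>" using tH subgroup.subset[OF H] by (auto simp: sym_right_carrier)
  have bS: "(s, t) \<in> carrier (swreath K \<Gamma>)" using s tp by (simp add: swreath_carrier)
  have t: "t \<in> terr_stab K \<Gamma> H u"
    using centraliser_top_in_terr_stab[OF u bS, of H] tH bu by simp
  then have th: "snd u \<circ> t = t \<circ> snd u" by (simp add: terr_stab_iff)
  obtain e \<sigma> \<pi>0 where fac: "is_top_factorisation K \<Gamma> u gam t e \<sigma> \<pi>0"
    using top_factorisation_exists[OF tp t] by blast
  note f = fac[unfolded is_top_factorisation_iff[OF tp]]
  note rec = bu[unfolded commute_iff[OF s tp th fac]]
  have sc: "\<gamma> \<in> \<Gamma> \<Longrightarrow> s \<gamma> \<in> carrier K" for \<gamma> using s by blast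
  \<comment> \<open>Solves \<open>cval\<close> for the component of \<open>c\<close> at \<open>z\<close>.\<close>
  define d where "d z = x z \<otimes> s (pt z (- int (e z))) \<otimes> inv (x (sig \<sigma> z))" for z
  define c where "c = (\<lambda>L\<in>loads K \<Gamma> u. \<lambda>T\<in>terr K \<Gamma> ` cycles_load K \<Gamma> L u. d (inv_into cyc (terr K \<Gamma>) T))"
  define c0 where "c0 = restrict s (\<Gamma> - terr K \<Gamma> u)"
  have dz: "d z \<in> centraliser K (carrier K) (F (rep (load K \<Gamma> z)))"
    "inv (x z) \<otimes> d z \<otimes> x (sig \<sigma> z) = s (pt z (- int (e z)))" if z: "z \<in> cyc" for z
  proof -
    have sz: "sig \<sigma> z \<in> cyc" "load K \<Gamma> (sig \<sigma> z) = load K \<Gamma> z" using sig_props[OF _ z] f by blast+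
    have clo: "x z \<in> carrier K" "x (sig \<sigma> z) \<in> carrier K" "s (pt z (- int (e z))) \<in> carrier K"
      using x_props(1)[OF z] x_props(1)[OF sz(1)] sc[OF pt_in_\<Gamma>[OF z]] by auto
    then have dc: "d z \<in> carrier K" by (simp add: d_def)
    have "inv (x z) \<otimes> (x z \<otimes> k) = k" if "k \<in> carrier K" for k
      using that clo by (simp flip: m_assoc)
    then show eq: "inv (x z) \<otimes> d z \<otimes> x (sig \<sigma> z) = s (pt z (- int (e z)))"
      using clo by (simp add: d_def m_assoc)
    show "d z \<in> centraliser K (carrier K) (F (rep (load K \<Gamma> z)))"
      using intertwiner_iff[OF z sz dc] rec z dc unfolding eq by (simp add: centraliser_def)
  qed
  have cz: "c (load K \<Gamma> z) (terr K \<Gamma> z) = d z" if z: "z \<in> cyc" for z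
    using z load_in_loads[OF z] inv_into_f_f[OF terr_inj z] by (simp add: c_def cycles_load_iff)
  have "c \<in> (\<Pi>\<^sub>E L\<in>loads K \<Gamma> u. \<Pi>\<^sub>E T\<in>terr K \<Gamma> ` cycles_load K \<Gamma> L u. centraliser K (carrier K) (F (rep L)))"
  proof (rule PiE_I)
    fix L assume L: "L \<in> loads K \<Gamma> u"
    show "c L \<in> (\<Pi>\<^sub>E T\<in>terr K \<Gamma> ` cycles_load K \<Gamma> L u. centraliser K (carrier K) (F (rep L)))"
    proof (rule PiE_I)
      fix T assume "T \<in> terr K \<Gamma> ` cycles_load K \<Gamma> L u"
      then obtain z where "z \<in> cyc" "load K \<Gamma> z = L" "T = terr K \<Gamma> z"
        unfolding cycles_load_def by blast
      then show "c L T \<in> centraliser K (carrier K) (F (rep L))"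
        using cz[of z] dz(1)[of z] by simp
    qed (simp add: c_def L)
  qed (simp add: c_def)
  then have cB: "(c, c0) \<in> carrier (base_kernel K \<Gamma> u gam rep)"
    unfolding base_kernel_carrier using s by (auto simp: c0_def)
  note v = phi_value[OF tp fac, where c = c and d = c0]
  have "fst (phi K \<Gamma> u gam x ((c, c0), t)) = s"
  proof
    fix \<gamma>
    show "fst (phi K \<Gamma> u gam x ((c, c0), t)) \<gamma> = s \<gamma>"
    proof (cases "\<gamma> \<in> \<Gamma>")
      case True
      then show ?thesis
      proof (cases rule: point_cases)
        case (1 z j)
        obtain k where k: "0 \<le> k" "k < len z" "pt z j = pt z (k - int (e z))"
          using pt_shifted[OF 1(1)] by blast
        have "cval c z (sig \<sigma> z) = s (pt z (- int (e z)))"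
          unfolding cval_def cz[OF 1(1)] by (rule dz(2)[OF 1(1)])
        then show ?thesis using v(3)[OF 1(1) k(1,2)] rec k 1 by simp
      next
        case 2
        then show ?thesis using v(4)[of \<gamma>] True by (simp add: c0_def)
      qed
    next
      case False
      then show ?thesis using v(2) s by (simp add: extensional_def PiE_iff)
    qed
  qed
  then have "phi K \<Gamma> u gam x ((c, c0), t) = b" using v(1) by (simp add: st prod_eq_iff)
  with cB t show thesis by (rule that)
qed

lemma phi_bij:
  assumes H: "subgroup H (sym_right \<Gamma>)"
  shows "bij_betw (phi K \<Gamma> u gam x) (carrier (base_kernel K \<Gamma> u gam rep) \<times> terr_stab K \<Gamma> H u)
    (centraliser (swreath K \<Gamma>) (carrier (wreath K \<Gamma> H)) u)"
proof (rule bij_betwI')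
  fix p q assume "p \<in> carrier (base_kernel K \<Gamma> u gam rep) \<times> terr_stab K \<Gamma> H u"
    "q \<in> carrier (base_kernel K \<Gamma> u gam rep) \<times> terr_stab K \<Gamma> H u"
  then obtain c c0 t d d0 t' where
    "p = ((c, c0), t)" "(c, c0) \<in> carrier (base_kernel K \<Gamma> u gam rep)" "t \<in> terr_stab K \<Gamma> H u"
    "q = ((d, d0), t')" "(d, d0) \<in> carrier (base_kernel K \<Gamma> u gam rep)" "t' \<in> terr_stab K \<Gamma> H u"
    by (metis SigmaE prod.collapse)
  then show "phi K \<Gamma> u gam x p = phi K \<Gamma> u gam x q \<longleftrightarrow> p = q" using phi_inj[OF H] by blast
next
  fix p assume "p \<in> carrier (base_kernel K \<Gamma> u gam rep) \<times> terr_stab K \<Gamma> H u"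
  then show "phi K \<Gamma> u gam x p \<in> centraliser (swreath K \<Gamma>) (carrier (wreath K \<Gamma> H)) u"
    using phi_in_centraliser[OF H] by (metis SigmaE prod.collapse)
next
  fix b assume "b \<in> centraliser (swreath K \<Gamma>) (carrier (wreath K \<Gamma> H)) u"
  then obtain c c0 t where "(c, c0) \<in> carrier (base_kernel K \<Gamma> u gam rep)" "t \<in> terr_stab K \<Gamma> H u"
    "phi K \<Gamma> u gam x ((c, c0), t) = b" using phi_surj[OF H] by metis
  then show "\<exists>p\<in>carrier (base_kernel K \<Gamma> u gam rep) \<times> terr_stab K \<Gamma> H u. b = phi K \<Gamma> u gam x p"
    by blast
qed

section \<open>The extension\<close>

lemma id_in_terr_stab:
  assumes H: "subgroup H (sym_right \<Gamma>)"
  shows "id \<in> terr_stab K \<Gamma> H u"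
proof -
  have "\<one>\<^bsub>swreath K \<Gamma>\<^esub> \<otimes>\<^bsub>swreath K \<Gamma>\<^esub> u = u \<otimes>\<^bsub>swreath K \<Gamma>\<^esub> \<one>\<^bsub>swreath K \<Gamma>\<^esub>" using u by simp
  then show ?thesis
    using centraliser_top_in_terr_stab[OF u wr.one_closed, of H] subgroup.one_closed[OF H]
    by (simp add: wreath_one)
qed

lemma phi_id_factorisation:
  "is_top_factorisation K \<Gamma> u gam id (\<lambda>z\<in>cyc. 0) (\<lambda>L\<in>loads K \<Gamma> u. id) id"
  unfolding is_top_factorisation_iff[OF permutes_id]
proof (intro conjI)
  show "(\<lambda>z\<in>cyc. 0) \<in> (\<Pi>\<^sub>E z\<in>cyc. {0..<top_order \<Gamma> z})"
    using len_pos by auto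
  show "(\<lambda>L\<in>loads K \<Gamma> u. id) \<in> load_perms" by (simp add: permutes_id)
  show "\<forall>z\<in>cyc. \<forall>j. id (pt z j) = pt (sig (\<lambda>L\<in>loads K \<Gamma> u. id) z) (j + int ((\<lambda>z\<in>cyc. 0) z))"
    using load_in_loads by simp
qed (simp_all add: permutes_id)

text \<open>For the trivial top component no cycle is shifted, so there is a single value on each territory.\<close>

lemma phi_id:
  "snd (phi K \<Gamma> u gam x ((c, c0), id)) = id"
  "z \<in> cyc \<Longrightarrow> fst (phi K \<Gamma> u gam x ((c, c0), id)) (pt z j) = cval c z z"
  "\<gamma> \<in> \<Gamma> - terr K \<Gamma> u \<Longrightarrow> fst (phi K \<Gamma> u gam x ((c, c0), id)) \<gamma> = c0 \<gamma>"
proof -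
  note v = phi_value[OF permutes_id phi_id_factorisation, where c = c and d = c0]
  show "snd (phi K \<Gamma> u gam x ((c, c0), id)) = id" by (rule v(1))
  show "\<gamma> \<in> \<Gamma> - terr K \<Gamma> u \<Longrightarrow> fst (phi K \<Gamma> u gam x ((c, c0), id)) \<gamma> = c0 \<gamma>" by (rule v(4))
  assume z: "z \<in> cyc"
  have "0 \<le> j mod len z" "j mod len z < len z" using len_pos[OF z] by simp_all
  then show "fst (phi K \<Gamma> u gam x ((c, c0), id)) (pt z j) = cval c z z"
    using v(3)[OF z, of "j mod len z"] load_in_loads[OF z] z pt_mod[OF z, of j] by (auto split: if_splits)
qed

lemma base_kernel_mult:
  "(c, c0) \<otimes>\<^bsub>base_kernel K \<Gamma> u gam rep\<^esub> (d, d0) =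
    ((\<lambda>L\<in>loads K \<Gamma> u. \<lambda>T\<in>terr K \<Gamma> ` cycles_load K \<Gamma> L u. c L T \<otimes> d L T),
     (\<lambda>\<gamma>\<in>\<Gamma> - terr K \<Gamma> u. c0 \<gamma> \<otimes> d0 \<gamma>))"
  by (simp add: base_kernel_def DirProd_def)

lemma group_base_kernel: "group (base_kernel K \<Gamma> u gam rep)"
  unfolding base_kernel_def
proof (rule DirProd_group)
  show "group (fun_group K (\<Gamma> - terr K \<Gamma> u))" by (rule product_group) (rule group_axioms)
  show "group (product_group (loads K \<Gamma> u)
       (\<lambda>L. product_group (terr K \<Gamma> ` cycles_load K \<Gamma> L u)
         (\<lambda>_. K\<lparr>carrier := centraliser K (carrier K) (F (rep L))\<rparr>)))"
  proof (intro product_group)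
    fix L assume "L \<in> loads K \<Gamma> u"
    then have "F (rep L) \<in> carrier K"
      using rep_props(1) F_closed by (simp add: cycles_load_iff)
    then show "group (K\<lparr>carrier := centraliser K (carrier K) (F (rep L))\<rparr>)"
      by (intro subgroup.subgroup_is_group[OF subgroup_centraliser[OF subgroup_self]] group_axioms)
  qed
qed

text \<open>On each territory \<open>\<Phi>\<close> conjugates the component of \<open>c\<close> by the same element \<open>x z\<close>.\<close>

lemma phi_id_hom:
  assumes H: "subgroup H (sym_right \<Gamma>)"
    and p: "p \<in> carrier (base_kernel K \<Gamma> u gam rep)" and q: "q \<in> carrier (base_kernel K \<Gamma> u gam rep)"
  shows "phi K \<Gamma> u gam x (p \<otimes>\<^bsub>base_kernel K \<Gamma> u gam rep\<^esub> q, id) =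
    phi K \<Gamma> u gam x (p, id) \<otimes>\<^bsub>swreath K \<Gamma>\<^esub> phi K \<Gamma> u gam x (q, id)"
proof -
  interpret B: group "base_kernel K \<Gamma> u gam rep" by (rule group_base_kernel)
  obtain c c0 d d0 where pq: "p = (c, c0)" "q = (d, d0)" by (cases p, cases q)
  have c: "(c, c0) \<in> carrier (base_kernel K \<Gamma> u gam rep)" and d: "(d, d0) \<in> carrier (base_kernel K \<Gamma> u gam rep)"
    using p q pq by simp_all
  obtain m m0 where m: "p \<otimes>\<^bsub>base_kernel K \<Gamma> u gam rep\<^esub> q = (m, m0)" by fastforce
  have mB: "(m, m0) \<in> carrier (base_kernel K \<Gamma> u gam rep)" using B.m_closed[OF p q] m by simp
  have m': "m = (\<lambda>L\<in>loads K \<Gamma> u. \<lambda>T\<in>terr K \<Gamma> ` cycles_load K \<Gamma> L u. c L T \<otimes> d L T)"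
    "m0 = (\<lambda>\<gamma>\<in>\<Gamma> - terr K \<Gamma> u. c0 \<gamma> \<otimes> d0 \<gamma>)"
    using m by (simp_all add: pq base_kernel_mult)
  have car: "phi K \<Gamma> u gam x ((k, k0), id) \<in> carrier (swreath K \<Gamma>)"
    if "(k, k0) \<in> carrier (base_kernel K \<Gamma> u gam rep)" for k k0
    using phi_in_centraliser[OF H that id_in_terr_stab[OF H]]
    unfolding centraliser_def wreath_carrier_swreath_iff[OF H] by blast
  have "phi K \<Gamma> u gam x ((m, m0), id) =
    phi K \<Gamma> u gam x ((c, c0), id) \<otimes>\<^bsub>swreath K \<Gamma>\<^esub> phi K \<Gamma> u gam x ((d, d0), id)"
  proof (rule swreath_eqI)
    show "phi K \<Gamma> u gam x ((m, m0), id) \<in> carrier (swreath K \<Gamma>)" by (rule car[OF mB])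
    show "phi K \<Gamma> u gam x ((c, c0), id) \<otimes>\<^bsub>swreath K \<Gamma>\<^esub> phi K \<Gamma> u gam x ((d, d0), id) \<in> carrier (swreath K \<Gamma>)"
      using car[OF c] car[OF d] by simp
    fix \<gamma> assume g: "\<gamma> \<in> \<Gamma>"
    show "snd (phi K \<Gamma> u gam x ((m, m0), id)) \<gamma> =
      snd (phi K \<Gamma> u gam x ((c, c0), id) \<otimes>\<^bsub>swreath K \<Gamma>\<^esub> phi K \<Gamma> u gam x ((d, d0), id)) \<gamma>"
      by (simp add: phi_id(1) wreath_mult)
    show "fst (phi K \<Gamma> u gam x ((m, m0), id)) \<gamma> =
      fst (phi K \<Gamma> u gam x ((c, c0), id) \<otimes>\<^bsub>swreath K \<Gamma>\<^esub> phi K \<Gamma> u gam x ((d, d0), id)) \<gamma>"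
      using g
    proof (cases rule: point_cases)
      case (1 z j)
      note z = 1(1)
      have "cval m z z = cval c z z \<otimes> cval d z z"
      proof -
        let ?c = "c (load K \<Gamma> z) (terr K \<Gamma> z)" and ?d = "d (load K \<Gamma> z) (terr K \<Gamma> z)"
        have clo: "x z \<in> carrier K" "?c \<in> carrier K" "?d \<in> carrier K"
          using x_props(1)[OF z] base_kernel_comp(1)[OF c z] base_kernel_comp(1)[OF d z] by auto
        have "m (load K \<Gamma> z) (terr K \<Gamma> z) = ?c \<otimes> ?d"
          using z load_in_loads[OF z] by (simp add: m' cycles_load_iff)
        moreover have "x z \<otimes> (inv (x z) \<otimes> k) = k" if "k \<in> carrier K" for k
          using that clo by (simp flip: m_assoc)
        ultimately show ?thesis using clo by (simp add: cval_def m_assoc)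
      qed
      then show ?thesis using g unfolding 1(2) by (simp add: wreath_mult phi_id(2)[OF z] phi_id(1))
    next
      case 2
      then show ?thesis using g by (simp add: wreath_mult phi_id(1,3) m')
    qed
  qed
  then show ?thesis unfolding m unfolding pq .
qed

text \<open>Conjugation by \<open>a\<close> carries the parametrisation of the centraliser of \<open>u\<close> to that of \<open>w\<close>. The top
projection maps onto the stabiliser because every \<open>t\<close> occurs together with the trivial \<open>c\<close>, and
its kernel consists of the parameters with \<open>t = 1\<close>. That the stabiliser is a group comes for free:
it is the image of a homomorphism.\<close>

lemma centraliser_short_exact:
  assumes H: "subgroup H (sym_right \<Gamma>)" and w: "w \<in> carrier (swreath K \<Gamma>)"
    and a: "a \<in> carrier (fun_group K \<Gamma>) \<times> {\<one>\<^bsub>sym_right \<Gamma>\<^esub>}"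
    and uw: "u = inv\<^bsub>swreath K \<Gamma>\<^esub> a \<otimes>\<^bsub>swreath K \<Gamma>\<^esub> w \<otimes>\<^bsub>swreath K \<Gamma>\<^esub> a"
  defines "B \<equiv> base_kernel K \<Gamma> u gam rep"
    and "C \<equiv> centraliser (swreath K \<Gamma>) (carrier (wreath K \<Gamma> H))"
    and "\<Phi> \<equiv> phi K \<Gamma> u gam x"
    and "f \<equiv> (\<lambda>b. a \<otimes>\<^bsub>swreath K \<Gamma>\<^esub> b \<otimes>\<^bsub>swreath K \<Gamma>\<^esub> inv\<^bsub>swreath K \<Gamma>\<^esub> a)"
  shows "snd u = snd w" and "C w = f ` C u"
    and "bij_betw \<Phi> (carrier B \<times> terr_stab K \<Gamma> H u) (C u)"
    and "bij_betw (\<lambda>p. f (\<Phi> p)) (carrier B \<times> terr_stab K \<Gamma> H u) (C w)"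
    and "is_short_exact B ((swreath K \<Gamma>)\<lparr>carrier := C w\<rparr>)
      ((sym_right \<Gamma>)\<lparr>carrier := terr_stab K \<Gamma> H w\<rparr>) (\<lambda>c. f (\<Phi> (c, \<one>\<^bsub>sym_right \<Gamma>\<^esub>))) (\<lambda>(s, t). t)"
proof -
  let ?S = "swreath K \<Gamma>" and ?P = "sym_right \<Gamma>"
  interpret p: group_hom ?S ?P snd by (rule snd_hom)
  interpret B: group B unfolding B_def by (rule group_base_kernel)
  note aW = base_in_wreath[OF H a] and Wsub = subgroup_wreath[OF H]
  have aS: "a \<in> carrier ?S" using aW(1) unfolding wreath_carrier_swreath_iff[OF H] by blast
  have wa: "w \<otimes>\<^bsub>?S\<^esub> a = a \<otimes>\<^bsub>?S\<^esub> u" unfolding uw using aS w by (simp flip: wr.m_assoc)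
  note same = terr_stab_base_conj[OF w aS u wa aW(2)]
  show top: "snd u = snd w" by (rule same(1))
  have stab: "terr_stab K \<Gamma> H u = terr_stab K \<Gamma> H w" by (rule same(2))
  show Cw: "C w = f ` C u"
    unfolding C_def f_def uw by (rule wr.centraliser_conj[OF Wsub aW(1) w])
  show \<Phi>: "bij_betw \<Phi> (carrier B \<times> terr_stab K \<Gamma> H u) (C u)"
    unfolding \<Phi>_def B_def C_def by (rule phi_bij[OF H])
  have Csub: "C v \<subseteq> carrier ?S" for v
    unfolding C_def centraliser_def using wreath_carrier_swreath_iff[OF H] by blast
  have f_hom: "f (b \<otimes>\<^bsub>?S\<^esub> c) = f b \<otimes>\<^bsub>?S\<^esub> f c" if "b \<in> carrier ?S" "c \<in> carrier ?S" for b c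
  proof -
    have "inv\<^bsub>?S\<^esub> a \<otimes>\<^bsub>?S\<^esub> (a \<otimes>\<^bsub>?S\<^esub> z) = z" if "z \<in> carrier ?S" for z
      using aS that by (simp flip: wr.m_assoc)
    then show ?thesis using that aS by (simp add: f_def wr.m_assoc)
  qed
  have f_inj: "inj_on f (C u)"
  proof (rule inj_onI)
    fix b c assume bc: "b \<in> C u" "c \<in> C u" "f b = f c"
    then have bcS: "b \<in> carrier ?S" "c \<in> carrier ?S" using Csub by blast+
    have "a \<otimes>\<^bsub>?S\<^esub> b = a \<otimes>\<^bsub>?S\<^esub> c"
      using bc(3) aS bcS unfolding f_def by (metis wr.inv_closed wr.m_closed wr.right_cancel)
    then show "b = c" using aS bcS by (metis wr.Units_eq wr.Units_l_cancel)
  qed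
  have snd_f: "snd (f b) = snd b" if "b \<in> C u" for b
    unfolding f_def using snd_conj_base[OF aS aW(2)] that Csub by blast
  have "bij_betw f (C u) (C w)" using f_inj Cw by (simp add: bij_betw_def)
  then show f\<Phi>: "bij_betw (\<lambda>p. f (\<Phi> p)) (carrier B \<times> terr_stab K \<Gamma> H u) (C w)"
    using bij_betw_trans[OF \<Phi>] by (simp add: comp_def)
  have snd_\<Phi>: "snd (\<Phi> (c, t)) = t" if t: "t \<in> terr_stab K \<Gamma> H u" for c t
  proof -
    have tp: "t permutes \<Gamma>"
      using t subgroup.subset[OF H] by (auto simp: terr_stab_iff sym_right_carrier)
    obtain e \<sigma> \<pi>0 where "is_top_factorisation K \<Gamma> u gam t e \<sigma> \<pi>0"
      using top_factorisation_exists[OF tp t] by blast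
    then show ?thesis using phi_value(1)[OF tp] unfolding \<Phi>_def by (cases c) blast
  qed
  have \<Phi>_C: "\<Phi> (c, t) \<in> C u" if "c \<in> carrier B" "t \<in> terr_stab K \<Gamma> H u" for c t
    using bij_betwE[OF \<Phi>] that by blast
  have f\<Phi>_top: "snd (f (\<Phi> (c, t))) = t" if "c \<in> carrier B" "t \<in> terr_stab K \<Gamma> H u" for c t
    using snd_f[OF \<Phi>_C[OF that]] snd_\<Phi>[OF that(2)] by simp
  have idst: "id \<in> terr_stab K \<Gamma> H u" by (rule id_in_terr_stab[OF H])
  have CwS: "subgroup (C w) ?S" unfolding C_def by (rule wr.subgroup_centraliser[OF Wsub w])
  have img: "snd ` C w = terr_stab K \<Gamma> H w"
  proof -
    have "snd ` C w = (\<lambda>p. snd (f (\<Phi> p))) ` (carrier B \<times> terr_stab K \<Gamma> H u)"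
      unfolding bij_betw_imp_surj_on[OF f\<Phi>, symmetric] image_image ..
    also have "\<dots> = snd ` (carrier B \<times> terr_stab K \<Gamma> H u)"
      by (rule image_cong[OF refl]) (use f\<Phi>_top in auto)
    also have "\<dots> = terr_stab K \<Gamma> H u" using B.one_closed by force
    finally show ?thesis using stab by simp
  qed
  have Tsub: "subgroup (terr_stab K \<Gamma> H w) ?P"
    using p.subgroup_img_is_subgroup[OF CwS] unfolding img .
  have pr: "(\<lambda>(s, t). t) = snd" by auto
  show "is_short_exact B (?S\<lparr>carrier := C w\<rparr>) (?P\<lparr>carrier := terr_stab K \<Gamma> H w\<rparr>)
      (\<lambda>c. f (\<Phi> (c, \<one>\<^bsub>?P\<^esub>))) (\<lambda>(s, t). t)"
    unfolding is_short_exact_def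
  proof (intro conjI)
    show "group B" by (rule B.group_axioms)
    show "group (?S\<lparr>carrier := C w\<rparr>)" by (rule subgroup.subgroup_is_group[OF CwS wr.group_axioms])
    show "group (?P\<lparr>carrier := terr_stab K \<Gamma> H w\<rparr>)"
      by (rule subgroup.subgroup_is_group[OF Tsub sym.group_axioms])
    show "(\<lambda>c. f (\<Phi> (c, \<one>\<^bsub>?P\<^esub>))) \<in> mon B (?S\<lparr>carrier := C w\<rparr>)"
      unfolding mon_def mem_Collect_eq
    proof
      show "(\<lambda>c. f (\<Phi> (c, \<one>\<^bsub>?P\<^esub>))) \<in> hom B (?S\<lparr>carrier := C w\<rparr>)"
      proof (rule homI)
        fix c assume c: "c \<in> carrier B"
        show "f (\<Phi> (c, \<one>\<^bsub>?P\<^esub>)) \<in> carrier (?S\<lparr>carrier := C w\<rparr>)"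
          using \<Phi>_C[OF c idst] Cw by simp
        fix d assume d: "d \<in> carrier B"
        have "\<Phi> (c \<otimes>\<^bsub>B\<^esub> d, id) = \<Phi> (c, id) \<otimes>\<^bsub>?S\<^esub> \<Phi> (d, id)"
          using phi_id_hom[OF H, of c d] c d unfolding B_def \<Phi>_def by blast
        then show "f (\<Phi> (c \<otimes>\<^bsub>B\<^esub> d, \<one>\<^bsub>?P\<^esub>)) =
          f (\<Phi> (c, \<one>\<^bsub>?P\<^esub>)) \<otimes>\<^bsub>?S\<lparr>carrier := C w\<rparr>\<^esub> f (\<Phi> (d, \<one>\<^bsub>?P\<^esub>))"
          using f_hom[OF subsetD[OF Csub \<Phi>_C[OF c idst]] subsetD[OF Csub \<Phi>_C[OF d idst]]] by simp
      qed
      show "inj_on (\<lambda>c. f (\<Phi> (c, \<one>\<^bsub>?P\<^esub>))) (carrier B)"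
      proof (rule inj_onI)
        fix c d assume cd: "c \<in> carrier B" "d \<in> carrier B" "f (\<Phi> (c, \<one>\<^bsub>?P\<^esub>)) = f (\<Phi> (d, \<one>\<^bsub>?P\<^esub>))"
        then have "(c, id :: 'g \<Rightarrow> 'g) = (d, id)"
          using inj_onD[OF bij_betw_imp_inj_on[OF f\<Phi>], of "(c, id)" "(d, id)"] idst by simp
        then show "c = d" by simp
      qed
    qed
    show "(\<lambda>(s, t). t) \<in> epi (?S\<lparr>carrier := C w\<rparr>) (?P\<lparr>carrier := terr_stab K \<Gamma> H w\<rparr>)"
      unfolding epi_def mem_Collect_eq pr
    proof
      show "snd \<in> hom (?S\<lparr>carrier := C w\<rparr>) (?P\<lparr>carrier := terr_stab K \<Gamma> H w\<rparr>)"
        by (rule homI) (use img in \<open>auto simp: wreath_mult\<close>)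
      show "snd ` carrier (?S\<lparr>carrier := C w\<rparr>) = carrier (?P\<lparr>carrier := terr_stab K \<Gamma> H w\<rparr>)"
        using img by simp
    qed
    show "(\<lambda>c. f (\<Phi> (c, \<one>\<^bsub>?P\<^esub>))) ` carrier B =
      kernel (?S\<lparr>carrier := C w\<rparr>) (?P\<lparr>carrier := terr_stab K \<Gamma> H w\<rparr>) (\<lambda>(s, t). t)"
    proof (rule subset_antisym)
      show "(\<lambda>c. f (\<Phi> (c, \<one>\<^bsub>?P\<^esub>))) ` carrier B \<subseteq>
        kernel (?S\<lparr>carrier := C w\<rparr>) (?P\<lparr>carrier := terr_stab K \<Gamma> H w\<rparr>) (\<lambda>(s, t). t)"
        unfolding kernel_def pr using f\<Phi>_top[OF _ idst] \<Phi>_C[OF _ idst] Cw by auto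
      show "kernel (?S\<lparr>carrier := C w\<rparr>) (?P\<lparr>carrier := terr_stab K \<Gamma> H w\<rparr>) (\<lambda>(s, t). t) \<subseteq>
        (\<lambda>c. f (\<Phi> (c, \<one>\<^bsub>?P\<^esub>))) ` carrier B"
      proof
        fix b assume "b \<in> kernel (?S\<lparr>carrier := C w\<rparr>) (?P\<lparr>carrier := terr_stab K \<Gamma> H w\<rparr>) (\<lambda>(s, t). t)"
        then have b: "b \<in> C w" "snd b = id" by (simp_all add: kernel_def pr)
        then have "b \<in> (\<lambda>p. f (\<Phi> p)) ` (carrier B \<times> terr_stab K \<Gamma> H u)"
          using bij_betw_imp_surj_on[OF f\<Phi>] by simp
        then obtain c t where ct: "c \<in> carrier B" "t \<in> terr_stab K \<Gamma> H u" "b = f (\<Phi> (c, t))" by blast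
        then have "t = id" using f\<Phi>_top b(2) by simp
        then show "b \<in> (\<lambda>c. f (\<Phi> (c, \<one>\<^bsub>?P\<^esub>))) ` carrier B" using ct by simp
      qed
    qed
  qed
qed

end

theorem theorem2:
  fixes K :: "('k, 'm) monoid_scheme"
    and \<Gamma> :: "'g set"
    and H :: "('g \<Rightarrow> 'g) set"
    and w :: "('g \<Rightarrow> 'k) \<times> ('g \<Rightarrow> 'g)"
  assumes "group K"
    and "finite \<Gamma>"
    and "subgroup H (sym_right \<Gamma>)"
    and "w \<in> carrier (swreath K \<Gamma>)"
  shows
    "let S = swreath K \<Gamma>;
         W = carrier (wreath K \<Gamma> H);
         h = snd w;
         base = carrier (fun_group K \<Gamma>) \<times> {\<one>\<^bsub>sym_right \<Gamma>\<^esub>}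
     in
     (\<exists>a\<in>base. sparse_decomp K \<Gamma> (inv\<^bsub>S\<^esub> a \<otimes>\<^bsub>S\<^esub> w \<otimes>\<^bsub>S\<^esub> a)) \<and>
     (\<forall>a\<in>base. \<forall>u gam rep x.
        u = inv\<^bsub>S\<^esub> a \<otimes>\<^bsub>S\<^esub> w \<otimes>\<^bsub>S\<^esub> a \<longrightarrow>
        sparse_decomp K \<Gamma> u \<longrightarrow>
        wreath_choices K \<Gamma> u gam rep x \<longrightarrow>
        (let B = base_kernel K \<Gamma> u gam rep;
             \<Phi> = phi K \<Gamma> u gam x;
             D = carrier B \<times> terr_stab K \<Gamma> H u
         in
           snd u = h \<and>
           centraliser S W w = (\<lambda>b. a \<otimes>\<^bsub>S\<^esub> b \<otimes>\<^bsub>S\<^esub> inv\<^bsub>S\<^esub> a) ` centraliser S W u \<and>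
           bij_betw \<Phi> D (centraliser S W u) \<and>
           bij_betw (\<lambda>p. a \<otimes>\<^bsub>S\<^esub> \<Phi> p \<otimes>\<^bsub>S\<^esub> inv\<^bsub>S\<^esub> a) D (centraliser S W w) \<and>
           is_short_exact B
             (S\<lparr>carrier := centraliser S W w\<rparr>)
             ((sym_right \<Gamma>)\<lparr>carrier := terr_stab K \<Gamma> H w\<rparr>)
             (\<lambda>c. a \<otimes>\<^bsub>S\<^esub> \<Phi> (c, \<one>\<^bsub>sym_right \<Gamma>\<^esub>) \<otimes>\<^bsub>S\<^esub> inv\<^bsub>S\<^esub> a)
             (\<lambda>(s, t). t)))"
proof -
  interpret finite_wreath K \<Gamma>
    using assms(1,2) by (simp add: finite_wreath_def finite_wreath_axioms_def)
  show ?thesis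
    unfolding Let_def
  proof (intro conjI ballI allI impI sparse_conjugate_exists[OF assms(4)])
    fix a u gam rep x
    assume a: "a \<in> carrier (fun_group K \<Gamma>) \<times> {\<one>\<^bsub>sym_right \<Gamma>\<^esub>}"
      and uw: "u = inv\<^bsub>swreath K \<Gamma>\<^esub> a \<otimes>\<^bsub>swreath K \<Gamma>\<^esub> w \<otimes>\<^bsub>swreath K \<Gamma>\<^esub> a"
      and choices: "wreath_choices K \<Gamma> u gam rep x"
    have "a \<in> carrier (swreath K \<Gamma>)"
      using base_in_wreath(1)[OF sym.subgroup_self a] by simp
    then have "u \<in> carrier (swreath K \<Gamma>)" using assms(4) by (simp add: uw)
    then interpret sparse_element K \<Gamma> u gam rep x
      using choices by unfold_locales
    note main = centraliser_short_exact[OF assms(3,4) a uw]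
    show "snd u = snd w" by (rule main(1))
    show "centraliser (swreath K \<Gamma>) (carrier (wreath K \<Gamma> H)) w =
      (\<lambda>b. a \<otimes>\<^bsub>swreath K \<Gamma>\<^esub> b \<otimes>\<^bsub>swreath K \<Gamma>\<^esub> inv\<^bsub>swreath K \<Gamma>\<^esub> a) `
        centraliser (swreath K \<Gamma>) (carrier (wreath K \<Gamma> H)) u" by (rule main(2))
    show "bij_betw (phi K \<Gamma> u gam x) (carrier (base_kernel K \<Gamma> u gam rep) \<times> terr_stab K \<Gamma> H u)
      (centraliser (swreath K \<Gamma>) (carrier (wreath K \<Gamma> H)) u)" by (rule main(3))
    show "bij_betw (\<lambda>p. a \<otimes>\<^bsub>swreath K \<Gamma>\<^esub> phi K \<Gamma> u gam x p \<otimes>\<^bsub>swreath K \<Gamma>\<^esub> inv\<^bsub>swreath K \<Gamma>\<^esub> a)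
      (carrier (base_kernel K \<Gamma> u gam rep) \<times> terr_stab K \<Gamma> H u)
      (centraliser (swreath K \<Gamma>) (carrier (wreath K \<Gamma> H)) w)" by (rule main(4))
    show "is_short_exact (base_kernel K \<Gamma> u gam rep)
      ((swreath K \<Gamma>)\<lparr>carrier := centraliser (swreath K \<Gamma>) (carrier (wreath K \<Gamma> H)) w\<rparr>)
      ((sym_right \<Gamma>)\<lparr>carrier := terr_stab K \<Gamma> H w\<rparr>)
      (\<lambda>c. a \<otimes>\<^bsub>swreath K \<Gamma>\<^esub> phi K \<Gamma> u gam x (c, \<one>\<^bsub>sym_right \<Gamma>\<^esub>) \<otimes>\<^bsub>swreath K \<Gamma>\<^esub> inv\<^bsub>swreath K \<Gamma>\<^esub> a)
      (\<lambda>(s, t). t)" by (rule main(5))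
  qed
qed

end
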